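(* Let $\alpha\in\widetilde{\Delta}_{\min}$ and define $$M_{\alpha,q}=\{\omega\in E_q \mid f_\alpha(\omega(\mathscr{C}_q))=\omega(\mathscr{C}_q)\}.$$ Let $V_\alpha=\{v\in V\mid f_\alpha(v)=v\}$. If $V_\alpha$ is contained in some hyperplane belonging to $\mathcal{H}_q$, then $|M_{\alpha,q}|=0$. Otherwise (i.e. if $V_\alpha$ is contained in no hyperplane of $\mathcal{H}_q$), $|M_{\alpha,q}|=q^{\dim V_\alpha}$.
   Context: Let $p$ be a prime, $q$ a power of $p$, and $\mathbf{G}$ a simple algebraic group over $\overline{\mathbb{F}}_p$ (irreducible root system, any isogeny type), defined over $\mathbb{F}_q$ with Frobenius map $F$, where $F$ is the composition of a split Frobenius map with a graph automorphism coming from a (possibly trivial) symmetry $\rho$ of the Dynkin diagram $\Delta$. Let $\mathbf{T}$ be an $F$-stable maximal torus contained in an $F$-stable Borel subgroup; $\Phi$ the root system, $\Delta$ the simple roots, $\alpha^\vee$ the coroots, $Y(\mathbf{T})$ the cocharacter group, $W$ the Weyl group, $\langle\,,\rangle$ the pairing between characters and cocharacters. Put $V=\mathbb{Q}\otimes_{\mathbb{Z}}Y(\mathbf{T})$, on which $W$ acts linearly by $s_\alpha(v)=v-\langle\alpha,v\rangle\alpha^\vee$. Let $(\varpi_\alpha^\vee)_{\alpha\in\Delta}$ be the basis of $V$ dual to $\Delta$, and $Y(\mathbf{T}_{\rm sc})=\bigoplus_{\alpha\in\Delta}\mathbb{Z}\alpha^\vee$. The action of $F$ on $Y(\mathbf{T})$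 extends to $V$ as $F=qF_0$ with $F_0$ linear, $F_0(\varpi^\vee_\alpha)=\varpi^\vee_{\rho^{-1}(\alpha)}$. Let $\alpha_0=\sum_{\alpha\in\Delta}n_\alpha\alpha$ be the highest root, $\widetilde\Delta=\Delta\cup\{-\alpha_0\}$, with the conventions $n_{-\alpha_0}=1$ and $\varpi^\vee_{-\alpha_0}=0$, and $\widetilde\Delta_{\min}=\{\alpha\in\widetilde\Delta\mid n_\alpha=1\}$. For $\alpha\in\widetilde\Delta_{\min}$ put $z_\alpha=w_\alpha w_0$, where $w_0$ and $w_\alpha$ are the longest elements of $W$ and of the parabolic subgroup $W_{\Delta\setminus\{\alpha\}}$ (so $z_{-\alpha_0}=1$), and let $f_\alpha:V\to V$, $f_\alpha(v)=z_\alpha(v)+\varpi_\alpha^\vee$. Let $\mathscr{C}=\{\lambda\in V\mid \langle\alpha,\lambda\rangle\ge 0\ \forall\alpha\in\Delta,\ \langle\alpha_0,\lambda\rangle\le 1\}$; each $f_\alpha$ stabilizes $\mathscr{C}$. Let $W_{a,q}=F^{-1}(Y(\mathbf{T}_{\rm sc}))\rtimes W$, acting on $V$ by affine transformations (translations and linear maps), $\mathscr{C}_q=\{v\in V\mid F(v)\in\mathscr{C}\}$, $E_q=\{\omega\in W_{a,q}\mid\omega(\mathscr{C}_q)\subseteq\mathscr{C}\}$, and let $\mathcal{H}_q$ be the collection of all hyperplanes of affine reflections in $W_{a,q}$, i.e. the hyperplanes $\{v\in V\mid\langle\beta,v\rangle=k/q\}$ with $\beta\in\Phi$, $k\in\mathbb{Z}$.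 *)

theory Defs
  imports "HOL-Analysis.Analysis" "HOL-Computational_Algebra.Primes"
begin

text \<open>
  The statement about a simple algebraic group \<open>G\<close> with maximal torus \<open>T\<close> involves only the root
  datum of \<open>(G, T)\<close> and the map induced by Frobenius on \<open>Y(T)\<close>. A \<open>\<int>\<close>-basis of \<open>Y(T)\<close>, together with
  the dual basis of \<open>X(T)\<close>, identifies \<open>Y(T)\<close> and \<open>X(T)\<close> with \<open>\<int>\<^sup>n\<close> (\<open>n\<close> the rank of \<open>G\<close>), paired by the
  standard bilinear form, and \<open>V = \<rat> \<otimes> Y(T)\<close> with \<open>\<rat>\<^sup>n\<close>. Roots are vectors of \<open>X(T)\<close>, coroots are vectors
  of \<open>Y(T)\<close>. Every isogeny type is covered: it is determined by how the integral roots and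
  coroots sit in \<open>\<int>\<^sup>n\<close>.
\<close>

definition pairing :: "rat ^ 'n \<Rightarrow> rat ^ 'n \<Rightarrow> rat"
  where "pairing x y = (\<Sum>i\<in>UNIV. x $ i * y $ i)"

definition integral_vectors :: "(rat ^ 'n) set"
  where "integral_vectors = {v. \<forall>i. v $ i \<in> \<int>}"

definition root_refl :: "(rat ^ 'n \<Rightarrow> rat ^ 'n) \<Rightarrow> rat ^ 'n \<Rightarrow> rat ^ 'n \<Rightarrow> rat ^ 'n"
  where "root_refl coroot \<alpha> v = v - pairing \<alpha> v *s coroot \<alpha>"

text \<open>The transposed reflection, on characters.\<close>

definition root_refl_char :: "(rat ^ 'n \<Rightarrow> rat ^ 'n) \<Rightarrow> rat ^ 'n \<Rightarrow> rat ^ 'n \<Rightarrow> rat ^ 'n"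
  where "root_refl_char coroot \<alpha> x = x - pairing x (coroot \<alpha>) *s \<alpha>"

text \<open>The function \<open>coroot\<close> matters only on \<open>\<Phi>\<close>.\<close>

locale semisimple_root_datum =
  fixes \<Phi> :: "(rat ^ 'n) set" and coroot :: "rat ^ 'n \<Rightarrow> rat ^ 'n"
  assumes finite_roots: "finite \<Phi>"
    and roots_integral: "\<Phi> \<subseteq> integral_vectors"
    and coroots_integral: "coroot ` \<Phi> \<subseteq> integral_vectors"
    and inj_coroot: "inj_on coroot \<Phi>"
    and pairing_root_coroot: "\<alpha> \<in> \<Phi> \<Longrightarrow> pairing \<alpha> (coroot \<alpha>) = 2"
    and refl_char_roots: "\<alpha> \<in> \<Phi> \<Longrightarrow> root_refl_char coroot \<alpha> ` \<Phi> \<subseteq> \<Phi>"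
    and refl_coroots: "\<alpha> \<in> \<Phi> \<Longrightarrow> root_refl coroot \<alpha> ` (coroot ` \<Phi>) \<subseteq> coroot ` \<Phi>"
    and reduced: "\<lbrakk>\<alpha> \<in> \<Phi>; c *s \<alpha> \<in> \<Phi>\<rbrakk> \<Longrightarrow> c = 1 \<or> c = - 1"
    and span_roots: "vec.span \<Phi> = UNIV"

definition irreducible_roots :: "(rat ^ 'n) set \<Rightarrow> (rat ^ 'n \<Rightarrow> rat ^ 'n) \<Rightarrow> bool"
  where "irreducible_roots \<Phi> coroot \<longleftrightarrow>
    \<Phi> \<noteq> {} \<and>
    (\<nexists>A B. A \<union> B = \<Phi> \<and> A \<inter> B = {} \<and> A \<noteq> {} \<and> B \<noteq> {} \<and>
       (\<forall>\<alpha>\<in>A. \<forall>\<beta>\<in>B. pairing \<alpha> (coroot \<beta>) = 0))"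

definition nonneg_comb :: "(rat ^ 'n) set \<Rightarrow> (rat ^ 'n) set"
  where "nonneg_comb \<Delta> = {(\<Sum>\<alpha>\<in>\<Delta>. of_nat (c \<alpha>) *s \<alpha>) | c :: rat ^ 'n \<Rightarrow> nat. True}"

definition simple_roots :: "(rat ^ 'n) set \<Rightarrow> (rat ^ 'n) set \<Rightarrow> bool"
  where "simple_roots \<Phi> \<Delta> \<longleftrightarrow>
    \<Delta> \<subseteq> \<Phi> \<and> vec.independent \<Delta> \<and>
    (\<forall>\<beta>\<in>\<Phi>. \<beta> \<in> nonneg_comb \<Delta> \<or> - \<beta> \<in> nonneg_comb \<Delta>)"

definition highest_root :: "(rat ^ 'n) set \<Rightarrow> (rat ^ 'n) set \<Rightarrow> rat ^ 'n \<Rightarrow> bool"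
  where "highest_root \<Phi> \<Delta> \<alpha>\<^sub>0 \<longleftrightarrow> \<alpha>\<^sub>0 \<in> \<Phi> \<and> (\<forall>\<beta>\<in>\<Phi>. \<alpha>\<^sub>0 - \<beta> \<in> nonneg_comb \<Delta>)"

text \<open>A symmetry of the Dynkin diagram preserves the Cartan matrix, i.e. also the arrows.\<close>

definition dynkin_symmetry ::
    "(rat ^ 'n \<Rightarrow> rat ^ 'n) \<Rightarrow> (rat ^ 'n) set \<Rightarrow> (rat ^ 'n \<Rightarrow> rat ^ 'n) \<Rightarrow> bool"
  where "dynkin_symmetry coroot \<Delta> \<rho> \<longleftrightarrow>
    bij_betw \<rho> \<Delta> \<Delta> \<and>
    (\<forall>\<alpha>\<in>\<Delta>. \<forall>\<beta>\<in>\<Delta>. pairing (\<rho> \<alpha>) (coroot (\<rho> \<beta>)) = pairing \<alpha> (coroot \<beta>))"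

text \<open>Reflections being involutions, the words in the reflections \<open>s\<^sub>\<alpha>\<close>, \<open>\<alpha> \<in> I\<close>, form a group.\<close>

definition refl_word ::
    "(rat ^ 'n \<Rightarrow> rat ^ 'n) \<Rightarrow> (rat ^ 'n) list \<Rightarrow> rat ^ 'n \<Rightarrow> rat ^ 'n"
  where "refl_word coroot as = foldr (\<lambda>\<alpha> w. root_refl coroot \<alpha> \<circ> w) as id"

definition refl_group ::
    "(rat ^ 'n \<Rightarrow> rat ^ 'n) \<Rightarrow> (rat ^ 'n) set \<Rightarrow> (rat ^ 'n \<Rightarrow> rat ^ 'n) set"
  where "refl_group coroot I = {refl_word coroot as | as. set as \<subseteq> I}"

definition weyl_length ::
    "(rat ^ 'n \<Rightarrow> rat ^ 'n) \<Rightarrow> (rat ^ 'n) set \<Rightarrow> (rat ^ 'n \<Rightarrow> rat ^ 'n) \<Rightarrow> nat"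
  where "weyl_length coroot \<Delta> w =
    (LEAST k. \<exists>as. set as \<subseteq> \<Delta> \<and> length as = k \<and> refl_word coroot as = w)"

definition longest ::
    "(rat ^ 'n \<Rightarrow> rat ^ 'n) \<Rightarrow> (rat ^ 'n) set \<Rightarrow> (rat ^ 'n \<Rightarrow> rat ^ 'n) set
      \<Rightarrow> rat ^ 'n \<Rightarrow> rat ^ 'n"
  where "longest coroot \<Delta> H = (ARG_MAX (weyl_length coroot \<Delta>) w. w \<in> H)"

definition ext_simple_roots :: "(rat ^ 'n) set \<Rightarrow> rat ^ 'n \<Rightarrow> (rat ^ 'n) set"
  where "ext_simple_roots \<Delta> \<alpha>\<^sub>0 = insert (- \<alpha>\<^sub>0) \<Delta>"

text \<open>The coefficients \<open>n\<^sub>\<alpha>\<close>, with \<open>n\<close> equal to 1 at \<open>-\<alpha>\<^sub>0\<close>.\<close>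

definition mark :: "(rat ^ 'n) set \<Rightarrow> rat ^ 'n \<Rightarrow> rat ^ 'n \<Rightarrow> rat"
  where "mark \<Delta> \<alpha>\<^sub>0 \<alpha> = (if \<alpha> = - \<alpha>\<^sub>0 then 1 else vec.representation \<Delta> \<alpha>\<^sub>0 \<alpha>)"

definition minuscule_roots :: "(rat ^ 'n) set \<Rightarrow> rat ^ 'n \<Rightarrow> (rat ^ 'n) set"
  where "minuscule_roots \<Delta> \<alpha>\<^sub>0 = {\<alpha> \<in> ext_simple_roots \<Delta> \<alpha>\<^sub>0. mark \<Delta> \<alpha>\<^sub>0 \<alpha> = 1}"

definition fund_coweight :: "(rat ^ 'n) set \<Rightarrow> rat ^ 'n \<Rightarrow> rat ^ 'n"
  where "fund_coweight \<Delta> \<alpha> = (THE v. \<forall>\<beta>\<in>\<Delta>. pairing \<beta> v = (if \<beta> = \<alpha> then 1 else 0))"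

definition ext_coweight :: "(rat ^ 'n) set \<Rightarrow> rat ^ 'n \<Rightarrow> rat ^ 'n \<Rightarrow> rat ^ 'n"
  where "ext_coweight \<Delta> \<alpha>\<^sub>0 \<alpha> = (if \<alpha> = - \<alpha>\<^sub>0 then 0 else fund_coweight \<Delta> \<alpha>)"

text \<open>For \<open>\<alpha> = -\<alpha>\<^sub>0\<close> the set \<open>\<Delta> - {\<alpha>}\<close> is \<open>\<Delta>\<close>, so \<open>z_elt\<close> is \<open>w\<^sub>0 w\<^sub>0 = 1\<close> there.\<close>

definition z_elt ::
    "(rat ^ 'n) set \<Rightarrow> (rat ^ 'n \<Rightarrow> rat ^ 'n) \<Rightarrow> (rat ^ 'n) set \<Rightarrow> rat ^ 'n
      \<Rightarrow> rat ^ 'n \<Rightarrow> rat ^ 'n"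
  where "z_elt \<Phi> coroot \<Delta> \<alpha> =
    longest coroot \<Delta> (refl_group coroot (\<Delta> - {\<alpha>})) \<circ> longest coroot \<Delta> (refl_group coroot \<Phi>)"

definition f_map ::
    "(rat ^ 'n) set \<Rightarrow> (rat ^ 'n \<Rightarrow> rat ^ 'n) \<Rightarrow> (rat ^ 'n) set \<Rightarrow> rat ^ 'n \<Rightarrow> rat ^ 'n
      \<Rightarrow> rat ^ 'n \<Rightarrow> rat ^ 'n"
  where "f_map \<Phi> coroot \<Delta> \<alpha>\<^sub>0 \<alpha> v = z_elt \<Phi> coroot \<Delta> \<alpha> v + ext_coweight \<Delta> \<alpha>\<^sub>0 \<alpha>"

definition alcove :: "(rat ^ 'n) set \<Rightarrow> rat ^ 'n \<Rightarrow> (rat ^ 'n) set"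
  where "alcove \<Delta> \<alpha>\<^sub>0 = {v. (\<forall>\<alpha>\<in>\<Delta>. pairing \<alpha> v \<ge> 0) \<and> pairing \<alpha>\<^sub>0 v \<le> 1}"

definition coroot_lattice ::
    "(rat ^ 'n \<Rightarrow> rat ^ 'n) \<Rightarrow> (rat ^ 'n) set \<Rightarrow> (rat ^ 'n) set"
  where "coroot_lattice coroot \<Delta> =
    {(\<Sum>\<alpha>\<in>\<Delta>. of_int (c \<alpha>) *s coroot \<alpha>) | c :: rat ^ 'n \<Rightarrow> int. True}"

text \<open>
  The semidirect product of \<open>F\<^sup>-\<^sup>1(Y(T\<^sub>s\<^sub>c))\<close> and \<open>W\<close> acts faithfully on \<open>V\<close>; it is identified with the
  group of affine transformations it induces. Similarly \<open>W\<close> is the group \<open>refl_group coroot \<Phi>\<close> of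
  linear maps.
\<close>

definition affine_weyl_q ::
    "(rat ^ 'n) set \<Rightarrow> (rat ^ 'n \<Rightarrow> rat ^ 'n) \<Rightarrow> (rat ^ 'n) set \<Rightarrow> (rat ^ 'n \<Rightarrow> rat ^ 'n)
      \<Rightarrow> (rat ^ 'n \<Rightarrow> rat ^ 'n) set"
  where "affine_weyl_q \<Phi> coroot \<Delta> F =
    {(\<lambda>v. w v + t) | w t. w \<in> refl_group coroot \<Phi> \<and> F t \<in> coroot_lattice coroot \<Delta>}"

definition alcove_q ::
    "(rat ^ 'n) set \<Rightarrow> rat ^ 'n \<Rightarrow> (rat ^ 'n \<Rightarrow> rat ^ 'n) \<Rightarrow> (rat ^ 'n) set"
  where "alcove_q \<Delta> \<alpha>\<^sub>0 F = {v. F v \<in> alcove \<Delta> \<alpha>\<^sub>0}"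

definition E_q ::
    "(rat ^ 'n) set \<Rightarrow> (rat ^ 'n \<Rightarrow> rat ^ 'n) \<Rightarrow> (rat ^ 'n) set \<Rightarrow> rat ^ 'n
      \<Rightarrow> (rat ^ 'n \<Rightarrow> rat ^ 'n) \<Rightarrow> (rat ^ 'n \<Rightarrow> rat ^ 'n) set"
  where "E_q \<Phi> coroot \<Delta> \<alpha>\<^sub>0 F =
    {\<omega> \<in> affine_weyl_q \<Phi> coroot \<Delta> F. \<omega> ` alcove_q \<Delta> \<alpha>\<^sub>0 F \<subseteq> alcove \<Delta> \<alpha>\<^sub>0}"

definition hyperplanes_q :: "(rat ^ 'n) set \<Rightarrow> nat \<Rightarrow> (rat ^ 'n) set set"
  where "hyperplanes_q \<Phi> q =
    {{v. pairing \<beta> v = of_int k / of_nat q} | \<beta> k. \<beta> \<in> \<Phi>}"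

definition M_q ::
    "(rat ^ 'n) set \<Rightarrow> (rat ^ 'n \<Rightarrow> rat ^ 'n) \<Rightarrow> (rat ^ 'n) set \<Rightarrow> rat ^ 'n
      \<Rightarrow> (rat ^ 'n \<Rightarrow> rat ^ 'n) \<Rightarrow> rat ^ 'n \<Rightarrow> (rat ^ 'n \<Rightarrow> rat ^ 'n) set"
  where "M_q \<Phi> coroot \<Delta> \<alpha>\<^sub>0 F \<alpha> =
    {\<omega> \<in> E_q \<Phi> coroot \<Delta> \<alpha>\<^sub>0 F.
       f_map \<Phi> coroot \<Delta> \<alpha>\<^sub>0 \<alpha> ` (\<omega> ` alcove_q \<Delta> \<alpha>\<^sub>0 F) = \<omega> ` alcove_q \<Delta> \<alpha>\<^sub>0 F}"

definition fixed_space ::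
    "(rat ^ 'n) set \<Rightarrow> (rat ^ 'n \<Rightarrow> rat ^ 'n) \<Rightarrow> (rat ^ 'n) set \<Rightarrow> rat ^ 'n \<Rightarrow> rat ^ 'n
      \<Rightarrow> (rat ^ 'n) set"
  where "fixed_space \<Phi> coroot \<Delta> \<alpha>\<^sub>0 \<alpha> = {v. f_map \<Phi> coroot \<Delta> \<alpha>\<^sub>0 \<alpha> v = v}"

text \<open>
  \<open>V\<^sub>\<alpha>\<close> is an affine subspace, in general not through 0; its dimension is that of its direction.
  The library's \<open>aff_dim\<close> is available over the reals only.
\<close>

definition affine_dim :: "(rat ^ 'n) set \<Rightarrow> nat"
  where "affine_dim A = vec.dim {u - v | u v. u \<in> A \<and> v \<in> A}"

end

theory Submission
  imports Defs
begin

text \<open>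
  Rescaling by \<open>q\<close> turns the small alcoves in \<open>\<C>\<close> into the unit alcoves \<open>\<eta>(\<C>)\<close>, \<open>\<eta>\<close> in the affine Weyl
  group, contained in \<open>q\<C>\<close>. The point \<open>x = \<rho>\<^sup>\<or>/h\<close> is fixed by every automorphism of \<open>\<C>\<close> coming from the
  extended affine Weyl group, so \<open>f(v) = z(v - x) + x\<close> where \<open>z\<close> is the linear part \<open>z\<^sub>\<alpha>\<close>, and \<open>\<eta>(\<C>)\<close> is
  stable iff \<open>z\<close> fixes \<open>\<eta>(x) - qx\<close>. If \<open>\<eta>(\<C>)\<close> is stable, then \<open>f\<close> conjugated by \<open>\<eta>\<close> is an automorphism
  of \<open>\<C>\<close> whose class modulo the coroot lattice is \<open>q\<close> times that of \<open>f\<close>, hence it equals \<open>f\<^sup>q\<close>; so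
  \<open>w\<^sup>-\<^sup>1zw = z\<^sup>q\<close> for the linear part \<open>w\<close> of \<open>\<eta>\<close>, and \<open>q\<close> is prime to the order of \<open>z\<close>. Therefore a small
  alcove of level \<open>q\<close> that is stable contains as many stable alcoves of level \<open>qr\<close> as \<open>\<C>\<close> contains of
  level \<open>r\<close>: the number \<open>a(q)\<close> of stable alcoves is multiplicative, and \<open>a(q\<^sup>n) = a(q)\<^sup>n\<close>. Counting
  lattice points in \<open>V\<^sub>\<alpha>\<close> shows that \<open>a(q\<^sup>n)\<close>, if nonzero, lies between constant multiples of \<open>q\<^sup>n\<^sup>d\<close> with
  \<open>d = dim V\<^sub>\<alpha>\<close>. Letting \<open>n\<close> grow gives \<open>a(q) = q\<^sup>d\<close> as soon as \<open>a(q) > 0\<close>, without any notion of volume.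
  Finally \<open>a(q) > 0\<close> iff \<open>V\<^sub>\<alpha>\<close> contains a point outside all hyperplanes of level \<open>q\<close>.
\<close>

section \<open>Pairing, reflection words and the invariant form\<close>

text \<open>The Frobenius map enters only through \<open>q\<close>: composition with
  \<open>F\<^sub>0\<close> permutes the simple roots and fixes the highest root, so the small alcove
  is the alcove divided by \<open>q\<close> and its translations are coroot lattice vectors divided
  by \<open>q\<close>.

  Freeness of the affine Weyl group on interior points is what allows elements to be identified by
  congruences: w in W is determined by the class of w(x) modulo the coroot lattice. Since W acts
  trivially on coweights modulo coroots, conjugation does not change the class of an automorphism,
  and the rescaling contributes the factor \<open>q\<close>; this is the origin of the exponent in
  the relation between z and its conjugate.

  Primality of \<open>q\<close> to the order of z makes z and its \<open>q\<close>-th power fix the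
  same vectors. Without this, a stable alcove of level qr inside a stable alcove of level q would
  not have to come from a stable alcove of level r.

  The room for the lower bound comes from x as well: at mx all walls of the alcove dilated by m are
  at level m/h, so one stable alcove can be moved near mx and then translated in about m steps in
  each fixed direction. Points are rational, so every descent is arranged to have an integral
  measure.\<close>

lemma pairing_add_left: "pairing (x + y) v = pairing x v + pairing y v"
  and pairing_add_right: "pairing x (v + w) = pairing x v + pairing x w"
  and pairing_diff_left: "pairing (x - y) v = pairing x v - pairing y v"
  and pairing_diff_right: "pairing x (v - w) = pairing x v - pairing x w"
  and pairing_minus_left: "pairing (- x) v = - pairing x v"
  and pairing_minus_right: "pairing x (- v) = - pairing x v"
  and pairing_scale_left: "pairing (c *s x) v = c * pairing x v"
  and pairing_scale_right: "pairing x (c *s v) = c * pairing x v"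
  and pairing_zero_left: "pairing 0 v = 0"
  and pairing_zero_right: "pairing x 0 = 0"
  by (simp_all add: pairing_def algebra_simps sum.distrib sum_subtractf sum_distrib_left sum_negf)

lemmas [simp] =
  pairing_add_left pairing_add_right pairing_diff_left pairing_diff_right pairing_minus_left
  pairing_minus_right pairing_scale_left pairing_scale_right pairing_zero_left pairing_zero_right

lemma pairing_sum_left: "pairing (sum f A) v = (\<Sum>i\<in>A. pairing (f i) v)"
  by (induction A rule: infinite_finite_induct) auto

lemma pairing_sum_right: "pairing x (sum f A) = (\<Sum>i\<in>A. pairing x (f i))"
  by (induction A rule: infinite_finite_induct) auto

lemma pairing_axis_left: "pairing (axis i 1) x = x $ i"
  by (simp add: pairing_def axis_def if_distrib[where f = "\<lambda>y. y * _"] sum.delta cong: if_cong)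

lemma pairing_integral_vectors:
  "x \<in> integral_vectors \<Longrightarrow> v \<in> integral_vectors \<Longrightarrow> pairing x v \<in> \<int>"
  unfolding pairing_def integral_vectors_def by (auto intro!: Ints_sum Ints_mult)

lemma linear_vecI:
  fixes w :: "rat ^ 'n \<Rightarrow> rat ^ 'n"
  assumes "\<And>u v. w (u + v) = w u + w v" and "\<And>c v. w (c *s v) = c *s w v"
  shows "Vector_Spaces.linear (*s) (*s) w"
  using assms by (simp add: Vector_Spaces.linear_iff vec.vector_space_axioms)

lemma linear_root_refl: "Vector_Spaces.linear (*s) (*s) (root_refl coroot \<alpha>)"
  by (rule linear_vecI) (simp_all add: root_refl_def vec_eq_iff algebra_simps)

lemma pairing_root_refl: "pairing x (root_refl coroot \<alpha> v) = pairing (root_refl_char coroot \<alpha> x) v"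
  by (simp add: root_refl_def root_refl_char_def algebra_simps)

lemma refl_word_Nil [simp]: "refl_word coroot [] = id"
  and refl_word_Cons [simp]: "refl_word coroot (a # as) = root_refl coroot a \<circ> refl_word coroot as"
  by (simp_all add: refl_word_def)

lemma refl_word_append: "refl_word coroot (as @ bs) = refl_word coroot as \<circ> refl_word coroot bs"
  by (induction as) (auto simp: comp_assoc)

lemma id_in_refl_group: "id \<in> refl_group coroot I"
  unfolding refl_group_def by (auto intro: exI[of _ "[]"])

lemma root_refl_in_refl_group: "\<alpha> \<in> I \<Longrightarrow> root_refl coroot \<alpha> \<in> refl_group coroot I"
  unfolding refl_group_def by (auto intro!: exI[of _ "[\<alpha>]"])

lemma refl_group_comp:
  assumes "w \<in> refl_group coroot I" "w' \<in> refl_group coroot I"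
  shows "w \<circ> w' \<in> refl_group coroot I"
proof -
  obtain as bs where "w = refl_word coroot as" "set as \<subseteq> I" "w' = refl_word coroot bs" "set bs \<subseteq> I"
    using assms unfolding refl_group_def by auto
  then show ?thesis
    unfolding refl_group_def by (auto intro!: exI[of _ "as @ bs"] simp: refl_word_append)
qed

lemma refl_group_mono: "I \<subseteq> J \<Longrightarrow> refl_group coroot I \<subseteq> refl_group coroot J"
  unfolding refl_group_def by blast

lemma refl_group_induct [consumes 1, case_names id comp]:
  assumes "w \<in> refl_group coroot I"
    and "P id"
    and step: "\<And>\<alpha> w. \<alpha> \<in> I \<Longrightarrow> w \<in> refl_group coroot I \<Longrightarrow> P w \<Longrightarrow> P (root_refl coroot \<alpha> \<circ> w)"
  shows "P w"
proof -
  have "P (refl_word coroot as)" if "set as \<subseteq> I" for as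
    using that
  proof (induction as)
    case (Cons a as)
    then have "refl_word coroot as \<in> refl_group coroot I"
      unfolding refl_group_def by auto
    with Cons show ?case
      unfolding refl_word_Cons by (intro step) auto
  next
    case Nil
    show ?case unfolding refl_word_Nil by fact
  qed
  then show ?thesis
    using assms(1) unfolding refl_group_def by auto
qed

section \<open>The Weyl group, its invariant form, and its action on roots and coroots\<close>

context semisimple_root_datum
begin

abbreviation W :: "(rat ^ 'n \<Rightarrow> rat ^ 'n) set"
  where "W \<equiv> refl_group coroot \<Phi>"

text \<open>A Weyl-invariant inner product: a reflection merely permutes the summands, and
  positivity holds because the roots span. Its values have bounded denominators on points with
  bounded denominators, which later gives an integral measure of distance.\<close>

definition form :: "rat ^ 'n \<Rightarrow> rat ^ 'n \<Rightarrow> rat"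
  where "form u v = (\<Sum>\<gamma>\<in>\<Phi>. pairing \<gamma> u * pairing \<gamma> v)"

lemma pairing_eq_zero_on_roots:
  assumes "\<And>\<gamma>. \<gamma> \<in> \<Phi> \<Longrightarrow> pairing \<gamma> v = 0"
  shows "v = 0"
proof -
  have "pairing x v = 0" for x
  proof -
    have "x \<in> vec.span \<Phi>" using span_roots by simp
    then show ?thesis by (induction rule: vec.span_induct_alt) (use assms in auto)
  qed
  then show ?thesis
    by (metis pairing_axis_left vec_eq_iff zero_index)
qed

lemma pairing_root_coroot_Ints: "\<beta> \<in> \<Phi> \<Longrightarrow> \<gamma> \<in> \<Phi> \<Longrightarrow> pairing \<beta> (coroot \<gamma>) \<in> \<int>"
  using roots_integral coroots_integral by (intro pairing_integral_vectors) auto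

lemma root_nonzero: "\<alpha> \<in> \<Phi> \<Longrightarrow> \<alpha> \<noteq> 0"
  using pairing_root_coroot by force

lemma root_refl_char_root: "\<alpha> \<in> \<Phi> \<Longrightarrow> \<beta> \<in> \<Phi> \<Longrightarrow> root_refl_char coroot \<alpha> \<beta> \<in> \<Phi>"
  using refl_char_roots by blast

lemma root_refl_char_invol: "\<alpha> \<in> \<Phi> \<Longrightarrow> root_refl_char coroot \<alpha> (root_refl_char coroot \<alpha> x) = x"
  using pairing_root_coroot[of \<alpha>]
  by (simp add: root_refl_char_def vec_eq_iff algebra_simps)

lemma root_refl_invol: "\<alpha> \<in> \<Phi> \<Longrightarrow> root_refl coroot \<alpha> (root_refl coroot \<alpha> v) = v"
  using pairing_root_coroot[of \<alpha>]
  by (simp add: root_refl_def vec_eq_iff algebra_simps)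

lemma minus_root: "\<alpha> \<in> \<Phi> \<Longrightarrow> - \<alpha> \<in> \<Phi>"
proof -
  assume \<alpha>: "\<alpha> \<in> \<Phi>"
  have "root_refl_char coroot \<alpha> \<alpha> = - \<alpha>"
    using pairing_root_coroot[OF \<alpha>] by (simp add: root_refl_char_def vec_eq_iff)
  then show ?thesis
    using root_refl_char_root[OF \<alpha> \<alpha>] by simp
qed

lemma form_add_left: "form (u + v) w = form u w + form v w"
  and form_diff_left: "form (u - v) w = form u w - form v w"
  and form_scale_left: "form (c *s u) w = c * form u w"
  and form_diff_right: "form u (v - w) = form u v - form u w"
  and form_scale_right: "form u (c *s w) = c * form u w"
  and form_minus_left: "form (- u) w = - form u w"
  by (simp_all add: form_def algebra_simps sum.distrib sum_subtractf sum_distrib_left sum_negf)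

lemma form_commute: "form u v = form v u"
  by (simp add: form_def mult.commute)

lemma form_self_nonneg: "form u u \<ge> 0"
  by (simp add: form_def sum_nonneg)

lemma form_self_pos: "u \<noteq> 0 \<Longrightarrow> form u u > 0"
proof (rule ccontr)
  assume "u \<noteq> 0" "\<not> form u u > 0"
  then have "(\<Sum>\<gamma>\<in>\<Phi>. pairing \<gamma> u * pairing \<gamma> u) = 0"
    using form_self_nonneg[of u] by (simp add: form_def)
  then have "pairing \<gamma> u = 0" if "\<gamma> \<in> \<Phi>" for \<gamma>
    using that finite_roots by (subst (asm) sum_nonneg_eq_0_iff) auto
  then show False
    using \<open>u \<noteq> 0\<close> pairing_eq_zero_on_roots by blast
qed

lemma form_root_refl: "\<alpha> \<in> \<Phi> \<Longrightarrow> form (root_refl coroot \<alpha> u) (root_refl coroot \<alpha> v) = form u v"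
  unfolding form_def pairing_root_refl
  by (rule sum.reindex_bij_witness[of _ "root_refl_char coroot \<alpha>" "root_refl_char coroot \<alpha>"])
    (auto simp: root_refl_char_invol root_refl_char_root)

lemma coroot_nonzero: "\<gamma> \<in> \<Phi> \<Longrightarrow> coroot \<gamma> \<noteq> 0"
  using pairing_root_coroot by fastforce

text \<open>The reflection in \<gamma> preserves the form and negates the coroot; comparing both
  sides shows that the coroot represents a multiple of \<gamma> with respect to the form.\<close>

lemma form_coroot:
  assumes "\<gamma> \<in> \<Phi>"
  shows "form (coroot \<gamma>) v = form (coroot \<gamma>) (coroot \<gamma>) / 2 * pairing \<gamma> v"
proof -
  have "form (coroot \<gamma>) v = form (root_refl coroot \<gamma> (coroot \<gamma>)) (root_refl coroot \<gamma> v)"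
    using assms by (simp add: form_root_refl)
  also have "root_refl coroot \<gamma> (coroot \<gamma>) = (- 1) *s coroot \<gamma>"
    using pairing_root_coroot[OF assms] by (simp add: root_refl_def vec_eq_iff)
  also have "form \<dots> (root_refl coroot \<gamma> v)
      = - (form (coroot \<gamma>) v - pairing \<gamma> v * form (coroot \<gamma>) (coroot \<gamma>))"
    unfolding root_refl_def by (simp only: form_scale_left form_diff_right form_scale_right mult_minus1)
  finally show ?thesis by (simp add: mult.commute)
qed

lemma form_coroot_pos: "\<gamma> \<in> \<Phi> \<Longrightarrow> form (coroot \<gamma>) (coroot \<gamma>) > 0"
  using coroot_nonzero form_self_pos by blast

text \<open>The axioms say only that reflections permute the coroots as a set. Characterizing the
  coroot by the form is what makes the correspondence between roots and coroots compatible with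
  W.\<close>

lemma coroot_unique:
  assumes "\<gamma> \<in> \<Phi>" "\<And>v. form u v = c * pairing \<gamma> v" "pairing \<gamma> u = 2"
  shows "u = coroot \<gamma>"
proof -
  define k where "k = c * (2 / form (coroot \<gamma>) (coroot \<gamma>))"
  have "form (u - k *s coroot \<gamma>) v = 0" for v
    using form_coroot[OF assms(1), of v] form_coroot_pos[OF assms(1)] assms(2)[of v]
    by (simp add: form_diff_left form_scale_left k_def field_simps)
  then have "u - k *s coroot \<gamma> = 0"
    using form_self_pos by fastforce
  then have u: "u = k *s coroot \<gamma>" by simp
  then have "k = 1"
    using assms(3) pairing_root_coroot[OF assms(1)] by simp
  with u show ?thesis by simp
qed

lemma coroot_minus: "\<gamma> \<in> \<Phi> \<Longrightarrow> coroot (- \<gamma>) = - coroot \<gamma>"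
proof -
  assume \<gamma>: "\<gamma> \<in> \<Phi>"
  have "- coroot \<gamma> = coroot (- \<gamma>)"
  proof (rule coroot_unique[where c = "form (coroot \<gamma>) (coroot \<gamma>) / 2"])
    fix v
    show "form (- coroot \<gamma>) v = form (coroot \<gamma>) (coroot \<gamma>) / 2 * pairing (- \<gamma>) v"
      using form_coroot[OF \<gamma>, of v] by (simp add: form_minus_left)
  qed (use \<gamma> minus_root pairing_root_coroot in auto)
  then show ?thesis by simp
qed

lemma W_linear: "w \<in> W \<Longrightarrow> Vector_Spaces.linear (*s) (*s) w"
proof (induction rule: refl_group_induct)
  case id
  show ?case by (rule linear_vecI) auto
next
  case (comp \<alpha> w)
  show ?case
    using Vector_Spaces.linear_compose[OF comp(3) linear_root_refl] .
qed

lemmas W_add = vec.linear_add[OF W_linear]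
  and W_diff = vec.linear_diff[OF W_linear]
  and W_scale = vec.linear_scale[OF W_linear]
  and W_zero = vec.linear_0[OF W_linear]

text \<open>This replaces the contragredient action of W on characters: a root composed with
  \<open>w\<close> is again pairing with a root, and no transposed map has to be named.\<close>

lemma W_root: "w \<in> W \<Longrightarrow> \<beta> \<in> \<Phi> \<Longrightarrow> \<exists>\<gamma>\<in>\<Phi>. \<forall>v. pairing \<beta> (w v) = pairing \<gamma> v"
proof (induction arbitrary: \<beta> rule: refl_group_induct)
  case (comp \<alpha> w)
  then show ?case
    using root_refl_char_root by (auto simp: pairing_root_refl)
qed auto

lemma refl_group_bij_inv:
  assumes "I \<subseteq> \<Phi>" "w \<in> refl_group coroot I"
  shows "bij w \<and> inv w \<in> refl_group coroot I"
  using assms(2)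
proof (induction rule: refl_group_induct)
  case id
  show ?case unfolding inv_id by (simp only: bij_id id_in_refl_group)
next
  case (comp \<alpha> w)
  let ?s = "root_refl coroot \<alpha>"
  have "?s \<circ> ?s = id"
    using root_refl_invol[of \<alpha>] comp(1) assms(1) by (auto simp: fun_eq_iff)
  then have "inv ?s = ?s" and bij: "bij ?s"
    by (auto intro: inv_unique_comp o_bij)
  then have "inv (?s \<circ> w) = inv w \<circ> ?s"
    using comp(3) by (metis o_inv_distrib)
  moreover have "inv w \<circ> ?s \<in> refl_group coroot I"
    using comp by (intro refl_group_comp root_refl_in_refl_group) auto
  moreover have "bij (?s \<circ> w)"
    using bij comp(3) by (intro bij_comp) auto
  ultimately show ?case by metis
qed

lemma W_bij: "w \<in> W \<Longrightarrow> bij w" and W_inv: "w \<in> W \<Longrightarrow> inv w \<in> W"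
  using refl_group_bij_inv by blast+

lemma W_inv_left: "w \<in> W \<Longrightarrow> inv w (w v) = v" and W_inv_right: "w \<in> W \<Longrightarrow> w (inv w v) = v"
  using W_bij by (auto simp: bij_def inv_f_f surj_f_inv_f)

lemma W_form: "w \<in> W \<Longrightarrow> form (w u) (w v) = form u v"
  by (induction rule: refl_group_induct) (auto simp: form_root_refl)

lemma W_coroot:
  assumes "w \<in> W" "\<beta> \<in> \<Phi>" "\<gamma> \<in> \<Phi>" "\<And>v. pairing \<beta> (w v) = pairing \<gamma> v"
  shows "w (coroot \<gamma>) = coroot \<beta>"
proof (rule coroot_unique[where c = "form (coroot \<gamma>) (coroot \<gamma>) / 2"])
  fix v
  have "form (w (coroot \<gamma>)) v = form (w (coroot \<gamma>)) (w (inv w v))"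
    by (simp add: W_inv_right assms(1))
  also have "\<dots> = form (coroot \<gamma>) (coroot \<gamma>) / 2 * pairing \<gamma> (inv w v)"
    using form_coroot[OF assms(3)] by (simp add: W_form assms(1))
  also have "pairing \<gamma> (inv w v) = pairing \<beta> v"
    using assms(4)[of "inv w v"] by (simp add: W_inv_right assms(1))
  finally show "form (w (coroot \<gamma>)) v = form (coroot \<gamma>) (coroot \<gamma>) / 2 * pairing \<beta> v" .
next
  show "pairing \<beta> (w (coroot \<gamma>)) = 2"
    using assms(4)[of "coroot \<gamma>"] pairing_root_coroot[OF assms(3)] by simp
qed (rule assms)

text \<open>The roots span, so an element is determined by the self-map of \<Phi> that it induces by
  composition.\<close>

lemma finite_W: "finite W"
proof (rule inj_on_finite)
  define g where "g w (\<beta> :: rat ^ 'n) = (SOME \<gamma>. \<gamma> \<in> \<Phi> \<and> (\<forall>v. pairing \<beta> (w v) = pairing \<gamma> v))" for w \<beta>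
  let ?h = "\<lambda>w. \<lambda>\<beta>\<in>\<Phi>. g w \<beta>"
  have some: "g w \<beta> \<in> \<Phi> \<and> (\<forall>v. pairing \<beta> (w v) = pairing (g w \<beta>) v)"
    if "w \<in> W" "\<beta> \<in> \<Phi>" for w \<beta>
    unfolding g_def using W_root[OF that] by (intro someI_ex[of "\<lambda>\<gamma>. \<gamma> \<in> \<Phi> \<and> (\<forall>v. pairing \<beta> (w v) = pairing \<gamma> v)"]) auto
  show "?h ` W \<subseteq> \<Phi> \<rightarrow>\<^sub>E \<Phi>"
    using some by auto
  show "finite (\<Phi> \<rightarrow>\<^sub>E \<Phi>)"
    by (intro finite_PiE finite_roots)
  show "inj_on ?h W"
  proof (rule inj_onI)
    fix w w' assume w: "w \<in> W" "w' \<in> W" and eq: "?h w = ?h w'"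
    have "w v - w' v = 0" for v
    proof (rule pairing_eq_zero_on_roots)
      fix \<beta> assume \<beta>: "\<beta> \<in> \<Phi>"
      have "pairing \<beta> (w v) = pairing \<beta> (w' v)"
        using some[OF w(1) \<beta>] some[OF w(2) \<beta>] fun_cong[OF eq, of \<beta>] \<beta> by simp
      then show "pairing \<beta> (w v - w' v) = 0" by simp
    qed
    then show "w = w'" by (simp add: fun_eq_iff)
  qed
qed

end

section \<open>The exchange argument\<close>

definition refl_product :: "('i \<Rightarrow> 'v \<Rightarrow> 'v) \<Rightarrow> 'i list \<Rightarrow> 'v \<Rightarrow> 'v"
  where "refl_product s is = foldr (\<lambda>i w. s i \<circ> w) is id"

lemma refl_product_Nil: "refl_product s [] = id"
  and refl_product_Cons: "refl_product s (i # is) = s i \<circ> refl_product s is"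
  by (simp_all add: refl_product_def)

lemma refl_product_append:
  "refl_product s (is @ js) = refl_product s is \<circ> refl_product s js"
  by (induction "is") (auto simp: refl_product_Nil refl_product_Cons comp_assoc)

lemma refl_product_snoc: "refl_product s (is @ [i]) = refl_product s is \<circ> s i"
  by (simp add: refl_product_append refl_product_Nil refl_product_Cons fun_eq_iff)

text \<open>The part of Coxeter theory needed below, for a group acting on a space with base point
  \<open>x\<close>. Roots are kept as functions, so that pulling one back along a word is plain
  composition. The decisive axiom is \<open>pos_permuted\<close>: a simple reflection makes no
  positive root negative at \<open>x\<close> except its own.\<close>

locale reflection_system =
  fixes I :: "'i set" and s :: "'i \<Rightarrow> 'v \<Rightarrow> 'v" and a :: "'i \<Rightarrow> 'v \<Rightarrow> 'k::linordered_idom"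
    and R :: "('v \<Rightarrow> 'k) set" and x :: 'v
  assumes invol: "i \<in> I \<Longrightarrow> s i (s i v) = v"
    and simple_in_R: "i \<in> I \<Longrightarrow> a i \<in> R"
    and R_closed: "b \<in> R \<Longrightarrow> i \<in> I \<Longrightarrow> b \<circ> s i \<in> R"
    and R_nonzero: "b \<in> R \<Longrightarrow> b x \<noteq> 0"
    and simple_pos: "i \<in> I \<Longrightarrow> a i x > 0"
    and simple_neg: "i \<in> I \<Longrightarrow> a i (s i v) = - a i v"
    and pos_permuted: "b \<in> R \<Longrightarrow> i \<in> I \<Longrightarrow> b x > 0 \<Longrightarrow> b \<noteq> a i \<Longrightarrow> b (s i x) > 0"
    and conjugate: "i \<in> I \<Longrightarrow> j \<in> I \<Longrightarrow> set is \<subseteq> I \<Longrightarrow> a j \<circ> refl_product s is = a i \<Longrightarrow>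
      s j \<circ> refl_product s is = refl_product s is \<circ> s i"
begin

lemma R_closed_word: "b \<in> R \<Longrightarrow> set is \<subseteq> I \<Longrightarrow> b \<circ> refl_product s is \<in> R"
  by (induction "is" arbitrary: b)
    (auto simp: refl_product_Nil refl_product_Cons comp_assoc[symmetric] R_closed)

text \<open>Pull \<open>a j\<close> back along the prefixes of the word: the empty prefix gives a
  positive value at \<open>x\<close>, the whole word a negative one. At the letter where the sign
  flips, the pulled-back root must be the simple root of that letter, so moving \<open>s j\<close>
  through the prefix cancels the letter.\<close>

lemma exchange:
  assumes "j \<in> I" "set is \<subseteq> I" "a j (refl_product s is x) < 0"
  shows "\<exists>is'. set is' \<subseteq> set is \<and> length is' < length is \<and>
    s j \<circ> refl_product s is = refl_product s is'"
  using assms(2,3)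
proof (induction "is" rule: rev_induct)
  case (snoc i ts)
  let ?b = "a j \<circ> refl_product s ts"
  have bR: "?b \<in> R"
    using snoc.prems assms(1) by (intro R_closed_word simple_in_R) auto
  show ?case
  proof (cases "?b x < 0")
    case True
    then have "a j (refl_product s ts x) < 0" by simp
    with snoc.IH snoc.prems obtain ts' where ts': "set ts' \<subseteq> set ts" "length ts' < length ts"
      "s j \<circ> refl_product s ts = refl_product s ts'"
      by (metis set_append le_sup_iff)
    then have "s j \<circ> refl_product s (ts @ [i]) = refl_product s (ts' @ [i])"
      by (simp add: refl_product_snoc comp_assoc[symmetric])
    with ts' show ?thesis by (intro exI[of _ "ts' @ [i]"]) auto
  next
    case False
    with R_nonzero[OF bR] have pos: "?b x > 0" by simp
    have "\<not> ?b (s i x) > 0"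
      using snoc.prems by (simp add: refl_product_snoc)
    have "?b = a i"
    proof (rule ccontr)
      assume "?b \<noteq> a i"
      from pos_permuted[OF bR _ pos this] snoc.prems have "?b (s i x) > 0" by force
      with \<open>\<not> ?b (s i x) > 0\<close> show False ..
    qed
    with conjugate snoc.prems assms(1) have c: "s j \<circ> refl_product s ts = refl_product s ts \<circ> s i"
      by simp
    have "s j (refl_product s ts (s i v)) = refl_product s ts v" for v
      using fun_cong[OF c, of "s i v"] invol snoc.prems by simp
    then have "s j \<circ> refl_product s (ts @ [i]) = refl_product s ts"
      by (simp add: refl_product_snoc fun_eq_iff)
    then show ?thesis by (intro exI[of _ ts]) auto
  qed
next
  case Nil
  then show ?case
    using simple_pos[OF assms(1)] by (simp add: refl_product_Nil)
qed

text \<open>Deleting the first letter j makes \<open>a j\<close> negative, so the exchange step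
  yields a shorter word for the same map. This becomes freeness of the affine Weyl group on interior
  points.\<close>

lemma word_preserving_positivity_is_id:
  assumes "set is \<subseteq> I" "\<And>j. j \<in> I \<Longrightarrow> a j (refl_product s is x) > 0"
  shows "refl_product s is = id"
  using assms
proof (induction "length is" arbitrary: "is" rule: less_induct)
  case less
  show ?case
  proof (cases "is")
    case Nil
    then show ?thesis by (simp only: refl_product_Nil)
  next
    case (Cons j ts)
    then have j: "j \<in> I" "set ts \<subseteq> I" using less.prems by auto
    have "a j (refl_product s is x) = - a j (refl_product s ts x)"
      using j by (simp add: Cons refl_product_Cons simple_neg)
    then have "a j (refl_product s ts x) < 0"
      using less.prems(2)[OF j(1)] by simp
    then obtain ts' where ts': "set ts' \<subseteq> set ts" "length ts' < length ts"
      "s j \<circ> refl_product s ts = refl_product s ts'"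
      using exchange[OF j] by blast
    then have eq: "refl_product s is = refl_product s ts'"
      by (simp only: Cons refl_product_Cons)
    have "refl_product s ts' = id"
      using ts' j Cons less.prems(2) eq by (intro less.hyps) auto
    with eq show ?thesis by simp
  qed
qed

end

lemma Nats_nonneg: "x \<in> \<nat> \<Longrightarrow> (0 :: 'a :: linordered_idom) \<le> x"
  by (auto elim: Nats_cases)

section \<open>Simple roots, the highest root and affine roots\<close>

locale based_root_datum = semisimple_root_datum \<Phi> coroot
  for \<Phi> :: "(rat ^ 'n) set" and coroot +
  fixes \<Delta> :: "(rat ^ 'n) set" and \<alpha>\<^sub>0 :: "rat ^ 'n"
  assumes simple: "simple_roots \<Phi> \<Delta>" and highest: "highest_root \<Phi> \<Delta> \<alpha>\<^sub>0"
begin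

lemma simple_subset: "\<Delta> \<subseteq> \<Phi>" and independent_simple: "vec.independent \<Delta>"
  and highest_in_roots: "\<alpha>\<^sub>0 \<in> \<Phi>"
  using simple highest unfolding simple_roots_def highest_root_def by auto

lemma simple_is_root [intro]: "\<alpha> \<in> \<Delta> \<Longrightarrow> \<alpha> \<in> \<Phi>"
  using simple_subset by auto

lemma finite_simple: "finite \<Delta>"
  using simple_subset finite_roots finite_subset by auto

lemma nonneg_comb_subset_span: "nonneg_comb \<Delta> \<subseteq> vec.span \<Delta>"
  unfolding nonneg_comb_def by (auto intro: vec.span_sum vec.span_scale vec.span_base)

lemma span_simple: "vec.span \<Delta> = UNIV"
proof -
  have "\<gamma> \<in> vec.span \<Delta>" if "\<gamma> \<in> \<Phi>" for \<gamma>
  proof -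
    from that have "\<gamma> \<in> nonneg_comb \<Delta> \<or> - \<gamma> \<in> nonneg_comb \<Delta>"
      using simple unfolding simple_roots_def by auto
    then show ?thesis
      using nonneg_comb_subset_span vec.span_neg[of "- \<gamma>" \<Delta>] by auto
  qed
  then have "vec.span \<Phi> \<subseteq> vec.span \<Delta>"
    by (intro vec.span_minimal) auto
  then show ?thesis using span_roots by auto
qed

lemma pairing_eq_zero_on_simple:
  assumes "\<And>\<alpha>. \<alpha> \<in> \<Delta> \<Longrightarrow> pairing \<alpha> v = 0"
  shows "v = 0"
proof (rule pairing_eq_zero_on_roots)
  fix x
  have "x \<in> vec.span \<Delta>" using span_simple by simp
  then show "pairing x v = 0" by (induction rule: vec.span_induct_alt) (use assms in auto)
qed

lemma eq_on_simple: "(\<And>\<alpha>. \<alpha> \<in> \<Delta> \<Longrightarrow> pairing \<alpha> u = pairing \<alpha> v) \<Longrightarrow> u = v"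
  using pairing_eq_zero_on_simple[of "u - v"] by simp

abbreviation coweight :: "rat ^ 'n \<Rightarrow> rat ^ 'n"
  where "coweight \<equiv> fund_coweight \<Delta>"

lemma pairing_coweight_representation: "\<alpha> \<in> \<Delta> \<Longrightarrow> pairing x (coweight \<alpha>) = vec.representation \<Delta> x \<alpha>"
  and pairing_coweight: "\<alpha> \<in> \<Delta> \<Longrightarrow> \<beta> \<in> \<Delta> \<Longrightarrow> pairing \<beta> (coweight \<alpha>) = (if \<beta> = \<alpha> then 1 else 0)"
proof -
  assume \<alpha>: "\<alpha> \<in> \<Delta>"
  \<comment> \<open>Pairing with a unit character reads off a coordinate, so the coordinates of the
    dual vector are forced to be the \<alpha>-coefficients of the unit characters.\<close>
  define v where "v = (\<chi> i. vec.representation \<Delta> (axis i 1) \<alpha>)"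
  have rep: "pairing x v = vec.representation \<Delta> x \<alpha>" for x
  proof -
    have "x = (\<Sum>i\<in>UNIV. x $ i *s axis i 1)"
      by (simp add: basis_expansion)
    also have "vec.representation \<Delta> \<dots> \<alpha> = (\<Sum>i\<in>UNIV. x $ i * vec.representation \<Delta> (axis i 1) \<alpha>)"
      using independent_simple span_simple
      by (simp add: vec.representation_sum vec.representation_scale)
    finally show ?thesis by (simp add: pairing_def v_def)
  qed
  have v: "\<forall>\<beta>\<in>\<Delta>. pairing \<beta> v = (if \<beta> = \<alpha> then 1 else 0)"
    using independent_simple by (auto simp: rep vec.representation_basis)
  then have "coweight \<alpha> = v"
    unfolding fund_coweight_def by (intro the_equality) (auto intro!: eq_on_simple)
  with rep v show "pairing x (coweight \<alpha>) = vec.representation \<Delta> x \<alpha>"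
    "\<beta> \<in> \<Delta> \<Longrightarrow> pairing \<beta> (coweight \<alpha>) = (if \<beta> = \<alpha> then 1 else 0)"
    by auto
qed

lemma simple_expansion: "x = (\<Sum>\<alpha>\<in>\<Delta>. pairing x (coweight \<alpha>) *s \<alpha>)"
proof -
  have "(\<Sum>\<alpha>\<in>\<Delta>. vec.representation \<Delta> x \<alpha> *s \<alpha>) = x"
    using independent_simple span_simple finite_simple by (intro vec.sum_representation_eq) auto
  then show ?thesis by (simp add: pairing_coweight_representation)
qed

lemma pairing_expansion: "pairing x v = (\<Sum>\<alpha>\<in>\<Delta>. pairing x (coweight \<alpha>) * pairing \<alpha> v)"
  by (subst simple_expansion) (simp add: pairing_sum_left)

lemma nonneg_comb_coweight:
  assumes "x \<in> nonneg_comb \<Delta>" "\<alpha> \<in> \<Delta>"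
  shows "pairing x (coweight \<alpha>) \<in> \<nat>"
proof -
  obtain c :: "rat ^ 'n \<Rightarrow> nat" where "x = (\<Sum>\<beta>\<in>\<Delta>. of_nat (c \<beta>) *s \<beta>)"
    using assms(1) unfolding nonneg_comb_def by auto
  then have "pairing x (coweight \<alpha>) = (\<Sum>\<beta>\<in>\<Delta>. of_nat (c \<beta>) * (if \<beta> = \<alpha> then 1 else 0))"
    using assms(2) by (simp add: pairing_sum_left pairing_coweight)
  also have "\<dots> = of_nat (c \<alpha>)"
    using assms(2) finite_simple by (simp add: if_distrib sum.delta cong: if_cong)
  finally show ?thesis by simp
qed

lemma root_coweight_Nats_cases:
  assumes "\<gamma> \<in> \<Phi>"
  obtains "\<And>\<alpha>. \<alpha> \<in> \<Delta> \<Longrightarrow> pairing \<gamma> (coweight \<alpha>) \<in> \<nat>"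
  | "\<And>\<alpha>. \<alpha> \<in> \<Delta> \<Longrightarrow> - pairing \<gamma> (coweight \<alpha>) \<in> \<nat>"
proof -
  from assms have "\<gamma> \<in> nonneg_comb \<Delta> \<or> - \<gamma> \<in> nonneg_comb \<Delta>"
    using simple unfolding simple_roots_def by auto
  then show ?thesis
    using nonneg_comb_coweight that by (metis pairing_minus_left)
qed

lemma root_coweight_Ints: "\<gamma> \<in> \<Phi> \<Longrightarrow> \<alpha> \<in> \<Delta> \<Longrightarrow> pairing \<gamma> (coweight \<alpha>) \<in> \<int>"
  by (rule root_coweight_Nats_cases) (use Nats_subset_Ints Ints_minus in fastforce)+

lemma root_le_highest: "\<gamma> \<in> \<Phi> \<Longrightarrow> \<alpha> \<in> \<Delta> \<Longrightarrow> pairing \<gamma> (coweight \<alpha>) \<le> pairing \<alpha>\<^sub>0 (coweight \<alpha>)"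
  using highest nonneg_comb_coweight[of "\<alpha>\<^sub>0 - \<gamma>" \<alpha>] Nats_nonneg unfolding highest_root_def
  by fastforce

lemma mark_ge_1: "\<alpha> \<in> \<Delta> \<Longrightarrow> 1 \<le> pairing \<alpha>\<^sub>0 (coweight \<alpha>)"
  using root_le_highest[of \<alpha> \<alpha>] by (auto simp: pairing_coweight)

lemma pairing_root_le_highest:
  assumes "\<gamma> \<in> \<Phi>" "\<And>\<alpha>. \<alpha> \<in> \<Delta> \<Longrightarrow> 0 \<le> pairing \<alpha> v"
  shows "pairing \<gamma> v \<le> pairing \<alpha>\<^sub>0 v"
  unfolding pairing_expansion[of \<gamma> v] pairing_expansion[of \<alpha>\<^sub>0 v]
  using assms root_le_highest by (intro sum_mono mult_right_mono) auto

section \<open>The interior of the alcove and the signs of affine roots\<close>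

definition interior_alcove :: "(rat ^ 'n) set"
  where "interior_alcove = {v. (\<forall>\<alpha>\<in>\<Delta>. 0 < pairing \<alpha> v) \<and> pairing \<alpha>\<^sub>0 v < 1}"

text \<open>The points on no reflection hyperplane of the affine Weyl group.\<close>

definition generic :: "rat ^ 'n \<Rightarrow> bool"
  where "generic v \<longleftrightarrow> (\<forall>\<beta>\<in>\<Phi>. pairing \<beta> v \<notin> \<int>)"

text \<open>The coefficients of an affine root \<open>\<gamma> + m\<close> with respect to the affine simple roots
  \<open>\<alpha> \<in> \<Delta>\<close> and \<open>1 - \<alpha>\<^sub>0\<close>: the one at \<open>1 - \<alpha>\<^sub>0\<close> is \<open>m\<close>.\<close>

definition coef :: "rat ^ 'n \<Rightarrow> rat \<Rightarrow> rat ^ 'n \<Rightarrow> rat"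
  where "coef \<gamma> m \<alpha> = pairing \<gamma> (coweight \<alpha>) + m * pairing \<alpha>\<^sub>0 (coweight \<alpha>)"

lemma affine_root_expansion:
  "pairing \<gamma> v + m = (\<Sum>\<alpha>\<in>\<Delta>. coef \<gamma> m \<alpha> * pairing \<alpha> v) + m * (1 - pairing \<alpha>\<^sub>0 v)"
proof -
  have "(\<Sum>\<alpha>\<in>\<Delta>. coef \<gamma> m \<alpha> * pairing \<alpha> v) = pairing \<gamma> v + m * pairing \<alpha>\<^sub>0 v"
    unfolding coef_def pairing_expansion[of \<gamma> v] pairing_expansion[of \<alpha>\<^sub>0 v]
    by (simp add: algebra_simps sum.distrib sum_distrib_left)
  then show ?thesis by (simp add: algebra_simps)
qed

text \<open>For \<gamma> positive and m at most -1 the coefficient at \<alpha> is bounded by that of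
  \<gamma> minus that of the highest root, hence not positive; here integrality of m matters.
  Negative \<gamma> is handled by negating the affine root.\<close>

lemma affine_root_sign:
  assumes "\<gamma> \<in> \<Phi>" "m \<in> \<int>"
  obtains "0 \<le> m" "\<And>\<alpha>. \<alpha> \<in> \<Delta> \<Longrightarrow> 0 \<le> coef \<gamma> m \<alpha>"
  | "m \<le> 0" "\<And>\<alpha>. \<alpha> \<in> \<Delta> \<Longrightarrow> coef \<gamma> m \<alpha> \<le> 0"
proof -
  have pos: "(0 \<le> m \<and> (\<forall>\<alpha>\<in>\<Delta>. 0 \<le> coef \<gamma> m \<alpha>)) \<or> (m \<le> 0 \<and> (\<forall>\<alpha>\<in>\<Delta>. coef \<gamma> m \<alpha> \<le> 0))"
    if \<gamma>: "\<gamma> \<in> \<Phi>" and m: "m \<in> \<int>" and nat: "\<And>\<alpha>. \<alpha> \<in> \<Delta> \<Longrightarrow> pairing \<gamma> (coweight \<alpha>) \<in> \<nat>" for \<gamma> m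
  proof (cases "0 \<le> m")
    case True
    then show ?thesis
      using nat[THEN Nats_nonneg] mark_ge_1 unfolding coef_def by (fastforce intro: add_nonneg_nonneg mult_nonneg_nonneg)
  next
    case False
    obtain k where k: "m = of_int k" using m by (elim Ints_cases)
    with False have m1: "m \<le> - 1" by simp
    have "coef \<gamma> m \<alpha> \<le> 0" if "\<alpha> \<in> \<Delta>" for \<alpha>
    proof -
      have "m * pairing \<alpha>\<^sub>0 (coweight \<alpha>) \<le> - 1 * pairing \<alpha>\<^sub>0 (coweight \<alpha>)"
        using m1 mark_ge_1[OF that] by (intro mult_right_mono) auto
      then show ?thesis
        using root_le_highest[OF \<gamma> that] unfolding coef_def by simp
    qed
    with False show ?thesis by auto
  qed
  have "(0 \<le> m \<and> (\<forall>\<alpha>\<in>\<Delta>. 0 \<le> coef \<gamma> m \<alpha>)) \<or> (m \<le> 0 \<and> (\<forall>\<alpha>\<in>\<Delta>. coef \<gamma> m \<alpha> \<le> 0))"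
  proof (rule root_coweight_Nats_cases[OF assms(1)])
    assume "\<And>\<alpha>. \<alpha> \<in> \<Delta> \<Longrightarrow> pairing \<gamma> (coweight \<alpha>) \<in> \<nat>"
    then show ?thesis by (rule pos[OF assms])
  next
    assume "\<And>\<alpha>. \<alpha> \<in> \<Delta> \<Longrightarrow> - pairing \<gamma> (coweight \<alpha>) \<in> \<nat>"
    then have "(0 \<le> - m \<and> (\<forall>\<alpha>\<in>\<Delta>. 0 \<le> coef (- \<gamma>) (- m) \<alpha>)) \<or>
        (- m \<le> 0 \<and> (\<forall>\<alpha>\<in>\<Delta>. coef (- \<gamma>) (- m) \<alpha> \<le> 0))"
      using assms by (intro pos minus_root) auto
    moreover have "coef (- \<gamma>) (- m) \<alpha> = - coef \<gamma> m \<alpha>" for \<alpha>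
      by (simp add: coef_def)
    ultimately show ?thesis by auto
  qed
  with that show ?thesis by blast
qed

lemma coef_all_zero:
  assumes "\<gamma> \<in> \<Phi>" "\<And>\<alpha>. \<alpha> \<in> \<Delta> \<Longrightarrow> coef \<gamma> 0 \<alpha> = 0"
  shows False
proof -
  have "\<gamma> = 0"
    using assms(2) by (subst simple_expansion) (simp add: coef_def)
  then show False using assms(1) root_nonzero by blast
qed

lemma affine_root_pos_interior:
  assumes "\<gamma> \<in> \<Phi>" "0 \<le> m" "\<And>\<alpha>. \<alpha> \<in> \<Delta> \<Longrightarrow> 0 \<le> coef \<gamma> m \<alpha>" "x \<in> interior_alcove"
  shows "0 < pairing \<gamma> x + m"
proof -
  have x: "\<alpha> \<in> \<Delta> \<Longrightarrow> 0 < pairing \<alpha> x" "pairing \<alpha>\<^sub>0 x < 1" for \<alpha>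
    using assms(4) by (auto simp: interior_alcove_def)
  show ?thesis
  proof (cases "m = 0")
    case True
    with coef_all_zero assms(1,3) obtain \<alpha> where \<alpha>: "\<alpha> \<in> \<Delta>" "0 < coef \<gamma> m \<alpha>"
      by (metis order_le_less)
    then have "0 < (\<Sum>\<alpha>\<in>\<Delta>. coef \<gamma> m \<alpha> * pairing \<alpha> x)"
      using x assms(3) finite_simple by (intro sum_pos2[of _ \<alpha>]) (auto simp: less_imp_le)
    then show ?thesis using True affine_root_expansion[of \<gamma> x m] by simp
  next
    case False
    then have "0 < m * (1 - pairing \<alpha>\<^sub>0 x)" using x assms(2) by simp
    moreover have "0 \<le> (\<Sum>\<alpha>\<in>\<Delta>. coef \<gamma> m \<alpha> * pairing \<alpha> x)"
      using x assms(3) by (intro sum_nonneg) (auto simp: less_imp_le)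
    ultimately show ?thesis using affine_root_expansion[of \<gamma> x m] by simp
  qed
qed

lemma coef_minus: "coef (- \<gamma>) (- m) \<alpha> = - coef \<gamma> m \<alpha>"
  by (simp add: coef_def)

lemma affine_root_neg_interior:
  assumes "\<gamma> \<in> \<Phi>" "m \<le> 0" "\<And>\<alpha>. \<alpha> \<in> \<Delta> \<Longrightarrow> coef \<gamma> m \<alpha> \<le> 0" "x \<in> interior_alcove"
  shows "pairing \<gamma> x + m < 0"
  using affine_root_pos_interior[of "- \<gamma>" "- m" x] assms minus_root by (simp add: coef_minus)

lemma interior_alcove_generic: "x \<in> interior_alcove \<Longrightarrow> generic x"
  unfolding generic_def
proof (intro ballI notI)
  fix \<beta> assume x: "x \<in> interior_alcove" and \<beta>: "\<beta> \<in> \<Phi>" and "pairing \<beta> x \<in> \<int>"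
  then have "- pairing \<beta> x \<in> \<int>" by simp
  with \<beta> show False
    by (rule affine_root_sign)
      (use affine_root_pos_interior[OF \<beta> _ _ x] affine_root_neg_interior[OF \<beta> _ _ x] in fastforce)+
qed

lemma interior_alcove_iff: "x \<in> interior_alcove \<longleftrightarrow> x \<in> alcove \<Delta> \<alpha>\<^sub>0 \<and> generic x"
proof
  assume "x \<in> interior_alcove"
  then show "x \<in> alcove \<Delta> \<alpha>\<^sub>0 \<and> generic x"
    using interior_alcove_generic by (auto simp: interior_alcove_def alcove_def less_imp_le)
next
  assume x: "x \<in> alcove \<Delta> \<alpha>\<^sub>0 \<and> generic x"
  then have "pairing \<beta> x \<noteq> of_int k" if "\<beta> \<in> \<Phi>" for \<beta> k
    using that unfolding generic_def by (metis Ints_of_int)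
  from this[of _ 0] this[of _ 1] x show "x \<in> interior_alcove"
    using highest_in_roots simple_is_root
    by (auto simp: interior_alcove_def alcove_def less_le)
qed

end

section \<open>Affine functions, affine reflections and their words\<close>

context semisimple_root_datum
begin

definition aff_fun :: "(rat ^ 'n) \<times> rat \<Rightarrow> rat ^ 'n \<Rightarrow> rat"
  where "aff_fun i v = pairing (fst i) v + snd i"

definition aff_refl :: "(rat ^ 'n) \<times> rat \<Rightarrow> rat ^ 'n \<Rightarrow> rat ^ 'n"
  where "aff_refl i v = v - aff_fun i v *s coroot (fst i)"

lemma aff_refl_conjugate:
  assumes "w \<in> W" "fst i \<in> \<Phi>" "fst j \<in> \<Phi>"
    and u: "\<And>v. u v = w v + t" and eq: "\<And>v. aff_fun j (u v) = aff_fun i v"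
  shows "aff_refl j \<circ> u = u \<circ> aff_refl i"
proof
  fix v
  have "pairing (fst j) (w v) = pairing (fst i) v" for v
    using eq[of v] eq[of 0] by (simp add: aff_fun_def u W_zero[OF assms(1)])
  then have "w (coroot (fst i)) = coroot (fst j)"
    using assms W_coroot by blast
  then show "(aff_refl j \<circ> u) v = (u \<circ> aff_refl i) v"
    using eq[of v] by (simp add: aff_refl_def u W_diff[OF assms(1)] W_scale[OF assms(1)])
qed

lemma aff_fun_aff_refl: "aff_fun j (aff_refl i v) =
    aff_fun (fst j - pairing (fst j) (coroot (fst i)) *s fst i,
      snd j - pairing (fst j) (coroot (fst i)) * snd i) v"
  by (simp add: aff_fun_def aff_refl_def algebra_simps)

lemma aff_fun_aff_refl': "aff_fun j (aff_refl i v) =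
    aff_fun j v - pairing (fst j) (coroot (fst i)) * aff_fun i v"
  by (simp add: aff_fun_def aff_refl_def algebra_simps)

lemma aff_refl_invol: "fst i \<in> \<Phi> \<Longrightarrow> aff_refl i (aff_refl i v) = v"
  using pairing_root_coroot[of "fst i"]
  by (simp add: aff_refl_def[of i "aff_refl i v"] aff_fun_aff_refl')
    (simp add: aff_refl_def vec_eq_iff)

lemma aff_refl_word_affine:
  assumes "set is \<subseteq> \<Phi> \<times> UNIV"
  shows "\<exists>w\<in>W. \<exists>t. \<forall>v. refl_product aff_refl is v = w v + t"
  using assms
proof (induction "is")
  case Nil
  show ?case by (rule bexI[OF _ id_in_refl_group]) (auto simp: refl_product_Nil intro: exI[of _ 0])
next
  case (Cons i "is")
  then obtain w t where w: "w \<in> W" and eq: "\<And>v. refl_product aff_refl is v = w v + t"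
    by auto
  have "root_refl coroot (fst i) \<circ> w \<in> W"
    using Cons.prems w by (intro refl_group_comp root_refl_in_refl_group) auto
  moreover have "refl_product aff_refl (i # is) v =
      (root_refl coroot (fst i) \<circ> w) v + aff_refl i t" for v
    by (simp add: refl_product_Cons eq aff_refl_def aff_fun_def root_refl_def vec_eq_iff
        algebra_simps)
  ultimately show ?case by blast
qed

lemma aff_refl_word_rev:
  assumes "set is \<subseteq> \<Phi> \<times> UNIV"
  shows "refl_product aff_refl is (refl_product aff_refl (rev is) v) = v"
  using assms
  by (induction "is" arbitrary: v)
    (auto simp: refl_product_Nil refl_product_Cons refl_product_snoc aff_refl_invol)

text \<open>Both pairings are positive multiples of
  \<open>form (coroot \<beta>) (coroot \<gamma>)\<close>.\<close>

lemma pairing_coroot_sign: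
  assumes "\<beta> \<in> \<Phi>" "\<gamma> \<in> \<Phi>"
  shows "pairing \<beta> (coroot \<gamma>) \<le> 0 \<longleftrightarrow> pairing \<gamma> (coroot \<beta>) \<le> 0"
proof -
  have "form (coroot \<beta>) (coroot \<beta>) / 2 * pairing \<beta> (coroot \<gamma>) =
      form (coroot \<gamma>) (coroot \<gamma>) / 2 * pairing \<gamma> (coroot \<beta>)"
    using form_coroot[OF assms(1), of "coroot \<gamma>"] form_coroot[OF assms(2), of "coroot \<beta>"]
      form_commute by metis
  then have "form (coroot \<beta>) (coroot \<beta>) * pairing \<beta> (coroot \<gamma>) \<le> 0 \<longleftrightarrow>
      form (coroot \<gamma>) (coroot \<gamma>) * pairing \<gamma> (coroot \<beta>) \<le> 0"
    by (simp add: mult.commute)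
  then show ?thesis
    using form_coroot_pos assms by (simp add: mult_le_0_iff) (meson less_le_not_le)
qed

end

context based_root_datum
begin

definition finite_simple_affine :: "((rat ^ 'n) \<times> rat) set"
  where "finite_simple_affine = (\<lambda>\<alpha>. (\<alpha>, 0)) ` \<Delta>"

definition simple_affine :: "((rat ^ 'n) \<times> rat) set"
  where "simple_affine = insert (- \<alpha>\<^sub>0, 1) finite_simple_affine"

definition affine_roots :: "(rat ^ 'n \<Rightarrow> rat) set"
  where "affine_roots = aff_fun ` (\<Phi> \<times> \<int>)"

lemma simple_affine_cases:
  assumes "i \<in> simple_affine"
  obtains \<alpha> where "\<alpha> \<in> \<Delta>" "i = (\<alpha>, 0)" | "i = (- \<alpha>\<^sub>0, 1)"
  using assms unfolding simple_affine_def finite_simple_affine_def by auto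

lemma finite_simple_affine_subset: "finite_simple_affine \<subseteq> simple_affine"
  unfolding simple_affine_def by auto

lemma simple_affine_subset: "simple_affine \<subseteq> \<Phi> \<times> \<int>"
  unfolding simple_affine_def finite_simple_affine_def
  using highest_in_roots minus_root by auto

lemma interior_alcove_simple_affine: "x \<in> interior_alcove \<longleftrightarrow> (\<forall>i\<in>simple_affine. 0 < aff_fun i x)"
  unfolding interior_alcove_def simple_affine_def finite_simple_affine_def aff_fun_def by auto

lemma alcove_simple_affine: "x \<in> alcove \<Delta> \<alpha>\<^sub>0 \<longleftrightarrow> (\<forall>i\<in>simple_affine. 0 \<le> aff_fun i x)"
  unfolding alcove_def simple_affine_def finite_simple_affine_def aff_fun_def by auto

lemma affine_root_pos_iff:
  assumes "\<gamma> \<in> \<Phi>" "m \<in> \<int>" "x \<in> interior_alcove"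
  shows "0 < aff_fun (\<gamma>, m) x \<longleftrightarrow> 0 \<le> m \<and> (\<forall>\<alpha>\<in>\<Delta>. 0 \<le> coef \<gamma> m \<alpha>)"
proof
  assume "0 < aff_fun (\<gamma>, m) x"
  then show "0 \<le> m \<and> (\<forall>\<alpha>\<in>\<Delta>. 0 \<le> coef \<gamma> m \<alpha>)"
    using affine_root_neg_interior[OF assms(1) _ _ assms(3), of m]
    by (rule_tac affine_root_sign[OF assms(1,2)]) (auto simp: aff_fun_def)
next
  assume "0 \<le> m \<and> (\<forall>\<alpha>\<in>\<Delta>. 0 \<le> coef \<gamma> m \<alpha>)"
  then show "0 < aff_fun (\<gamma>, m) x"
    using affine_root_pos_interior[OF assms(1) _ _ assms(3), of m] by (auto simp: aff_fun_def)
qed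

lemma affine_root_reflected:
  assumes "\<gamma> \<in> \<Phi>" "m \<in> \<int>" "i \<in> simple_affine"
  shows "fst i \<in> \<Phi>" "pairing \<gamma> (coroot (fst i)) \<in> \<int>"
    and "\<gamma> - pairing \<gamma> (coroot (fst i)) *s fst i \<in> \<Phi>"
    and "m - pairing \<gamma> (coroot (fst i)) * snd i \<in> \<int>"
proof -
  show i: "fst i \<in> \<Phi>" using assms(3) simple_affine_subset by auto
  show c: "pairing \<gamma> (coroot (fst i)) \<in> \<int>" by (intro pairing_root_coroot_Ints assms i)
  show "\<gamma> - pairing \<gamma> (coroot (fst i)) *s fst i \<in> \<Phi>"
    using root_refl_char_root[OF i assms(1)] by (simp add: root_refl_char_def)
  show "m - pairing \<gamma> (coroot (fst i)) * snd i \<in> \<int>"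
    using assms c simple_affine_subset by (intro Ints_diff Ints_mult) auto
qed

text \<open>Reflecting in a simple affine root changes only the coefficient at that root. If the
  sign switches, all other coefficients are both nonnegative and nonpositive, hence zero, and
  reducedness leaves only the simple root itself.\<close>

lemma affine_root_eq_simple:
  assumes \<gamma>: "\<gamma> \<in> \<Phi>" and m: "m \<in> \<int>" and i: "i \<in> simple_affine" and x: "x \<in> interior_alcove"
    and pos: "0 < aff_fun (\<gamma>, m) x" and neg: "aff_fun (\<gamma>, m) (aff_refl i x) \<le> 0"
  shows "(\<gamma>, m) = i"
proof -
  define c where "c = pairing \<gamma> (coroot (fst i))"
  define \<gamma>' where "\<gamma>' = \<gamma> - c *s fst i"
  define m' where "m' = m - c * snd i"
  have mem: "\<gamma>' \<in> \<Phi>" "m' \<in> \<int>"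
    using affine_root_reflected[OF \<gamma> m i] unfolding \<gamma>'_def m'_def c_def by auto
  have ge: "0 \<le> m" "\<alpha> \<in> \<Delta> \<Longrightarrow> 0 \<le> coef \<gamma> m \<alpha>" for \<alpha>
    using pos affine_root_pos_iff[OF \<gamma> m x] by auto
  have "aff_fun (\<gamma>', m') x \<le> 0"
    using neg by (simp add: aff_fun_aff_refl \<gamma>'_def m'_def c_def)
  then have le: "m' \<le> 0 \<and> (\<forall>\<alpha>\<in>\<Delta>. coef \<gamma>' m' \<alpha> \<le> 0)"
    using affine_root_pos_iff[OF mem x] by (rule_tac affine_root_sign[OF mem]) auto
  from i show ?thesis
  proof (cases rule: simple_affine_cases)
    case (1 \<alpha>)
    have m0: "m = 0" using le ge 1 by (simp add: m'_def)
    have "pairing \<gamma> (coweight \<beta>) = 0" if "\<beta> \<in> \<Delta>" "\<beta> \<noteq> \<alpha>" for \<beta>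
      using le ge(2)[OF that(1)] that 1 by (auto simp: \<gamma>'_def m'_def coef_def pairing_coweight m0)
    then have "\<gamma> = (\<Sum>\<beta>\<in>\<Delta>. if \<beta> = \<alpha> then pairing \<gamma> (coweight \<alpha>) *s \<alpha> else 0)"
      by (subst simple_expansion) (intro sum.cong, auto)
    then have eq: "\<gamma> = pairing \<gamma> (coweight \<alpha>) *s \<alpha>"
      using finite_simple 1 by (simp add: sum.delta)
    have "0 \<le> pairing \<gamma> (coweight \<alpha>)"
      using ge(2)[OF 1(1)] m0 by (simp add: coef_def)
    moreover have "pairing \<gamma> (coweight \<alpha>) = 1 \<or> pairing \<gamma> (coweight \<alpha>) = -1"
      using reduced[of \<alpha> "pairing \<gamma> (coweight \<alpha>)"] eq \<gamma> 1 by auto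
    ultimately show ?thesis using eq m0 1 by auto
  next
    case 2
    have "pairing \<gamma> (coweight \<beta>) = - m * pairing \<alpha>\<^sub>0 (coweight \<beta>)" if "\<beta> \<in> \<Delta>" for \<beta>
      using le ge(2)[OF that(1)] that 2 by (auto simp: \<gamma>'_def m'_def coef_def algebra_simps)
    then have "\<gamma> = (\<Sum>\<beta>\<in>\<Delta>. (- m) *s (pairing \<alpha>\<^sub>0 (coweight \<beta>) *s \<beta>))"
      by (subst simple_expansion) (simp add: vector_smult_assoc)
    also have "\<dots> = (- m) *s (\<Sum>\<beta>\<in>\<Delta>. pairing \<alpha>\<^sub>0 (coweight \<beta>) *s \<beta>)"
      by (simp add: vec.scale_sum_right)
    also have "\<dots> = (- m) *s \<alpha>\<^sub>0"
      by (simp only: simple_expansion[symmetric])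
    finally have eq: "\<gamma> = (- m) *s \<alpha>\<^sub>0" .
    then have "- m = 1 \<or> - m = - 1"
      using reduced[of \<alpha>\<^sub>0 "- m"] \<gamma> highest_in_roots by auto
    then have "m = 1" using ge by auto
    then show ?thesis using eq 2 by (simp add: vec_eq_iff)
  qed
qed

text \<open>The base point stays arbitrary because freeness starts from a given interior point,
  whereas the length arguments use \<open>center\<close>.\<close>

lemma reflection_system_alcove:
  assumes "x \<in> interior_alcove"
  shows "reflection_system simple_affine aff_refl aff_fun affine_roots x"
proof
  show "aff_refl i (aff_refl i v) = v" if "i \<in> simple_affine" for i v
    using that simple_affine_subset by (intro aff_refl_invol) auto
  show "aff_fun i \<in> affine_roots" if "i \<in> simple_affine" for i
    using that simple_affine_subset unfolding affine_roots_def by auto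
  show "b \<circ> aff_refl i \<in> affine_roots" if "b \<in> affine_roots" "i \<in> simple_affine" for b i
  proof -
    from that(1) obtain \<gamma> m where b: "\<gamma> \<in> \<Phi>" "m \<in> \<int>" "b = aff_fun (\<gamma>, m)"
      unfolding affine_roots_def by auto
    have "b \<circ> aff_refl i = aff_fun (\<gamma> - pairing \<gamma> (coroot (fst i)) *s fst i,
        m - pairing \<gamma> (coroot (fst i)) * snd i)"
      unfolding b by (rule ext) (simp add: aff_fun_aff_refl)
    then show ?thesis
      using affine_root_reflected[OF b(1,2) that(2)] unfolding affine_roots_def by blast
  qed
  show "b x \<noteq> 0" if "b \<in> affine_roots" for b
  proof -
    from that obtain \<gamma> m where b: "\<gamma> \<in> \<Phi>" "m \<in> \<int>" "b = aff_fun (\<gamma>, m)"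
      unfolding affine_roots_def by auto
    then have "pairing \<gamma> x \<noteq> - m"
      using interior_alcove_generic[OF assms] unfolding generic_def by (metis Ints_minus)
    then show ?thesis by (simp add: b aff_fun_def)
  qed
  show "aff_fun i x > 0" if "i \<in> simple_affine" for i
    using assms that interior_alcove_simple_affine by auto
  show "aff_fun i (aff_refl i v) = - aff_fun i v" if "i \<in> simple_affine" for i v
  proof -
    have "fst i \<in> \<Phi>" using that simple_affine_subset by auto
    then show ?thesis by (simp add: aff_fun_aff_refl' pairing_root_coroot)
  qed
  show "b (aff_refl i x) > 0"
    if "b \<in> affine_roots" "i \<in> simple_affine" "b x > 0" "b \<noteq> aff_fun i" for b i
  proof -
    from that(1) obtain \<gamma> m where b: "\<gamma> \<in> \<Phi>" "m \<in> \<int>" "b = aff_fun (\<gamma>, m)"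
      unfolding affine_roots_def by auto
    then show ?thesis
      using affine_root_eq_simple[OF b(1,2) that(2) assms] that by force
  qed
  show "aff_refl j \<circ> refl_product aff_refl is = refl_product aff_refl is \<circ> aff_refl i"
    if "i \<in> simple_affine" "j \<in> simple_affine" "set is \<subseteq> simple_affine"
      "aff_fun j \<circ> refl_product aff_refl is = aff_fun i" for i j "is"
  proof -
    have "set is \<subseteq> \<Phi> \<times> UNIV"
      using that(3) simple_affine_subset by auto
    then obtain w t where "w \<in> W" "\<And>v. refl_product aff_refl is v = w v + t"
      using aff_refl_word_affine[of "is"] by blast
    moreover have "aff_fun j (refl_product aff_refl is v) = aff_fun i v" for v
      using fun_cong[OF that(4), of v] by simp
    ultimately show ?thesis
      using that simple_affine_subset by (intro aff_refl_conjugate[of w i j _ t]) auto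
  qed
qed

section \<open>The Coxeter number, the center of the alcove, and descent on heights of affine
  roots\<close>

definition coxeter_number :: rat
  where "coxeter_number = 1 + pairing \<alpha>\<^sub>0 (\<Sum>\<alpha>\<in>\<Delta>. coweight \<alpha>)"

definition center :: "rat ^ 'n"
  where "center = (1 / coxeter_number) *s (\<Sum>\<alpha>\<in>\<Delta>. coweight \<alpha>)"

lemma pairing_sum_coweight: "\<alpha> \<in> \<Delta> \<Longrightarrow> pairing \<alpha> (\<Sum>\<alpha>\<in>\<Delta>. coweight \<alpha>) = 1"
  using finite_simple by (simp add: pairing_sum_right pairing_coweight)

lemma coxeter_number_pos: "coxeter_number > 0"
  unfolding coxeter_number_def pairing_sum_right
  using mark_ge_1 by (intro add_pos_nonneg sum_nonneg) (auto intro: order_trans[OF zero_le_one])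

lemma aff_fun_center: "i \<in> simple_affine \<Longrightarrow> aff_fun i center = 1 / coxeter_number"
  using coxeter_number_pos
  by (elim simple_affine_cases)
    (auto simp: aff_fun_def center_def pairing_sum_coweight coxeter_number_def field_simps)

lemma center_interior: "center \<in> interior_alcove"
  using coxeter_number_pos by (simp add: interior_alcove_simple_affine aff_fun_center)

lemma coxeter_number_Ints: "coxeter_number \<in> \<int>"
  unfolding coxeter_number_def pairing_sum_right
  by (intro Ints_add Ints_sum root_coweight_Ints highest_in_roots) auto

text \<open>The scaled value is the height of the affine root: the sum of its coefficients at all
  affine simple roots, including the one at \<open>1 - \<alpha>\<^sub>0\<close>.\<close>

lemma aff_fun_center_Ints:
  assumes "\<gamma> \<in> \<Phi>" "m \<in> \<int>"
  shows "coxeter_number * aff_fun (\<gamma>, m) center \<in> \<int>"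
proof -
  have "coxeter_number * aff_fun (\<gamma>, m) center = (\<Sum>\<alpha>\<in>\<Delta>. pairing \<gamma> (coweight \<alpha>)) + coxeter_number * m"
    using coxeter_number_pos by (simp add: aff_fun_def center_def pairing_sum_right field_simps)
  then show ?thesis
    using assms by (auto intro!: Ints_add Ints_mult Ints_sum root_coweight_Ints coxeter_number_Ints)
qed

text \<open>If all these pairings were nonpositive, expanding the affine root at its own coroot
  would write 2 as a sum of nonpositive terms. For m = 0 the affine node has coefficient zero, so
  the finite simple roots suffice.\<close>

lemma descent_step:
  assumes \<gamma>: "\<gamma> \<in> \<Phi>" and pos: "0 \<le> m" "\<And>\<alpha>. \<alpha> \<in> \<Delta> \<Longrightarrow> 0 \<le> coef \<gamma> m \<alpha>"
  shows "\<exists>i\<in>simple_affine. 0 < pairing \<gamma> (coroot (fst i)) \<and> (m = 0 \<longrightarrow> i \<in> finite_simple_affine)"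
proof (rule ccontr)
  assume neg: "\<not> ?thesis"
  have 1: "pairing \<alpha> (coroot \<gamma>) \<le> 0" if "\<alpha> \<in> \<Delta>" for \<alpha>
  proof -
    have "(\<alpha>, 0) \<in> finite_simple_affine"
      using that by (simp add: finite_simple_affine_def)
    then have "pairing \<gamma> (coroot \<alpha>) \<le> 0"
      using neg finite_simple_affine_subset by force
    then show ?thesis using pairing_coroot_sign[OF \<gamma>] that by auto
  qed
  have 2: "m * pairing (- \<alpha>\<^sub>0) (coroot \<gamma>) \<le> 0"
  proof (cases "m = 0")
    case False
    have "(- \<alpha>\<^sub>0, 1) \<in> simple_affine" by (simp add: simple_affine_def)
    then have "pairing \<gamma> (coroot (- \<alpha>\<^sub>0)) \<le> 0" using neg False by force
    then have "pairing (- \<alpha>\<^sub>0) (coroot \<gamma>) \<le> 0"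
      using pairing_coroot_sign[OF \<gamma> minus_root[OF highest_in_roots]] by simp
    then show ?thesis using pos by (simp only: mult_nonneg_nonpos)
  qed auto
  have "2 = (\<Sum>\<alpha>\<in>\<Delta>. coef \<gamma> m \<alpha> * pairing \<alpha> (coroot \<gamma>)) + m * pairing (- \<alpha>\<^sub>0) (coroot \<gamma>)"
    using affine_root_expansion[of \<gamma> "coroot \<gamma>" m] pairing_root_coroot[OF \<gamma>]
    by (simp add: algebra_simps)
  also have "\<dots> \<le> 0"
    by (rule add_nonpos_nonpos[OF sum_nonpos 2]) (use 1 pos in \<open>simp add: mult_nonneg_nonpos\<close>)
  finally show False by simp
qed

text \<open>Induction on the height. The clause for m = 0 carries the finite case along, so one
  induction serves both the generation of W and that of the affine Weyl group by simple
  reflections.\<close>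

lemma conjugate_to_simple:
  assumes "\<gamma> \<in> \<Phi>" "m \<in> \<int>" "0 < aff_fun (\<gamma>, m) center"
  shows "\<exists>is i. i \<in> simple_affine \<and> set is \<subseteq> simple_affine \<and>
    (m = 0 \<longrightarrow> i \<in> finite_simple_affine \<and> set is \<subseteq> finite_simple_affine) \<and>
    (\<forall>v. aff_fun (\<gamma>, m) (refl_product aff_refl is v) = aff_fun i v)"
  using assms
proof (induction "nat \<lfloor>coxeter_number * aff_fun (\<gamma>, m) center\<rfloor>" arbitrary: \<gamma> m
    rule: less_induct)
  case less
  let ?h = "\<lambda>\<gamma> m. coxeter_number * aff_fun (\<gamma>, m) center"
  interpret reflection_system simple_affine aff_refl aff_fun affine_roots center
    by (intro reflection_system_alcove center_interior)
  have "0 \<le> m" "\<And>\<alpha>. \<alpha> \<in> \<Delta> \<Longrightarrow> 0 \<le> coef \<gamma> m \<alpha>"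
    using less.prems affine_root_pos_iff center_interior by auto
  from descent_step[OF less.prems(1) this] obtain i where i: "i \<in> simple_affine"
    "0 < pairing \<gamma> (coroot (fst i))" "m = 0 \<Longrightarrow> i \<in> finite_simple_affine" by blast
  show ?case
  proof (cases "(\<gamma>, m) = i")
    case True
    then show ?thesis
      using i by (intro exI[of _ "[]"] exI[of _ i]) (auto simp: refl_product_Nil)
  next
    case False
    define c where "c = pairing \<gamma> (coroot (fst i))"
    define \<gamma>' where "\<gamma>' = \<gamma> - c *s fst i"
    define m' where "m' = m - c * snd i"
    have mem: "\<gamma>' \<in> \<Phi>" "m' \<in> \<int>" and c: "c \<in> \<int>" "0 < c"
      using affine_root_reflected[OF less.prems(1,2) i(1)] i(2)
      unfolding \<gamma>'_def m'_def c_def by auto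
    have refl: "aff_fun (\<gamma>, m) (aff_refl i v) = aff_fun (\<gamma>', m') v" for v
      by (simp add: aff_fun_aff_refl \<gamma>'_def m'_def c_def)
    have pos: "0 < aff_fun (\<gamma>', m') center"
      using affine_root_eq_simple[OF less.prems(1,2) i(1) center_interior less.prems(3)] False refl
      by force
    \<comment> \<open>An affine simple root has height one, so the reflection lowers the height by
      exactly the pairing \<open>c\<close>, a positive integer.\<close>
    have "?h \<gamma>' m' = ?h \<gamma> m - c"
      using coxeter_number_pos
      by (simp add: refl[symmetric] aff_fun_aff_refl' aff_fun_center i c_def field_simps)
    moreover have "?h \<gamma> m \<in> \<int>" "?h \<gamma>' m' \<in> \<int>"
      using aff_fun_center_Ints less.prems mem by auto
    moreover have "0 < ?h \<gamma>' m'"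
      using pos coxeter_number_pos by simp
    ultimately have "nat \<lfloor>?h \<gamma>' m'\<rfloor> < nat \<lfloor>?h \<gamma> m\<rfloor>"
      using c by (auto elim!: Ints_cases)
    from less.hyps[OF this mem pos] obtain "is" j where js: "j \<in> simple_affine"
      "set is \<subseteq> simple_affine"
      "m' = 0 \<longrightarrow> j \<in> finite_simple_affine \<and> set is \<subseteq> finite_simple_affine"
      "\<And>v. aff_fun (\<gamma>', m') (refl_product aff_refl is v) = aff_fun j v" by blast
    have "m = 0 \<Longrightarrow> m' = 0"
      using i(3) by (auto simp: m'_def finite_simple_affine_def)
    then show ?thesis
      using js i by (intro exI[of _ "i # is"] exI[of _ j]) (auto simp: refl_product_Cons refl)
  qed
qed

end

section \<open>The affine Weyl group\<close>

context based_root_datum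
begin

abbreviation Q :: "(rat ^ 'n) set"
  where "Q \<equiv> coroot_lattice coroot \<Delta>"

lemma latticeI: "v = (\<Sum>\<alpha>\<in>\<Delta>. of_int (c \<alpha>) *s coroot \<alpha>) \<Longrightarrow> v \<in> Q"
  unfolding coroot_lattice_def by auto

lemma lattice_zero: "0 \<in> Q"
  unfolding coroot_lattice_def by (auto intro!: exI[of _ "\<lambda>_. 0"])

lemma lattice_add: "u \<in> Q \<Longrightarrow> v \<in> Q \<Longrightarrow> u + v \<in> Q"
proof -
  assume "u \<in> Q" "v \<in> Q"
  then obtain c d :: "rat ^ 'n \<Rightarrow> int" where
    "u = (\<Sum>\<alpha>\<in>\<Delta>. of_int (c \<alpha>) *s coroot \<alpha>)" "v = (\<Sum>\<alpha>\<in>\<Delta>. of_int (d \<alpha>) *s coroot \<alpha>)"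
    unfolding coroot_lattice_def by auto
  then have "u + v = (\<Sum>\<alpha>\<in>\<Delta>. of_int (c \<alpha> + d \<alpha>) *s coroot \<alpha>)"
    by (simp add: vector_sadd_rdistrib sum.distrib)
  then show ?thesis by (rule latticeI)
qed

lemma lattice_scale: "k \<in> \<int> \<Longrightarrow> u \<in> Q \<Longrightarrow> k *s u \<in> Q"
proof -
  assume "k \<in> \<int>" "u \<in> Q"
  then obtain c :: "rat ^ 'n \<Rightarrow> int" and l where
    "u = (\<Sum>\<alpha>\<in>\<Delta>. of_int (c \<alpha>) *s coroot \<alpha>)" "k = of_int l"
    unfolding coroot_lattice_def by (auto elim: Ints_cases)
  then have "k *s u = (\<Sum>\<alpha>\<in>\<Delta>. of_int (l * c \<alpha>) *s coroot \<alpha>)"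
    by (simp add: vec.scale_sum_right vector_smult_assoc)
  then show ?thesis by (rule latticeI)
qed

lemma lattice_minus: "u \<in> Q \<Longrightarrow> - u \<in> Q"
  using lattice_scale[of "- 1" u] by simp

lemma lattice_diff: "u \<in> Q \<Longrightarrow> v \<in> Q \<Longrightarrow> u - v \<in> Q"
  using lattice_add[of u "- v"] lattice_minus by simp

lemma lattice_sum: "(\<And>i. i \<in> A \<Longrightarrow> f i \<in> Q) \<Longrightarrow> sum f A \<in> Q"
  by (induction A rule: infinite_finite_induct) (auto intro: lattice_zero lattice_add)

lemma lattice_simple: "\<alpha> \<in> \<Delta> \<Longrightarrow> coroot \<alpha> \<in> Q"
proof -
  assume "\<alpha> \<in> \<Delta>"
  then have "coroot \<alpha> = (\<Sum>\<beta>\<in>\<Delta>. (if \<beta> = \<alpha> then coroot \<beta> else 0))"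
    using finite_simple by (simp add: sum.delta)
  also have "\<dots> = (\<Sum>\<beta>\<in>\<Delta>. of_int (if \<beta> = \<alpha> then 1 else 0) *s coroot \<beta>)"
    by (intro sum.cong) auto
  finally show ?thesis by (rule latticeI)
qed

lemma lattice_induct [consumes 1, case_names zero add diff]:
  assumes "v \<in> Q" and zero: "P 0"
    and add: "\<And>u \<alpha>. P u \<Longrightarrow> \<alpha> \<in> \<Delta> \<Longrightarrow> P (u + coroot \<alpha>)"
    and diff: "\<And>u \<alpha>. P u \<Longrightarrow> \<alpha> \<in> \<Delta> \<Longrightarrow> P (u - coroot \<alpha>)"
  shows "P v"
proof -
  obtain c :: "rat ^ 'n \<Rightarrow> int" where v: "v = (\<Sum>\<alpha>\<in>\<Delta>. of_int (c \<alpha>) *s coroot \<alpha>)"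
    using assms(1) unfolding coroot_lattice_def by auto
  have step: "P (u + of_int k *s coroot \<alpha>)" if "P u" "\<alpha> \<in> \<Delta>" for u k \<alpha>
  proof (induction k rule: int_induct[where k = 0])
    case (step1 i)
    have "u + of_int (i + 1) *s coroot \<alpha> = (u + of_int i *s coroot \<alpha>) + coroot \<alpha>"
      by (simp add: vector_sadd_rdistrib)
    then show ?case using add[OF step1(2) that(2)] by metis
  next
    case (step2 i)
    have "u + of_int (i - 1) *s coroot \<alpha> = (u + of_int i *s coroot \<alpha>) - coroot \<alpha>"
      by (simp add: vec_eq_iff algebra_simps)
    then show ?case using diff[OF step2(2) that(2)] by metis
  qed (use that in simp)
  have "P (\<Sum>\<alpha>\<in>A. of_int (c \<alpha>) *s coroot \<alpha>)" if "A \<subseteq> \<Delta>" "finite A" for A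
    using that(2,1)
  proof (induction A rule: finite_induct)
    case (insert \<alpha> A)
    then show ?case
      using step[of "\<Sum>\<alpha>\<in>A. of_int (c \<alpha>) *s coroot \<alpha>" \<alpha> "c \<alpha>"] by (simp add: add.commute)
  qed (simp add: zero)
  then show ?thesis using v finite_simple by simp
qed

lemma aff_refl_linear: "aff_refl (\<alpha>, 0) = root_refl coroot \<alpha>"
  by (simp add: fun_eq_iff aff_refl_def aff_fun_def root_refl_def)

lemma finite_word: "set is \<subseteq> finite_simple_affine \<Longrightarrow>
    set (map fst is) \<subseteq> \<Delta> \<and> refl_product aff_refl is = refl_word coroot (map fst is)"
  by (induction "is")
    (auto simp: refl_product_Nil refl_product_Cons aff_refl_linear finite_simple_affine_def)

lemma finite_word': "set as \<subseteq> \<Delta> \<Longrightarrow>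
    set (map (\<lambda>\<alpha>. (\<alpha>, 0)) as) \<subseteq> finite_simple_affine \<and>
    refl_product aff_refl (map (\<lambda>\<alpha>. (\<alpha>, 0)) as) = refl_word coroot as"
  by (induction as)
    (auto simp: refl_product_Nil refl_product_Cons aff_refl_linear finite_simple_affine_def)

lemma root_sign:
  assumes "\<gamma> \<in> \<Phi>" "x \<in> interior_alcove"
  shows "0 < pairing \<gamma> x \<longleftrightarrow> (\<forall>\<alpha>\<in>\<Delta>. 0 \<le> pairing \<gamma> (coweight \<alpha>))"
  using affine_root_pos_iff[OF assms(1) _ assms(2), of 0] by (simp add: coef_def aff_fun_def)

lemma root_pairing_interior_nonzero: "\<gamma> \<in> \<Phi> \<Longrightarrow> x \<in> interior_alcove \<Longrightarrow> pairing \<gamma> x \<noteq> 0"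
  using interior_alcove_generic unfolding generic_def by (metis Ints_0)

lemma simple_group_subset: "refl_group coroot \<Delta> \<subseteq> W"
  by (intro refl_group_mono simple_subset)

lemma positive_root_conjugate:
  assumes "\<gamma> \<in> \<Phi>" "0 < pairing \<gamma> center"
  obtains u \<alpha> where "u \<in> refl_group coroot \<Delta>" "\<alpha> \<in> \<Delta>" "\<And>v. pairing \<gamma> (u v) = pairing \<alpha> v"
proof -
  obtain "is" i where "i \<in> finite_simple_affine" and s: "set is \<subseteq> finite_simple_affine"
    and eq: "\<And>v. aff_fun (\<gamma>, 0) (refl_product aff_refl is v) = aff_fun i v"
    using conjugate_to_simple[OF assms(1), of 0] assms(2) by (auto simp: aff_fun_def)
  then obtain \<alpha> where "\<alpha> \<in> \<Delta>" "i = (\<alpha>, 0)"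
    unfolding finite_simple_affine_def by auto
  moreover have "refl_word coroot (map fst is) \<in> refl_group coroot \<Delta>"
    using finite_word[OF s] unfolding refl_group_def by blast
  ultimately show ?thesis
    using that[of "refl_word coroot (map fst is)" \<alpha>] eq finite_word[OF s] by (simp add: aff_fun_def)
qed

lemma simple_group_lattice: "u \<in> refl_group coroot \<Delta> \<Longrightarrow> v \<in> Q \<Longrightarrow> u v \<in> Q"
proof (induction rule: refl_group_induct)
  case (comp \<alpha> w)
  have ints: "pairing \<alpha> v \<in> \<int>" if "v \<in> Q" for v
    using that comp(1)
    by (induction rule: lattice_induct) (auto intro!: Ints_add Ints_diff pairing_root_coroot_Ints)
  show ?case
    using comp ints by (auto simp: root_refl_def intro!: lattice_diff lattice_scale lattice_simple)
qed auto

text \<open>Conjugation by \<open>u\<close> transports both the coroot and the reflection of a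
  simple root to those of \<gamma>.\<close>

lemma positive_coroot_and_reflection:
  assumes "\<gamma> \<in> \<Phi>" "0 < pairing \<gamma> center"
  shows "coroot \<gamma> \<in> Q \<and> root_refl coroot \<gamma> \<in> refl_group coroot \<Delta>"
proof -
  obtain u \<alpha> where u: "u \<in> refl_group coroot \<Delta>" "\<alpha> \<in> \<Delta>" "\<And>v. pairing \<gamma> (u v) = pairing \<alpha> v"
    using positive_root_conjugate[OF assms] by blast
  then have uW: "u \<in> W" using simple_group_subset by auto
  have co: "u (coroot \<alpha>) = coroot \<gamma>"
    using u assms(1) by (intro W_coroot[OF uW]) auto
  have "root_refl coroot \<gamma> = u \<circ> root_refl coroot \<alpha> \<circ> inv u"
  proof
    fix v
    have "pairing \<alpha> (inv u v) = pairing \<gamma> v"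
      using u(3)[of "inv u v"] by (simp add: W_inv_right[OF uW])
    then show "root_refl coroot \<gamma> v = (u \<circ> root_refl coroot \<alpha> \<circ> inv u) v"
      by (simp add: root_refl_def W_diff[OF uW] W_scale[OF uW] W_inv_right[OF uW] co)
  qed
  moreover have "inv u \<in> refl_group coroot \<Delta>"
    using refl_group_bij_inv[OF simple_subset u(1)] by simp
  ultimately show ?thesis
    using simple_group_lattice[OF u(1) lattice_simple[OF u(2)]] u co
    by (auto intro!: refl_group_comp root_refl_in_refl_group)
qed

lemma coroot_and_reflection:
  assumes "\<gamma> \<in> \<Phi>"
  shows "coroot \<gamma> \<in> Q \<and> root_refl coroot \<gamma> \<in> refl_group coroot \<Delta>"
proof (cases "0 < pairing \<gamma> center")
  case False
  then have "0 < pairing (- \<gamma>) center"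
    using root_pairing_interior_nonzero[OF assms center_interior] by simp
  moreover have "root_refl coroot (- \<gamma>) = root_refl coroot \<gamma>"
    by (simp add: fun_eq_iff root_refl_def coroot_minus[OF assms] vec_eq_iff)
  ultimately show ?thesis
    using positive_coroot_and_reflection[OF minus_root[OF assms]] coroot_minus[OF assms]
      lattice_minus[of "- coroot \<gamma>"] by simp
qed (use positive_coroot_and_reflection assms in auto)

lemma coroot_in_lattice: "\<gamma> \<in> \<Phi> \<Longrightarrow> coroot \<gamma> \<in> Q"
  using coroot_and_reflection by blast

lemma simple_group_eq: "refl_group coroot \<Delta> = W"
proof
  show "W \<subseteq> refl_group coroot \<Delta>"
  proof
    fix w assume "w \<in> W"
    then show "w \<in> refl_group coroot \<Delta>"
    proof (induction rule: refl_group_induct)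
      case (comp \<alpha> w)
      then show ?case using coroot_and_reflection by (intro refl_group_comp) auto
    qed (rule id_in_refl_group)
  qed
qed (rule simple_group_subset)

lemma W_lattice: "w \<in> W \<Longrightarrow> v \<in> Q \<Longrightarrow> w v \<in> Q"
  using simple_group_lattice simple_group_eq by auto

section \<open>Coweights modulo coroots\<close>

definition coweight_lattice :: "(rat ^ 'n) set"
  where "coweight_lattice = {v. \<forall>\<beta>\<in>\<Phi>. pairing \<beta> v \<in> \<int>}"

lemma coweight_lattice_add: "u \<in> coweight_lattice \<Longrightarrow> v \<in> coweight_lattice \<Longrightarrow> u + v \<in> coweight_lattice"
  and coweight_lattice_diff: "u \<in> coweight_lattice \<Longrightarrow> v \<in> coweight_lattice \<Longrightarrow> u - v \<in> coweight_lattice"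
  and coweight_lattice_scale: "k \<in> \<int> \<Longrightarrow> u \<in> coweight_lattice \<Longrightarrow> k *s u \<in> coweight_lattice"
  by (auto simp: coweight_lattice_def)

lemma lattice_subset_coweight_lattice: "Q \<subseteq> coweight_lattice"
proof
  fix v assume "v \<in> Q"
  then show "v \<in> coweight_lattice"
    by (induction rule: lattice_induct)
      (auto simp: coweight_lattice_def intro!: Ints_add Ints_diff pairing_root_coroot_Ints)
qed

lemma W_coweight_lattice: "w \<in> W \<Longrightarrow> v \<in> coweight_lattice \<Longrightarrow> w v \<in> coweight_lattice"
  unfolding coweight_lattice_def using W_root by fastforce

text \<open>A reflection changes a coweight by an integral multiple of a coroot. Consequently
  conjugation by W leaves the class of a translation modulo \<open>Q\<close> unchanged.\<close>

lemma W_trivial_mod_lattice: "w \<in> W \<Longrightarrow> v \<in> coweight_lattice \<Longrightarrow> w v - v \<in> Q"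
proof (induction rule: refl_group_induct)
  case (comp \<alpha> w)
  have "pairing \<alpha> (w v) \<in> \<int>"
    using W_coweight_lattice[OF comp(2,4)] comp(1) by (simp add: coweight_lattice_def)
  then have "(w v - v) - pairing \<alpha> (w v) *s coroot \<alpha> \<in> Q"
    using comp coroot_in_lattice by (intro lattice_diff[OF comp(3)[OF comp(4)]] lattice_scale)
  moreover have "(root_refl coroot \<alpha> \<circ> w) v - v = (w v - v) - pairing \<alpha> (w v) *s coroot \<alpha>"
    by (simp add: root_refl_def)
  ultimately show ?case by metis
qed (simp add: lattice_zero)

section \<open>The affine Weyl group: generation by simple affine reflections, freeness and
  transitivity\<close>

definition affine_weyl :: "(rat ^ 'n \<Rightarrow> rat ^ 'n) set"
  where "affine_weyl = {(\<lambda>v. w v + t) | w t. w \<in> W \<and> t \<in> Q}"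

lemma affine_weylI: "w \<in> W \<Longrightarrow> t \<in> Q \<Longrightarrow> (\<And>v. \<omega> v = w v + t) \<Longrightarrow> \<omega> \<in> affine_weyl"
  unfolding affine_weyl_def by (auto simp: fun_eq_iff)

lemma affine_weylE:
  assumes "\<omega> \<in> affine_weyl"
  obtains w t where "w \<in> W" "t \<in> Q" "\<omega> = (\<lambda>v. w v + t)"
  using assms unfolding affine_weyl_def by blast

lemma affine_weyl_comp: "\<omega> \<in> affine_weyl \<Longrightarrow> \<eta> \<in> affine_weyl \<Longrightarrow> \<omega> \<circ> \<eta> \<in> affine_weyl"
proof -
  assume \<omega>: "\<omega> \<in> affine_weyl" and \<eta>: "\<eta> \<in> affine_weyl"
  from \<omega> obtain w t where 1: "w \<in> W" "t \<in> Q" "\<omega> = (\<lambda>v. w v + t)"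
    by (rule affine_weylE)
  from \<eta> obtain w' t' where 2: "w' \<in> W" "t' \<in> Q" "\<eta> = (\<lambda>v. w' v + t')"
    by (rule affine_weylE)
  note * = 1 2
  have "w \<circ> w' \<in> W" "w t' + t \<in> Q"
    using refl_group_comp[OF *(1,4)] lattice_add[OF W_lattice[OF *(1,5)] *(2)] by blast+
  then show ?thesis
    by (rule affine_weylI) (simp add: * W_add[OF *(1)])
qed

lemma affine_weyl_bij_inv: "\<omega> \<in> affine_weyl \<Longrightarrow> bij \<omega> \<and> inv \<omega> \<in> affine_weyl"
proof -
  assume "\<omega> \<in> affine_weyl"
  then obtain w t where *: "w \<in> W" "t \<in> Q" "\<omega> = (\<lambda>v. w v + t)"
    by (rule affine_weylE)
  let ?\<eta> = "\<lambda>v. inv w v + (- inv w t)"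
  have "\<omega> \<circ> ?\<eta> = id" "?\<eta> \<circ> \<omega> = id"
    by (simp_all add: fun_eq_iff * W_diff[OF *(1)] W_add[OF W_inv[OF *(1)]]
        W_inv_left[OF *(1)] W_inv_right[OF *(1)])
  then have "bij \<omega>" "inv \<omega> = ?\<eta>"
    by (auto intro: o_bij inv_unique_comp)
  moreover have "?\<eta> \<in> affine_weyl"
    by (intro affine_weylI[OF W_inv[OF *(1)] lattice_minus[OF W_lattice[OF W_inv[OF *(1)] *(2)]]] refl)
  ultimately show ?thesis by simp
qed

lemma aff_refl_in_affine_weyl:
  assumes "\<gamma> \<in> \<Phi>" "m \<in> \<int>"
  shows "aff_refl (\<gamma>, m) \<in> affine_weyl"
  by (rule affine_weylI[of "root_refl coroot \<gamma>" "- (m *s coroot \<gamma>)"])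
    (use assms in \<open>auto intro!: root_refl_in_refl_group lattice_minus lattice_scale coroot_in_lattice
      simp: aff_refl_def aff_fun_def root_refl_def vector_sadd_rdistrib\<close>)

text \<open>The exchange argument applies to words only, so the group of affine maps has to be shown
  to consist of them.\<close>

definition simple_words :: "(rat ^ 'n \<Rightarrow> rat ^ 'n) set"
  where "simple_words = {refl_product aff_refl is | is. set is \<subseteq> simple_affine}"

lemma simple_words_comp: "u \<in> simple_words \<Longrightarrow> v \<in> simple_words \<Longrightarrow> u \<circ> v \<in> simple_words"
proof -
  assume "u \<in> simple_words" "v \<in> simple_words"
  then obtain "is" js where "u = refl_product aff_refl is" "set is \<subseteq> simple_affine"
    "v = refl_product aff_refl js" "set js \<subseteq> simple_affine"
    unfolding simple_words_def by auto
  then show ?thesis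
    unfolding simple_words_def by (auto intro!: exI[of _ "is @ js"] simp: refl_product_append)
qed

lemma id_in_simple_words: "id \<in> simple_words"
  unfolding simple_words_def by (auto intro!: exI[of _ "[]"] simp: refl_product_Nil)

lemma positive_aff_refl_in_simple_words:
  assumes "\<gamma> \<in> \<Phi>" "m \<in> \<int>" "0 < aff_fun (\<gamma>, m) center"
  shows "aff_refl (\<gamma>, m) \<in> simple_words"
proof -
  obtain "is" i where i: "i \<in> simple_affine" "set is \<subseteq> simple_affine"
    and eq: "\<And>v. aff_fun (\<gamma>, m) (refl_product aff_refl is v) = aff_fun i v"
    using conjugate_to_simple[OF assms] by blast
  let ?u = "refl_product aff_refl is" and ?u' = "refl_product aff_refl (rev is)"
  have sub: "set is \<subseteq> \<Phi> \<times> UNIV" using i simple_affine_subset by auto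
  then obtain w t where w: "w \<in> W" "\<And>v. ?u v = w v + t"
    using aff_refl_word_affine by blast
  have conj: "aff_refl (\<gamma>, m) \<circ> ?u = ?u \<circ> aff_refl i"
    using aff_refl_conjugate[OF w(1) _ _ w(2) eq] assms i simple_affine_subset by auto
  have "aff_refl (\<gamma>, m) v = ?u (aff_refl i (?u' v))" for v
    using fun_cong[OF conj, of "?u' v"] aff_refl_word_rev[OF sub] by simp
  then have "aff_refl (\<gamma>, m) = refl_product aff_refl (is @ [i] @ rev is)"
    by (simp add: fun_eq_iff refl_product_append refl_product_Cons refl_product_Nil)
  then show ?thesis
    unfolding simple_words_def using i by (auto intro!: exI[of _ "is @ [i] @ rev is"])
qed

lemma W_simple_words: "w \<in> W \<Longrightarrow> w \<in> simple_words"
proof -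
  assume "w \<in> W"
  then have "w \<in> refl_group coroot \<Delta>" by (simp add: simple_group_eq)
  then obtain as where "set as \<subseteq> \<Delta>" "w = refl_word coroot as"
    unfolding refl_group_def by auto
  with finite_word'[of as] finite_simple_affine_subset show ?thesis
    unfolding simple_words_def by (metis (mono_tags, lifting) mem_Collect_eq order_trans)
qed

lemma translation_simple_words: "t \<in> Q \<Longrightarrow> (\<lambda>v. v + t) \<in> simple_words"
proof (induction rule: lattice_induct)
  case zero
  then show ?case using id_in_simple_words by (simp add: id_def)
next
  have words: "aff_refl (\<alpha>, m) \<in> simple_words" if "\<alpha> \<in> \<Delta>" "m = 0 \<or> m = 1" for \<alpha> m
  proof -
    have "0 < pairing \<alpha> center"
      using center_interior that by (simp add: interior_alcove_def)
    then show ?thesis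
      using that by (intro positive_aff_refl_in_simple_words) (auto simp: aff_fun_def)
  qed
  \<comment> \<open>Reflections in two neighbouring parallel hyperplanes compose to a translation by
    the coroot. The affine root (\<alpha>, 1) is in general not simple, which is why words for all
    positive affine roots were prepared.\<close>
  have translation: "aff_refl (\<alpha>, 0) \<circ> aff_refl (\<alpha>, 1) = (\<lambda>v. v + coroot \<alpha>)"
    "aff_refl (\<alpha>, 1) \<circ> aff_refl (\<alpha>, 0) = (\<lambda>v. v - coroot \<alpha>)" if "\<alpha> \<in> \<Delta>" for \<alpha>
    using pairing_root_coroot[OF simple_is_root[OF that]]
    by (simp_all add: fun_eq_iff aff_refl_def aff_fun_def vec_eq_iff algebra_simps)
  {
    case (add u \<alpha>)
    have "(\<lambda>v. v + (u + coroot \<alpha>)) = (\<lambda>v. v + coroot \<alpha>) \<circ> (\<lambda>v. v + u)"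
      by (auto simp: algebra_simps)
    also have "\<dots> \<in> simple_words"
      unfolding translation(1)[OF add(2), symmetric]
      by (intro simple_words_comp words add) auto
    finally show ?case .
  next
    case (diff u \<alpha>)
    have "(\<lambda>v. v + (u - coroot \<alpha>)) = (\<lambda>v. v - coroot \<alpha>) \<circ> (\<lambda>v. v + u)"
      by (auto simp: algebra_simps)
    also have "\<dots> \<in> simple_words"
      unfolding translation(2)[OF diff(2), symmetric]
      by (intro simple_words_comp words diff) auto
    finally show ?case .
  }
qed

lemma affine_weyl_simple_words: "affine_weyl \<subseteq> simple_words"
proof
  fix \<omega> assume "\<omega> \<in> affine_weyl"
  then obtain w t where *: "w \<in> W" "t \<in> Q" "\<omega> = (\<lambda>v. w v + t)"
    by (rule affine_weylE)
  have "(\<lambda>v. v + t) \<circ> w \<in> simple_words"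
    using * by (intro simple_words_comp translation_simple_words W_simple_words)
  then show "\<omega> \<in> simple_words"
    using * by (simp add: comp_def)
qed

text \<open>With \<open>x\<close> as base point, a word moving \<open>x\<close> to an interior point
  keeps all simple affine roots positive.\<close>

lemma affine_weyl_free:
  assumes "\<omega> \<in> affine_weyl" "x \<in> interior_alcove" "\<omega> x \<in> interior_alcove"
  shows "\<omega> = id"
proof -
  interpret reflection_system simple_affine aff_refl aff_fun affine_roots x
    by (intro reflection_system_alcove assms)
  obtain "is" where "set is \<subseteq> simple_affine" "\<omega> = refl_product aff_refl is"
    using assms(1) affine_weyl_simple_words unfolding simple_words_def by auto
  with assms(3) show ?thesis
    using word_preserving_positivity_is_id interior_alcove_simple_affine by simp
qed

text \<open>Finitely many rationals become integers after one scaling; this supplies the integral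
  measure for the distance descent and lattice multiples of rational vectors.\<close>

lemma common_denominator:
  assumes "finite A"
  shows "\<exists>N::nat. N > 0 \<and> (\<forall>a\<in>A. of_nat N * (a :: rat) \<in> \<int>)"
  using assms
proof induction
  case (insert a A)
  then obtain N :: nat where N: "N > 0" "\<forall>a\<in>A. of_nat N * a \<in> \<int>" by auto
  obtain k d :: int where d: "d > 0" "a = of_int k / of_int d"
    by (metis Fract_of_int_quotient quotient_of_denom_pos quotient_of_div surj_pair)
  have "of_nat (N * nat d) * a = of_int (int N * k)"
    using d by simp
  then have "of_nat (N * nat d) * a \<in> \<int>" by (metis Ints_of_int)
  moreover have "of_nat (N * nat d) * b \<in> \<int>" if "b \<in> A" for b
  proof -
    have "of_nat (N * nat d) * b = of_int d * (of_nat N * b)"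
      using d by simp
    also have "\<dots> \<in> \<int>" by (rule Ints_mult) (use N that in auto)
    finally show ?thesis .
  qed
  ultimately show ?case
    using N d by (intro exI[of _ "N * nat d"]) (simp del: of_nat_mult)
qed (auto intro: exI[of _ 1])

lemma form_minus_coroot:
  assumes "\<gamma> \<in> \<Phi>"
  shows "form (u - a *s coroot \<gamma>) (u - a *s coroot \<gamma>) =
    form u u + a * form (coroot \<gamma>) (coroot \<gamma>) * (a - pairing \<gamma> u)"
proof -
  have "form (coroot \<gamma>) u = form (coroot \<gamma>) (coroot \<gamma>) / 2 * pairing \<gamma> u"
    by (rule form_coroot[OF assms])
  moreover from this have "form u (coroot \<gamma>) = form (coroot \<gamma>) (coroot \<gamma>) / 2 * pairing \<gamma> u"
    using form_commute by metis
  ultimately show ?thesis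
    by (simp only: form_diff_left form_diff_right form_scale_left form_scale_right)
      (simp add: field_simps)
qed

text \<open>Among the points of an orbit the one closest to \<open>center\<close> lies in the alcove, since reflecting
  in a wall separating it from \<open>center\<close> would bring it closer.\<close>

lemma affine_weyl_transitive_aux:
  assumes "N > 0" "\<And>\<beta>. \<beta> \<in> \<Phi> \<Longrightarrow> of_nat N * pairing \<beta> center \<in> \<int>"
    and "\<And>\<beta>. \<beta> \<in> \<Phi> \<Longrightarrow> of_nat N * pairing \<beta> (y - center) \<in> \<int>"
  shows "\<exists>\<omega>\<in>affine_weyl. \<omega> y \<in> alcove \<Delta> \<alpha>\<^sub>0"
  using assms(3)
proof (induction "nat \<lfloor>(of_nat N)\<^sup>2 * form (y - center) (y - center)\<rfloor>" arbitrary: y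
    rule: less_induct)
  case less
  let ?D = "\<lambda>y. (of_nat N)\<^sup>2 * form (y - center) (y - center)"
  show ?case
  proof (cases "y \<in> alcove \<Delta> \<alpha>\<^sub>0")
    case True
    have "id \<in> affine_weyl"
      by (rule affine_weylI[OF id_in_refl_group lattice_zero]) simp
    then show ?thesis by (rule bexI[rotated]) (simp add: True)
  next
    case False
    then obtain i where i: "i \<in> simple_affine" "aff_fun i y < 0"
      by (auto simp: alcove_simple_affine not_le)
    have i\<Phi>: "fst i \<in> \<Phi>" "snd i \<in> \<int>" using i simple_affine_subset by auto
    define y' where "y' = aff_refl i y"
    define a where "a = aff_fun i y"
    let ?\<beta> = "coroot (fst i)"
    have y': "y' - center = (y - center) - a *s ?\<beta>"
      by (simp add: y'_def aff_refl_def a_def)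
    have "of_nat N * a = of_nat N * pairing (fst i) (y - center) +
        of_nat N * pairing (fst i) center + of_nat N * snd i"
      by (simp add: a_def aff_fun_def algebra_simps)
    then have "of_nat N * a \<in> \<int>"
      using less.prems assms(2) i\<Phi> by auto
    then have int': "of_nat N * pairing \<beta> (y' - center) \<in> \<int>" if "\<beta> \<in> \<Phi>" for \<beta>
    proof -
      have "of_nat N * pairing \<beta> (y' - center) =
          of_nat N * pairing \<beta> (y - center) - (of_nat N * a) * pairing \<beta> ?\<beta>"
        by (simp add: y' algebra_simps)
      also have "\<dots> \<in> \<int>"
        using less.prems[OF that] \<open>of_nat N * a \<in> \<int>\<close> pairing_root_coroot_Ints[OF that i\<Phi>(1)]
        by (metis Ints_diff Ints_mult)
      finally show ?thesis .
    qed
    have D_int: "?D y \<in> \<int>" if "\<And>\<beta>. \<beta> \<in> \<Phi> \<Longrightarrow> of_nat N * pairing \<beta> (y - center) \<in> \<int>" for y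
    proof -
      have "?D y = (\<Sum>\<beta>\<in>\<Phi>. (of_nat N * pairing \<beta> (y - center)) * (of_nat N * pairing \<beta> (y - center)))"
        by (simp add: form_def sum_distrib_left power2_eq_square mult_ac)
      also have "\<dots> \<in> \<int>" by (intro Ints_sum, rule Ints_mult) (use that in auto)
      finally show ?thesis .
    qed
    \<comment> \<open>The change of the squared distance is the value of the wall at
      \<open>y\<close>, times the squared length of the coroot, times the value of the wall at
      \<open>center\<close>. It is negative because the wall separates the two points.\<close>
    have "form (y' - center) (y' - center) = form (y - center) (y - center) +
        a * form ?\<beta> ?\<beta> * (a - pairing (fst i) (y - center))"
      unfolding y' by (rule form_minus_coroot[OF i\<Phi>(1)])
    moreover have "a - pairing (fst i) (y - center) = 1 / coxeter_number"
      using aff_fun_center[OF i(1)] by (simp add: a_def aff_fun_def)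
    moreover have "a * form ?\<beta> ?\<beta> * (1 / coxeter_number) < 0"
      using i(2) form_coroot_pos[OF i\<Phi>(1)] coxeter_number_pos
      by (simp add: a_def mult_neg_pos divide_neg_pos)
    ultimately have "form (y' - center) (y' - center) < form (y - center) (y - center)"
      by simp
    then have "?D y' < ?D y" using assms(1) by simp
    moreover have "0 \<le> ?D y'" using form_self_nonneg by simp
    ultimately have "nat \<lfloor>?D y'\<rfloor> < nat \<lfloor>?D y\<rfloor>"
      using D_int[OF less.prems] D_int[OF int'] by (auto elim!: Ints_cases)
    from less.hyps[OF this int'] obtain \<omega> where "\<omega> \<in> affine_weyl" "\<omega> y' \<in> alcove \<Delta> \<alpha>\<^sub>0" by auto
    moreover have "aff_refl i \<in> affine_weyl"
      using aff_refl_in_affine_weyl[OF i\<Phi>] by simp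
    ultimately show ?thesis
      using affine_weyl_comp[of \<omega> "aff_refl i"] by (intro bexI[of _ "\<omega> \<circ> aff_refl i"]) (auto simp: y'_def)
  qed
qed

lemma affine_weyl_transitive: "\<exists>\<omega>\<in>affine_weyl. \<omega> y \<in> alcove \<Delta> \<alpha>\<^sub>0"
proof -
  let ?A = "(\<lambda>\<beta>. pairing \<beta> center) ` \<Phi> \<union> (\<lambda>\<beta>. pairing \<beta> (y - center)) ` \<Phi>"
  have "finite ?A" using finite_roots by auto
  then obtain N :: nat where "N > 0" "\<forall>a\<in>?A. of_nat N * a \<in> \<int>"
    using common_denominator by blast
  then show ?thesis
    by (intro affine_weyl_transitive_aux[of N]) blast+
qed

end

section \<open>Automorphisms of the alcove\<close>

context based_root_datum
begin

definition dilated :: "rat \<Rightarrow> (rat ^ 'n) set"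
  where "dilated m = {v. (\<forall>\<alpha>\<in>\<Delta>. 0 \<le> pairing \<alpha> v) \<and> pairing \<alpha>\<^sub>0 v \<le> m}"

lemma alcove_eq_dilated: "alcove \<Delta> \<alpha>\<^sub>0 = dilated 1"
  by (simp add: alcove_def dilated_def)

text \<open>No reflection hyperplane cuts the alcove: on it a root stays between two consecutive
  integers, the upper bound being that of the highest root.\<close>

lemma root_alcove_bounds:
  assumes "\<gamma> \<in> \<Phi>"
  shows "(\<forall>v\<in>alcove \<Delta> \<alpha>\<^sub>0. 0 \<le> pairing \<gamma> v \<and> pairing \<gamma> v \<le> 1) \<or>
    (\<forall>v\<in>alcove \<Delta> \<alpha>\<^sub>0. - 1 \<le> pairing \<gamma> v \<and> pairing \<gamma> v \<le> 0)"
proof -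
  have le: "pairing \<gamma> v \<le> 1" if "\<gamma> \<in> \<Phi>" "v \<in> alcove \<Delta> \<alpha>\<^sub>0" for \<gamma> v
    using pairing_root_le_highest[OF that(1), of v] that(2) by (auto simp: alcove_def)
  have ge: "0 \<le> pairing \<gamma> v"
    if "v \<in> alcove \<Delta> \<alpha>\<^sub>0" "\<And>\<alpha>. \<alpha> \<in> \<Delta> \<Longrightarrow> pairing \<gamma> (coweight \<alpha>) \<in> \<nat>" for \<gamma> v
    unfolding pairing_expansion[of \<gamma> v]
    using that Nats_nonneg by (intro sum_nonneg mult_nonneg_nonneg) (auto simp: alcove_def)
  show ?thesis
  proof (rule root_coweight_Nats_cases[OF assms])
    assume "\<And>\<alpha>. \<alpha> \<in> \<Delta> \<Longrightarrow> pairing \<gamma> (coweight \<alpha>) \<in> \<nat>"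
    then show ?thesis using le[OF assms] ge by blast
  next
    assume "\<And>\<alpha>. \<alpha> \<in> \<Delta> \<Longrightarrow> - pairing \<gamma> (coweight \<alpha>) \<in> \<nat>"
    then have "0 \<le> pairing (- \<gamma>) v \<and> pairing (- \<gamma>) v \<le> 1" if "v \<in> alcove \<Delta> \<alpha>\<^sub>0" for v
      using le[OF minus_root[OF assms] that] ge[OF that, of "- \<gamma>"] by simp
    then show ?thesis by simp
  qed
qed

lemma generic_image:
  assumes "w \<in> W" "t \<in> coweight_lattice" "generic x"
  shows "generic (w x + t)"
  unfolding generic_def
proof
  fix \<beta> assume \<beta>: "\<beta> \<in> \<Phi>"
  obtain \<gamma> where \<gamma>: "\<gamma> \<in> \<Phi>" "\<And>v. pairing \<beta> (w v) = pairing \<gamma> v"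
    using W_root[OF assms(1) \<beta>] by blast
  have "pairing \<beta> t \<in> \<int>" using assms(2) \<beta> by (simp add: coweight_lattice_def)
  moreover have "pairing \<gamma> x \<notin> \<int>" using assms(3) \<gamma> by (simp add: generic_def)
  ultimately show "pairing \<beta> (w x + t) \<notin> \<int>"
    using Ints_diff[of "pairing \<gamma> x + pairing \<beta> t" "pairing \<beta> t"] by (auto simp: \<gamma>)
qed

lemma image_stays_above:
  assumes "w \<in> W" "t \<in> coweight_lattice" "x \<in> alcove \<Delta> \<alpha>\<^sub>0" "generic x"
    and "\<beta> \<in> \<Phi>" "k \<in> \<int>" "k \<le> pairing \<beta> (w x + t)" "v \<in> alcove \<Delta> \<alpha>\<^sub>0"
  shows "k \<le> pairing \<beta> (w v + t)"
proof -
  obtain \<gamma> where \<gamma>: "\<gamma> \<in> \<Phi>" "\<And>v. pairing \<beta> (w v) = pairing \<gamma> v"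
    using W_root[OF assms(1,5)] by blast
  obtain j l where j: "pairing \<beta> t = of_int j" and k: "k = of_int l"
    using assms(2,5,6) by (auto simp: coweight_lattice_def elim!: Ints_cases)
  have ne: "pairing \<gamma> x \<noteq> of_int i" for i
    using assms(4) \<gamma> unfolding generic_def by (metis Ints_of_int)
  from root_alcove_bounds[OF \<gamma>(1)] show ?thesis
  proof
    assume b: "\<forall>v\<in>alcove \<Delta> \<alpha>\<^sub>0. 0 \<le> pairing \<gamma> v \<and> pairing \<gamma> v \<le> 1"
    then have "pairing \<gamma> x < 1" using assms(3) ne[of 1] by (auto simp: less_le)
    then have "of_int l < (of_int (j + 1) :: rat)"
      using assms(7) by (simp add: \<gamma> j k)
    then have "l \<le> j" by linarith
    then have "(of_int l :: rat) \<le> of_int j" by simp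
    moreover have "0 \<le> pairing \<gamma> v" using b assms(8) by blast
    ultimately show ?thesis by (simp add: \<gamma> j k)
  next
    assume b: "\<forall>v\<in>alcove \<Delta> \<alpha>\<^sub>0. - 1 \<le> pairing \<gamma> v \<and> pairing \<gamma> v \<le> 0"
    then have "pairing \<gamma> x < 0" using assms(3) ne[of 0] by (auto simp: less_le)
    then have "of_int l < (of_int j :: rat)"
      using assms(7) by (simp add: \<gamma> j k)
    then have "l \<le> j - 1" by linarith
    then have "(of_int l :: rat) \<le> of_int j - 1"
      by (metis of_int_1 of_int_diff of_int_le_iff)
    moreover have "- 1 \<le> pairing \<gamma> v" using b assms(8) by blast
    ultimately show ?thesis by (simp add: \<gamma> j k)
  qed
qed

lemma image_stays_inside:
  assumes "w \<in> W" "t \<in> coweight_lattice" "x \<in> interior_alcove" "m \<in> \<int>"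
    and "w x + t \<in> dilated m" "v \<in> alcove \<Delta> \<alpha>\<^sub>0"
  shows "w v + t \<in> dilated m"
proof -
  have x: "x \<in> alcove \<Delta> \<alpha>\<^sub>0" "generic x" using assms(3) interior_alcove_iff by auto
  note * = image_stays_above[OF assms(1,2) x]
  have "0 \<le> pairing \<alpha> (w v + t)" if "\<alpha> \<in> \<Delta>" for \<alpha>
    using *[of \<alpha> 0 v] that assms(5,6) by (auto simp: dilated_def)
  moreover have "- m \<le> pairing (- \<alpha>\<^sub>0) (w v + t)"
    using *[of "- \<alpha>\<^sub>0" "- m" v] minus_root[OF highest_in_roots] assms(4-6) by (auto simp: dilated_def)
  ultimately show ?thesis by (simp add: dilated_def)
qed

text \<open>An affine automorphism of the alcove fixes \<open>center\<close>: all affine simple roots take the value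
  \<open>1 / coxeter_number\<close> there, which is the smallest positive value possible on its orbit, and a
  positive combination of them is constant.\<close>

lemma center_fixed:
  assumes w: "w \<in> W" and t: "t \<in> coweight_lattice" and "w center + t \<in> alcove \<Delta> \<alpha>\<^sub>0"
  shows "w center + t = center"
proof -
  let ?y = "w center + t" and ?e = "1 / coxeter_number"
  have "?y \<in> interior_alcove"
    using assms generic_image[OF w t interior_alcove_generic[OF center_interior]]
    by (simp add: interior_alcove_iff)
  then have pos: "0 < aff_fun i ?y" if "i \<in> simple_affine" for i
    using that interior_alcove_simple_affine by blast
  have ge: "?e \<le> aff_fun i ?y" if i: "i \<in> simple_affine" for i
  proof -
    have i\<Phi>: "fst i \<in> \<Phi>" "snd i \<in> \<int>" using i simple_affine_subset by auto
    obtain \<gamma> where \<gamma>: "\<gamma> \<in> \<Phi>" "\<And>v. pairing (fst i) (w v) = pairing \<gamma> v"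
      using W_root[OF w i\<Phi>(1)] by blast
    have "aff_fun i ?y = aff_fun (\<gamma>, pairing (fst i) t + snd i) center"
      by (simp add: aff_fun_def \<gamma>)
    moreover have "pairing (fst i) t + snd i \<in> \<int>"
      using i\<Phi> t by (intro Ints_add) (auto simp: coweight_lattice_def)
    ultimately have "coxeter_number * aff_fun i ?y \<in> \<int>"
      using aff_fun_center_Ints[OF \<gamma>(1)] by metis
    moreover have "0 < coxeter_number * aff_fun i ?y"
      using pos[OF i] coxeter_number_pos by simp
    ultimately have "1 \<le> coxeter_number * aff_fun i ?y"
      by (auto elim!: Ints_cases)
    then show ?thesis using coxeter_number_pos by (simp add: field_simps)
  qed
  have ge_simple: "?e \<le> pairing \<alpha> ?y" if "\<alpha> \<in> \<Delta>" for \<alpha>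
    using ge[of "(\<alpha>, 0)"] that by (simp add: aff_fun_def simple_affine_def finite_simple_affine_def)
  have "pairing \<alpha>\<^sub>0 ?y \<le> 1 - ?e"
    using ge[of "(- \<alpha>\<^sub>0, 1)"] by (simp add: aff_fun_def simple_affine_def)
  moreover have "pairing \<alpha>\<^sub>0 center = 1 - ?e"
    using aff_fun_center[of "(- \<alpha>\<^sub>0, 1)"] by (simp add: aff_fun_def simple_affine_def)
  moreover have center: "pairing \<alpha> center = ?e" if "\<alpha> \<in> \<Delta>" for \<alpha>
    using aff_fun_center[of "(\<alpha>, 0)"] that
    by (simp add: aff_fun_def simple_affine_def finite_simple_affine_def)
  ultimately have "(\<Sum>\<alpha>\<in>\<Delta>. pairing \<alpha>\<^sub>0 (coweight \<alpha>) * (pairing \<alpha> ?y - ?e)) \<le> 0"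
    unfolding pairing_expansion[of \<alpha>\<^sub>0 ?y] pairing_expansion[of \<alpha>\<^sub>0 center]
    by (simp add: right_diff_distrib sum_subtractf del: pairing_add_right)
  moreover have nonneg: "0 \<le> pairing \<alpha>\<^sub>0 (coweight \<alpha>) * (pairing \<alpha> ?y - ?e)" if "\<alpha> \<in> \<Delta>" for \<alpha>
    using mark_ge_1[OF that] ge_simple[OF that] by (intro mult_nonneg_nonneg) linarith+
  ultimately have "(\<Sum>\<alpha>\<in>\<Delta>. pairing \<alpha>\<^sub>0 (coweight \<alpha>) * (pairing \<alpha> ?y - ?e)) = 0"
    using sum_nonneg[of \<Delta> "\<lambda>\<alpha>. pairing \<alpha>\<^sub>0 (coweight \<alpha>) * (pairing \<alpha> ?y - ?e)"] by fastforce
  then have "pairing \<alpha>\<^sub>0 (coweight \<alpha>) * (pairing \<alpha> ?y - ?e) = 0" if "\<alpha> \<in> \<Delta>" for \<alpha>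
    using that nonneg finite_simple
      sum_nonneg_eq_0_iff[of \<Delta> "\<lambda>\<alpha>. pairing \<alpha>\<^sub>0 (coweight \<alpha>) * (pairing \<alpha> ?y - ?e)"] by blast
  then have "pairing \<alpha> ?y = ?e" if "\<alpha> \<in> \<Delta>" for \<alpha>
    using that mark_ge_1[OF that] by fastforce
  then show ?thesis by (intro eq_on_simple) (simp only: center)
qed

text \<open>Fixing one interior point already forces the whole alcove into itself, because its image
  lies in a single alcove.\<close>

lemma fixed_generic_imp_center_fixed:
  assumes "w \<in> W" "t \<in> coweight_lattice" "x \<in> interior_alcove" "w x + t = x"
  shows "w center + t = center"
proof (rule center_fixed[OF assms(1,2)])
  have "x \<in> dilated 1" "center \<in> alcove \<Delta> \<alpha>\<^sub>0"
    using assms(3) center_interior by (auto simp: interior_alcove_iff alcove_eq_dilated)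
  then show "w center + t \<in> alcove \<Delta> \<alpha>\<^sub>0"
    using image_stays_inside[OF assms(1-3), of 1 center] assms(4) by (simp add: alcove_eq_dilated)
qed

section \<open>Longest elements\<close>

text \<open>If \<open>w\<close> kept some \<beta> in I positive, composing with the reflection in
  \<beta> would stay in the subgroup and give a longer element. Lengths are taken with respect to
  \<Delta> even for a parabolic subgroup, so the exchange is carried out on words over
  \<Delta>.\<close>

lemma longest_negates:
  assumes I: "I \<subseteq> \<Delta>"
  defines "w \<equiv> longest coroot \<Delta> (refl_group coroot I)"
  shows "w \<in> refl_group coroot I" "\<And>\<beta>. \<beta> \<in> I \<Longrightarrow> pairing \<beta> (w center) < 0"
proof -
  let ?H = "refl_group coroot I" and ?l = "weyl_length coroot \<Delta>"
  have HW: "?H \<subseteq> W" using I simple_subset by (intro refl_group_mono) auto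
  \<comment> \<open>The lengths are bounded, so \<open>ARG_MAX\<close> really denotes an element of
    maximal length.\<close>
  then have "finite (?l ` ?H)" using finite_W finite_subset by blast
  then have "\<forall>y. y \<in> ?H \<longrightarrow> ?l y < Suc (Max (?l ` ?H))"
    by (auto simp: less_Suc_eq_le)
  then have w: "w \<in> ?H" "\<And>y. y \<in> ?H \<Longrightarrow> ?l y \<le> ?l w"
    using arg_max_nat_lemma[of "\<lambda>w. w \<in> ?H" id ?l] id_in_refl_group
    unfolding w_def longest_def by blast+
  then show "w \<in> ?H" by simp
  fix \<beta> assume \<beta>: "\<beta> \<in> I"
  then have \<beta>': "\<beta> \<in> \<Delta>" "\<beta> \<in> \<Phi>" using I by auto
  show "pairing \<beta> (w center) < 0"
  proof (rule ccontr)
    assume "\<not> pairing \<beta> (w center) < 0"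
    moreover obtain \<gamma> where "\<gamma> \<in> \<Phi>" "pairing \<beta> (w center) = pairing \<gamma> center"
      using W_root[of w \<beta>] w HW \<beta>' by blast
    ultimately have pos: "pairing \<beta> (w center) > 0"
      using root_pairing_interior_nonzero[OF _ center_interior] by fastforce
    let ?w' = "root_refl coroot \<beta> \<circ> w"
    have w'H: "?w' \<in> ?H"
      using w \<beta> by (intro refl_group_comp root_refl_in_refl_group)
    then have "?w' \<in> refl_group coroot \<Delta>" using HW simple_group_eq by auto
    then obtain bs where "set bs \<subseteq> \<Delta>" "refl_word coroot bs = ?w'"
      unfolding refl_group_def by auto
    then have "\<exists>as. set as \<subseteq> \<Delta> \<and> length as = ?l ?w' \<and> refl_word coroot as = ?w'"
      unfolding weyl_length_def
      by (intro LeastI[of "\<lambda>k. \<exists>as. set as \<subseteq> \<Delta> \<and> length as = k \<and> refl_word coroot as = ?w'" "length bs"])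
        blast
    then obtain as where as: "set as \<subseteq> \<Delta>" "length as = ?l ?w'" "refl_word coroot as = ?w'"
      by blast
    let ?is = "map (\<lambda>\<alpha>. (\<alpha>, 0)) as"
    have "is": "set ?is \<subseteq> finite_simple_affine" "refl_product aff_refl ?is = ?w'"
      using finite_word'[OF as(1)] as(3) by auto
    interpret reflection_system simple_affine aff_refl aff_fun affine_roots center
      by (intro reflection_system_alcove center_interior)
    have \<beta>s: "(\<beta>, 0) \<in> simple_affine"
      using \<beta>' by (simp add: simple_affine_def finite_simple_affine_def)
    have "aff_fun (\<beta>, 0) (refl_product aff_refl ?is center) = - pairing \<beta> (w center)"
      unfolding "is" using pairing_root_coroot[OF \<beta>'(2)] by (simp add: aff_fun_def root_refl_def)
    with pos obtain js where js: "set js \<subseteq> set ?is" "length js < length ?is"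
      "aff_refl (\<beta>, 0) \<circ> refl_product aff_refl ?is = refl_product aff_refl js"
      using exchange[OF \<beta>s, of ?is] "is"(1) finite_simple_affine_subset by fastforce
    have "aff_refl (\<beta>, 0) \<circ> ?w' = w"
      using root_refl_invol[OF \<beta>'(2)] by (simp add: fun_eq_iff aff_refl_linear)
    then have "refl_product aff_refl js = w" using js(3) "is"(2) by simp
    then have "set (map fst js) \<subseteq> \<Delta> \<and> refl_word coroot (map fst js) = w"
      using finite_word[of js] js(1) "is"(1) by auto
    then have "?l w \<le> length (map fst js)"
      unfolding weyl_length_def by (intro Least_le) blast
    then show False
      using js(2) as(2) w(2)[OF w'H] by simp
  qed
qed

lemma parabolic_fixes_coweight:
  assumes "w \<in> refl_group coroot (\<Delta> - {\<alpha>})" "\<alpha> \<in> \<Delta>"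
  shows "w (coweight \<alpha>) = coweight \<alpha>"
  using assms(1)
proof (induction rule: refl_group_induct)
  case (comp \<beta> w)
  then show ?case using assms(2) by (simp add: root_refl_def pairing_coweight)
qed simp

lemma minus_highest_not_simple: "- \<alpha>\<^sub>0 \<notin> \<Delta>"
  using mark_ge_1[of "- \<alpha>\<^sub>0"] pairing_coweight[of "- \<alpha>\<^sub>0" "- \<alpha>\<^sub>0"] by auto

lemma coweight_in_lattice: "\<alpha> \<in> \<Delta> \<Longrightarrow> coweight \<alpha> \<in> coweight_lattice"
  using root_coweight_Ints by (simp add: coweight_lattice_def)

text \<open>It suffices that \<open>center\<close> is mapped into the interior. The longest element
  makes all positive roots negative with values above -1, the parabolic one restores positivity at
  every simple root except \<alpha>, and the coweight repairs the value at \<alpha>.\<close>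

lemma f_map_fixes_center:
  assumes "\<alpha> \<in> minuscule_roots \<Delta> \<alpha>\<^sub>0"
  shows "z_elt \<Phi> coroot \<Delta> \<alpha> \<in> W" "ext_coweight \<Delta> \<alpha>\<^sub>0 \<alpha> \<in> coweight_lattice"
    "f_map \<Phi> coroot \<Delta> \<alpha>\<^sub>0 \<alpha> center = center"
proof -
  let ?w0 = "longest coroot \<Delta> W" and ?w\<alpha> = "longest coroot \<Delta> (refl_group coroot (\<Delta> - {\<alpha>}))"
  have w0: "?w0 \<in> W" "\<And>\<beta>. \<beta> \<in> \<Delta> \<Longrightarrow> pairing \<beta> (?w0 center) < 0"
    using longest_negates[of \<Delta>] unfolding simple_group_eq by auto
  have w\<alpha>': "?w\<alpha> \<in> refl_group coroot (\<Delta> - {\<alpha>})"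
    "\<And>\<beta>. \<beta> \<in> \<Delta> - {\<alpha>} \<Longrightarrow> pairing \<beta> (?w\<alpha> center) < 0"
    using longest_negates[of "\<Delta> - {\<alpha>}"] by auto
  then have w\<alpha>: "?w\<alpha> \<in> W"
    using refl_group_mono[of "\<Delta> - {\<alpha>}" \<Phi>] by auto
  have z: "z_elt \<Phi> coroot \<Delta> \<alpha> = ?w\<alpha> \<circ> ?w0" by (simp add: z_elt_def)
  then show zW: "z_elt \<Phi> coroot \<Delta> \<alpha> \<in> W" using w\<alpha> w0 by (simp add: refl_group_comp)
  show cw: "ext_coweight \<Delta> \<alpha>\<^sub>0 \<alpha> \<in> coweight_lattice"
    using assms coweight_in_lattice
    by (auto simp: ext_coweight_def minuscule_roots_def ext_simple_roots_def
        coweight_lattice_def[THEN eqset_imp_iff, of 0])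
  define y where "y = ?w0 center"
  have y_bounds: "- 1 < pairing \<gamma> y \<and> pairing \<gamma> y < 1 \<and> pairing \<gamma> y \<noteq> 0" if "\<gamma> \<in> \<Phi>" for \<gamma>
  proof -
    from W_root[OF w0(1) that] obtain \<delta> where \<delta>: "\<delta> \<in> \<Phi>" "pairing \<gamma> y = pairing \<delta> center"
      unfolding y_def by blast
    have "generic center" and c: "center \<in> alcove \<Delta> \<alpha>\<^sub>0"
      using center_interior interior_alcove_iff by auto
    then have ne: "pairing \<delta> center \<noteq> of_int k" for k
      using \<delta> unfolding generic_def by (metis Ints_of_int)
    show ?thesis
      using root_alcove_bounds[OF \<delta>(1)] c ne[of 0] ne[of 1] ne[of "- 1"] unfolding \<delta>
      by (fastforce simp: less_le)
  qed
  have y_pos: "pairing \<gamma> y < 0" if "\<gamma> \<in> \<Phi>" "0 < pairing \<gamma> center" for \<gamma>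
  proof -
    have "pairing \<gamma> y \<le> 0"
      unfolding pairing_expansion[of \<gamma> y]
      using root_sign[OF that(1) center_interior] that(2) w0(2)
      by (intro sum_nonpos mult_nonneg_nonpos) (auto simp: y_def less_imp_le)
    then show ?thesis using y_bounds[OF that(1)] by simp
  qed
  have y_neg: "pairing \<gamma> y > 0" if "\<gamma> \<in> \<Phi>" "pairing \<gamma> center < 0" for \<gamma>
    using y_pos[OF minus_root[OF that(1)]] that(2) by simp
  have pull: "\<exists>\<gamma>\<in>\<Phi>. \<forall>v. pairing \<beta> (?w\<alpha> v) = pairing \<gamma> v" if "\<beta> \<in> \<Phi>" for \<beta>
    using W_root[OF w\<alpha> that] .
  have simple_pos: "0 < pairing \<beta> (?w\<alpha> y)" if "\<beta> \<in> \<Delta> - {\<alpha>}" for \<beta>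
  proof -
    from that have "\<beta> \<in> \<Phi>" by auto
    from pull[OF this] obtain \<gamma> where \<gamma>: "\<gamma> \<in> \<Phi>" "\<And>v. pairing \<beta> (?w\<alpha> v) = pairing \<gamma> v"
      by blast
    have "pairing \<gamma> center < 0" using w\<alpha>'(2)[OF that] \<gamma> by simp
    then show ?thesis using y_neg \<gamma> by simp
  qed
  have bounds: "- 1 < pairing \<beta> (?w\<alpha> y) \<and> pairing \<beta> (?w\<alpha> y) < 1" if "\<beta> \<in> \<Phi>" for \<beta>
    using pull[OF that] y_bounds by fastforce
  have "?w\<alpha> y + ext_coweight \<Delta> \<alpha>\<^sub>0 \<alpha> \<in> interior_alcove"
  proof (cases "\<alpha> = - \<alpha>\<^sub>0")
    case True
    then show ?thesis
      using simple_pos bounds[OF highest_in_roots] minus_highest_not_simple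
      by (auto simp: interior_alcove_def ext_coweight_def)
  next
    case False
    then have \<alpha>: "\<alpha> \<in> \<Delta>" "pairing \<alpha>\<^sub>0 (coweight \<alpha>) = 1"
      using assms pairing_coweight_representation
      by (auto simp: minuscule_roots_def ext_simple_roots_def mark_def)
    obtain \<gamma> where \<gamma>: "\<gamma> \<in> \<Phi>" "\<And>v. pairing \<alpha>\<^sub>0 (?w\<alpha> v) = pairing \<gamma> v"
      using pull[OF highest_in_roots] by blast
    \<comment> \<open>The minuscule condition enters here: the parabolic element fixes the coweight,
      so \<gamma> keeps the coefficient 1 of the highest root at \<alpha>. Hence \<gamma> is
      positive, and adding the coweight leaves the highest root below 1.\<close>
    have "pairing \<gamma> (coweight \<alpha>) = 1"
      using \<gamma>(2)[of "coweight \<alpha>"] parabolic_fixes_coweight[OF w\<alpha>'(1) \<alpha>(1)] \<alpha> by simp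
    have "0 < pairing \<gamma> center"
    proof (rule ccontr)
      assume "\<not> 0 < pairing \<gamma> center"
      then have "0 < pairing (- \<gamma>) center"
        using root_pairing_interior_nonzero[OF \<gamma>(1) center_interior] by simp
      then have "0 \<le> pairing (- \<gamma>) (coweight \<alpha>)"
        using root_sign[OF minus_root[OF \<gamma>(1)] center_interior] \<alpha>(1) by blast
      then show False using \<open>pairing \<gamma> (coweight \<alpha>) = 1\<close> by simp
    qed
    then have "pairing \<alpha>\<^sub>0 (?w\<alpha> y) < 0" using y_pos \<gamma> by simp
    moreover have "- 1 < pairing \<alpha> (?w\<alpha> y)" using bounds \<alpha> by auto
    ultimately show ?thesis
      using simple_pos \<alpha> False
      by (auto simp: interior_alcove_def ext_coweight_def pairing_coweight)
  qed
  then have "z_elt \<Phi> coroot \<Delta> \<alpha> center + ext_coweight \<Delta> \<alpha>\<^sub>0 \<alpha> \<in> alcove \<Delta> \<alpha>\<^sub>0"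
    by (simp add: interior_alcove_iff z y_def)
  then show "f_map \<Phi> coroot \<Delta> \<alpha>\<^sub>0 \<alpha> center = center"
    using center_fixed[OF zW cw] by (simp add: f_map_def)
qed

end

section \<open>Counting the stable alcoves\<close>

text \<open>\<open>z\<close> is the linear part of the automorphism \<open>v \<mapsto> z (v - center) + center\<close> of the alcove. The
  alcoves in the dilated alcove \<open>dilated m\<close> are the images \<open>\<eta> (alcove \<Delta> \<alpha>\<^sub>0)\<close>, and they are
  represented by their centers \<open>\<eta> center\<close>.\<close>

locale alcove_automorphism = based_root_datum \<Phi> coroot \<Delta> \<alpha>\<^sub>0
  for \<Phi> :: "(rat ^ 'n) set" and coroot \<Delta> \<alpha>\<^sub>0 +
  fixes z :: "rat ^ 'n \<Rightarrow> rat ^ 'n"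
  assumes z_in_W: "z \<in> W" and z_center: "center - z center \<in> coweight_lattice"
begin

definition stable :: "nat \<Rightarrow> (rat ^ 'n \<Rightarrow> rat ^ 'n) set"
  where "stable m = {\<eta> \<in> affine_weyl. \<eta> center \<in> dilated (of_nat m) \<and>
    z (\<eta> center - of_nat m *s center) = \<eta> center - of_nat m *s center}"

lemmas z_add = W_add[OF z_in_W] and z_diff = W_diff[OF z_in_W] and z_scale = W_scale[OF z_in_W]

lemma affine_weyl_eq:
  assumes "\<eta> \<in> affine_weyl" "\<theta> \<in> affine_weyl" "x \<in> interior_alcove" "y \<in> interior_alcove"
    and "\<eta> x = \<theta> y"
  shows "\<eta> = \<theta>"
proof -
  have b: "bij \<theta>" "inv \<theta> \<in> affine_weyl" using affine_weyl_bij_inv assms by auto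
  have "(inv \<theta> \<circ> \<eta>) x = y" using assms(5) b by (simp add: bij_is_inj)
  then have "inv \<theta> \<circ> \<eta> = id"
    using affine_weyl_comp[OF b(2) assms(1)] assms by (intro affine_weyl_free[of _ x]) auto
  then have "inv \<theta> (\<eta> v) = v" for v by (metis comp_apply id_apply)
  then have "\<eta> v = \<theta> v" for v using b(1) by (metis bij_inv_eq_iff)
  then show ?thesis by blast
qed

text \<open>The quotient of the two elements, followed by a coroot translation, is an affine Weyl
  element fixing \<open>center\<close>, hence the identity. Thus an automorphism of the alcove can
  be recognized by its class modulo \<open>Q\<close>.\<close>

lemma center_images_congruent_imp_eq:
  assumes "A \<in> W" "B \<in> W" "B center - A center \<in> Q"
  shows "A = B"
proof -
  define h where "h = inv B \<circ> A"
  have iB: "inv B \<in> W" by (rule W_inv[OF assms(2)])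
  have hW: "h \<in> W" unfolding h_def by (rule refl_group_comp[OF iB assms(1)])
  have "inv B (B center - A center) \<in> Q" by (rule W_lattice[OF iB assms(3)])
  then have "center - h center \<in> Q"
    by (simp add: h_def W_diff[OF iB] W_inv_left[OF assms(2)])
  then have "(\<lambda>v. h v + (center - h center)) \<in> affine_weyl"
    by (intro affine_weylI[OF hW]) auto
  then have "(\<lambda>v. h v + (center - h center)) = id"
    using center_interior by (intro affine_weyl_free[of _ center]) auto
  then have *: "h v + (center - h center) = v" for v by (metis id_apply)
  have "center - h center = 0" using *[of 0] by (simp add: W_zero[OF hW])
  then have "h v = v" for v using *[of v] by simp
  then have "A v = B v" for v
    using W_inv_right[OF assms(2), of "A v"] by (simp add: h_def)
  then show ?thesis by blast
qed

lemma funpow_W: "z ^^ k \<in> W"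
  by (induction k) (simp_all only: funpow.simps z_in_W id_in_refl_group refl_group_comp)

text \<open>The translation part of the k-th power of the automorphism is congruent to k times that
  of the automorphism itself, because z acts trivially on coweights modulo \<open>Q\<close>.\<close>

lemma center_funpow:
  "(center - (z ^^ k) center) - of_nat k *s (center - z center) \<in> Q"
proof (induction k)
  case (Suc k)
  let ?c = "center - z center"
  have "(z ^^ k) ?c - ?c \<in> Q" by (rule W_trivial_mod_lattice[OF funpow_W z_center])
  then have "((center - (z ^^ k) center) - of_nat k *s ?c) + ((z ^^ k) ?c - ?c) \<in> Q"
    by (rule lattice_add[OF Suc])
  moreover have "(z ^^ Suc k) center = (z ^^ k) (z center)"
    by (simp only: funpow_Suc_right comp_apply)
  then have "(center - (z ^^ Suc k) center) - of_nat (Suc k) *s ?c =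
      ((center - (z ^^ k) center) - of_nat k *s ?c) + ((z ^^ k) ?c - ?c)"
    by (simp add: W_diff[OF funpow_W] vec_eq_iff algebra_simps)
  ultimately show ?case by metis
qed (simp add: lattice_zero)

text \<open>Stability at level m forces the conjugate of z by \<open>w\<close> to move
  \<open>center\<close> by m times the class of z, up to coroots. The m-th power of z does the same,
  so the two linear parts agree.\<close>

lemma conjugate_eq_power:
  assumes "\<eta> \<in> stable m" "w \<in> W" "t \<in> Q" "\<And>v. \<eta> v = w v + t"
  shows "z (w v) = w ((z ^^ m) v)"
proof -
  define c where "c = center - z center"
  have iw: "inv w \<in> W" by (rule W_inv[OF assms(2)])
  define A where "A = inv w \<circ> z \<circ> w"
  have AW: "A \<in> W" unfolding A_def by (intro refl_group_comp iw z_in_W assms(2))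
  have "z (\<eta> center - of_nat m *s center) = \<eta> center - of_nat m *s center"
    using assms(1) by (simp add: stable_def)
  then have "z (w center) = w center - (z t - t) - of_nat m *s c"
    unfolding assms(4) z_diff z_add z_scale c_def by (simp add: vec_eq_iff algebra_simps)
  then have "A center = center - inv w (z t - t) - of_nat m *s inv w c"
    by (simp add: A_def W_diff[OF iw] W_scale[OF iw] W_inv_left[OF assms(2)])
  moreover have "inv w (z t - t) \<in> Q"
    by (intro W_lattice[OF iw] lattice_diff W_lattice[OF z_in_W] assms(3))
  moreover have "of_nat m *s (inv w c - c) \<in> Q"
    using z_center by (intro lattice_scale W_trivial_mod_lattice[OF iw]) (auto simp: c_def)
  moreover have "(center - (z ^^ m) center) - of_nat m *s c \<in> Q"
    using center_funpow by (simp add: c_def)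
  ultimately have "of_nat m *s (inv w c - c) + inv w (z t - t)
      - ((center - (z ^^ m) center) - of_nat m *s c) \<in> Q"
    using lattice_diff lattice_add by blast
  also have "of_nat m *s (inv w c - c) + inv w (z t - t)
      - ((center - (z ^^ m) center) - of_nat m *s c) = (z ^^ m) center - A center"
    unfolding \<open>A center = _\<close> by (simp add: vec_eq_iff algebra_simps)
  finally have "A = z ^^ m"
    by (rule center_images_congruent_imp_eq[OF AW funpow_W])
  then have "w ((z ^^ m) v) = w (inv w (z (w v)))"
    by (simp add: A_def fun_eq_iff)
  then show ?thesis by (simp add: W_inv_right[OF assms(2)])
qed

lemma z_finite_order: "\<exists>N>0. z ^^ N = id"
proof -
  have "\<not> inj (\<lambda>k. z ^^ k)"
    using finite_W finite_subset[of "range (\<lambda>k. z ^^ k)" W] funpow_W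
      finite_imageD[of "\<lambda>k. z ^^ k" UNIV] by auto
  then obtain i j where "i < j" "z ^^ i = z ^^ j"
    unfolding inj_def by (metis linorder_neqE_nat)
  then have "(z ^^ i) ((z ^^ (j - i)) v) = (z ^^ i) v" for v
    by (metis comp_apply funpow_add le_add_diff_inverse less_imp_le)
  then have "z ^^ (j - i) = id"
    using W_bij[OF funpow_W, of i] by (auto simp: fun_eq_iff bij_def inj_def)
  then show ?thesis using \<open>i < j\<close> by (intro exI[of _ "j - i"]) auto
qed

text \<open>Since \<open>z\<close> and \<open>z ^^ m\<close> are conjugate they have the same order, so \<open>m\<close> is prime to it.\<close>

lemma z_eq_power:
  assumes "stable m \<noteq> {}" "m > 0"
  obtains s where "z ^^ (m * s) = z"
proof -
  obtain \<eta> where \<eta>: "\<eta> \<in> stable m" using assms(1) by auto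
  then have "\<eta> \<in> affine_weyl" by (simp add: stable_def)
  then obtain w t where w: "w \<in> W" "t \<in> Q" "\<eta> = (\<lambda>v. w v + t)" by (rule affine_weylE)
  have conj: "z (w v) = w ((z ^^ m) v)" for v
    by (rule conjugate_eq_power[OF \<eta> w(1,2)]) (simp add: w(3))
  have conjk: "(z ^^ k) (w v) = w ((z ^^ (m * k)) v)" for k v
    by (induction k arbitrary: v) (simp_all add: conj funpow_add)
  define N where "N = (LEAST N. 0 < N \<and> z ^^ N = id)"
  have N: "0 < N" "z ^^ N = id"
    using LeastI_ex[of "\<lambda>N. 0 < N \<and> z ^^ N = id"] z_finite_order unfolding N_def by auto
  have least: "N \<le> k" if "0 < k" "z ^^ k = id" for k
    unfolding N_def using that by (intro Least_le) auto
  define D where "D = gcd m N"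
  have D: "D dvd N" "D dvd m" "0 < D" using N by (auto simp: D_def)
  \<comment> \<open>Since \<open>w\<close> conjugates z to its m-th power, the power of z with
    exponent N / D is trivial; minimality of \<open>N\<close> then leaves only D = 1.\<close>
  have "m * (N div D) = N * (m div D)"
    using D by (metis div_mult_swap mult.commute)
  then have "z ^^ (m * (N div D)) = (z ^^ N) ^^ (m div D)"
    by (simp add: funpow_mult mult.commute)
  then have "z ^^ (m * (N div D)) = id" by (simp add: N(2))
  then have "(z ^^ (N div D)) (w v) = w v" for v using conjk by simp
  then have "(z ^^ (N div D)) v = v" for v
    using W_inv_right[OF w(1), of v] by metis
  then have "z ^^ (N div D) = id" by auto
  moreover have "0 < N div D" using D N by (simp add: dvd_imp_le div_greater_zero_iff)
  ultimately have "N \<le> N div D" using least by blast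
  then have "D = 1"
    using N D by (metis div_less_dividend leD less_one nat_neq_iff)
  then obtain s y where "m * s = N * y + 1"
    using bezout_nat[of m N] assms(2) by (auto simp: D_def)
  then have "z ^^ (m * s) = z \<circ> (z ^^ N) ^^ y"
    by (simp add: funpow_mult)
  then have "z ^^ (m * s) = z" by (simp add: N(2))
  then show ?thesis by (rule that)
qed

lemma funpow_fixed: "f u = u \<Longrightarrow> (f ^^ k) u = u"
  by (induction k) auto

text \<open>Since z is itself a power of its m-th power, the two fix the same vectors. This is
  needed to recover the inner factor of a stable alcove of composite level.\<close>

lemma fixed_by_power:
  assumes "stable m \<noteq> {}" "m > 0" "(z ^^ m) u = u"
  shows "z u = u"
proof -
  obtain s where s: "z ^^ (m * s) = z" using z_eq_power[OF assms(1,2)] .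
  have "z u = ((z ^^ m) ^^ s) u" by (simp add: funpow_mult s)
  then show ?thesis using funpow_fixed[of "z ^^ m"] assms(3) by metis
qed

text \<open>Pulled back to the alcove, the automorphism is an extended affine map that fixes the
  interior point \<open>x\<close>, and therefore fixes \<open>center\<close>.\<close>

lemma fixed_transfer:
  assumes w: "w \<in> W" and t: "t \<in> coweight_lattice" and x: "x \<in> interior_alcove"
    and fixed: "z (w x + t - of_nat m *s center) = w x + t - of_nat m *s center"
  shows "z (w center + t - of_nat m *s center) = w center + t - of_nat m *s center"
proof -
  define c where "c = center - z center"
  have iw: "inv w \<in> W" by (rule W_inv[OF w])
  define A where "A = inv w \<circ> z \<circ> w"
  have AW: "A \<in> W" unfolding A_def by (intro refl_group_comp iw z_in_W w)
  define \<tau> where "\<tau> = inv w (z t + of_nat m *s c - t)"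
  have \<tau>: "\<tau> \<in> coweight_lattice" unfolding \<tau>_def c_def
    by (intro W_coweight_lattice[OF iw] coweight_lattice_add coweight_lattice_diff
        coweight_lattice_scale z_center t W_coweight_lattice[OF z_in_W]) auto
  have eq: "z (w v + t - of_nat m *s center) = w v + t - of_nat m *s center \<longleftrightarrow> A v + \<tau> = v" for v
  proof -
    have "A v + \<tau> = inv w (z (w v) + z t + of_nat m *s c - t)"
      by (simp add: A_def \<tau>_def W_add[OF iw] W_diff[OF iw])
    then have "A v + \<tau> = v \<longleftrightarrow> z (w v) + z t + of_nat m *s c - t = w v"
      by (metis W_inv_left[OF w] W_inv_right[OF w])
    then show ?thesis
      unfolding z_diff z_add z_scale c_def by (auto simp: vec_eq_iff algebra_simps)
  qed
  have "A x + \<tau> = x" using fixed eq by blast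
  then have "A center + \<tau> = center" by (rule fixed_generic_imp_center_fixed[OF AW \<tau> x])
  then show ?thesis using eq by blast
qed

text \<open>A generic fixed point lies in exactly the kind of alcove that is counted. It produces
  stable alcoves from points, both for the factorization and for nonemptiness.\<close>

lemma stable_cover:
  assumes "y \<in> dilated (of_nat m)" "generic y"
    and "z (y - of_nat m *s center) = y - of_nat m *s center"
  shows "\<exists>\<eta>\<in>stable m. \<exists>x\<in>interior_alcove. \<eta> x = y"
proof -
  obtain \<omega> where \<omega>: "\<omega> \<in> affine_weyl" "\<omega> y \<in> alcove \<Delta> \<alpha>\<^sub>0"
    using affine_weyl_transitive by blast
  then have b: "bij \<omega>" "inv \<omega> \<in> affine_weyl" using affine_weyl_bij_inv by auto
  obtain w' t' where "w' \<in> W" "t' \<in> Q" "\<omega> = (\<lambda>v. w' v + t')"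
    using \<omega>(1) by (rule affine_weylE)
  then have "generic (\<omega> y)"
    using generic_image assms(2) lattice_subset_coweight_lattice by auto
  then have x: "\<omega> y \<in> interior_alcove" using \<omega>(2) by (simp add: interior_alcove_iff)
  obtain w t where w: "w \<in> W" "t \<in> Q" "inv \<omega> = (\<lambda>v. w v + t)"
    using b(2) by (rule affine_weylE)
  have t: "t \<in> coweight_lattice" using w lattice_subset_coweight_lattice by auto
  have y: "w (\<omega> y) + t = y"
    using fun_cong[OF w(3), of "\<omega> y"] b(1) by (simp add: bij_is_inj)
  have "center \<in> alcove \<Delta> \<alpha>\<^sub>0" using center_interior interior_alcove_iff by auto
  then have "inv \<omega> center \<in> dilated (of_nat m)"
    using image_stays_inside[OF w(1) t x] assms(1) y by (simp add: w(3))
  moreover have "z (inv \<omega> center - of_nat m *s center) = inv \<omega> center - of_nat m *s center"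
    using fixed_transfer[OF w(1) t x, of m] assms(3) y by (simp add: w(3))
  ultimately have "inv \<omega> \<in> stable m" using b(2) by (simp add: stable_def)
  moreover have "inv \<omega> (\<omega> y) = y" using b(1) by (simp add: bij_is_inj)
  ultimately show ?thesis using x by blast
qed

section \<open>Composing stable alcoves of different levels\<close>

definition dilate :: "nat \<Rightarrow> (rat ^ 'n \<Rightarrow> rat ^ 'n) \<Rightarrow> rat ^ 'n \<Rightarrow> rat ^ 'n"
  where "dilate r \<eta> v = of_nat r *s \<eta> ((1 / of_nat r) *s v)"

lemma dilate_affine:
  assumes "r > 0" "w \<in> W"
  shows "dilate r (\<lambda>v. w v + t) v = w v + of_nat r *s t"
  using assms(1) by (simp add: dilate_def W_scale[OF assms(2)] vec_eq_iff algebra_simps)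

lemma dilate_in_affine_weyl:
  assumes "r > 0" "\<eta> \<in> affine_weyl"
  shows "dilate r \<eta> \<in> affine_weyl"
proof -
  obtain w t where w: "w \<in> W" "t \<in> Q" "\<eta> = (\<lambda>v. w v + t)" using assms(2) by (rule affine_weylE)
  show ?thesis
    using w by (intro affine_weylI[OF w(1) lattice_scale[of "of_nat r"]])
      (auto simp: dilate_affine[OF assms(1) w(1)])
qed

lemma dilated_scale:
  assumes "r > 0" "0 < m"
  shows "(1 / of_nat r) *s v \<in> dilated (of_nat m) \<longleftrightarrow> v \<in> dilated (of_nat (m * r))"
  using assms by (auto simp: dilated_def field_simps zero_le_mult_iff)

lemma generic_scale:
  assumes "r > 0" "generic v"
  shows "generic ((1 / of_nat r) *s v)"
  unfolding generic_def
proof (intro ballI notI)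
  fix \<beta> assume "\<beta> \<in> \<Phi>" "pairing \<beta> ((1 / of_nat r) *s v) \<in> \<int>"
  then have "of_nat r * pairing \<beta> ((1 / of_nat r) *s v) \<in> \<int>" by (intro Ints_mult) auto
  then show False using assms \<open>\<beta> \<in> \<Phi>\<close> by (simp add: generic_def)
qed

lemma affine_weyl_generic: "\<eta> \<in> affine_weyl \<Longrightarrow> generic x \<Longrightarrow> generic (\<eta> x)"
  by (elim affine_weylE) (use generic_image lattice_subset_coweight_lattice in auto)

lemma stable_scaled_interior:
  assumes "r > 0" "\<theta> \<in> stable r"
  shows "(1 / of_nat r) *s \<theta> center \<in> interior_alcove"
proof -
  have "\<theta> center \<in> dilated (of_nat (1 * r))" "\<theta> \<in> affine_weyl"
    using assms by (auto simp: stable_def)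
  moreover from this have "generic (\<theta> center)"
    using affine_weyl_generic interior_alcove_generic[OF center_interior] by blast
  ultimately show ?thesis
    using dilated_scale[OF assms(1), of 1] generic_scale[OF assms(1)]
    by (simp add: interior_alcove_iff alcove_eq_dilated)
qed

text \<open>The alcove of \<theta> inside the r-fold alcove is carried into the r-fold copy of the
  alcove of \<eta>. Its displacement splits as \<open>w u\<close> plus a multiple of the
  displacement of \<eta>; z fixes \<open>w u\<close> because it acts there as \<open>w\<close>
  applied to the q-th power of z on \<open>u\<close>.\<close>

lemma stable_mult_in:
  assumes "q > 0" "r > 0" "\<eta> \<in> stable q" "\<theta> \<in> stable r"
  shows "dilate r \<eta> \<circ> \<theta> \<in> stable (q * r)"
proof -
  have aff: "\<eta> \<in> affine_weyl" "\<theta> \<in> affine_weyl" using assms by (auto simp: stable_def)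
  obtain w t where w: "w \<in> W" "t \<in> Q" "\<eta> = (\<lambda>v. w v + t)" using aff(1) by (rule affine_weylE)
  have t: "t \<in> coweight_lattice" using w lattice_subset_coweight_lattice by auto
  define y where "y = dilate r \<eta> (\<theta> center)"
  have y: "y = w (\<theta> center) + of_nat r *s t"
    by (simp add: y_def w(3) dilate_affine[OF assms(2) w(1)])
  have "w center + t \<in> dilated (of_nat q)" using assms(3) by (simp add: stable_def w(3))
  then have "w ((1 / of_nat r) *s \<theta> center) + t \<in> dilated (of_nat q)"
    using image_stays_inside[OF w(1) t center_interior, of "of_nat q"]
      stable_scaled_interior[OF assms(2,4)] interior_alcove_iff by auto
  moreover have "w ((1 / of_nat r) *s \<theta> center) + t = (1 / of_nat r) *s y"
    using assms(2) by (simp add: y W_scale[OF w(1)] vec_eq_iff field_simps)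
  ultimately have "y \<in> dilated (of_nat (q * r))" using dilated_scale assms by metis
  moreover have "z (y - of_nat (q * r) *s center) = y - of_nat (q * r) *s center"
  proof -
    define u where "u = \<theta> center - of_nat r *s center"
    define u' where "u' = \<eta> center - of_nat q *s center"
    have u: "z u = u" "z u' = u'" using assms by (auto simp: stable_def u_def u'_def)
    have "y - of_nat (q * r) *s center = w u + of_nat r *s u'"
      by (simp add: y u_def u'_def w(3) W_diff[OF w(1)] W_scale[OF w(1)] vec_eq_iff algebra_simps)
    moreover have "z (w u) = w u"
      using conjugate_eq_power[OF assms(3) w(1,2), of u] w(3) funpow_fixed[of z u q] u by simp
    ultimately show ?thesis by (simp add: z_add z_scale u)
  qed
  ultimately show ?thesis
    using affine_weyl_comp[OF dilate_in_affine_weyl[OF assms(2) aff(1)] aff(2)]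
    by (simp add: stable_def y_def)
qed

text \<open>Scaling the composite center by 1/r lands in the interior of the image under \<eta>, and
  distinct elements have disjoint images of the interior. So \<eta> can be read off, and then
  \<theta>.\<close>

lemma stable_mult_inj:
  assumes "r > 0"
  shows "inj_on (\<lambda>(\<eta>, \<theta>). dilate r \<eta> \<circ> \<theta>) (stable q \<times> stable r)"
proof (rule inj_onI, clarify)
  fix \<eta> \<theta> \<eta>' \<theta>'
  assume st: "\<eta> \<in> stable q" "\<theta> \<in> stable r" "\<eta>' \<in> stable q" "\<theta>' \<in> stable r"
    and eq: "dilate r \<eta> \<circ> \<theta> = dilate r \<eta>' \<circ> \<theta>'"
  have aff: "\<eta> \<in> affine_weyl" "\<eta>' \<in> affine_weyl" using st by (auto simp: stable_def)
  have "\<eta> ((1 / of_nat r) *s \<theta> center) = \<eta>' ((1 / of_nat r) *s \<theta>' center)"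
    using fun_cong[OF eq, of center] assms by (simp add: dilate_def vec_eq_iff)
  then have "\<eta> = \<eta>'"
    using aff st stable_scaled_interior[OF assms] by (intro affine_weyl_eq)
  moreover have "inj (dilate r \<eta>')"
    using affine_weyl_bij_inv[OF dilate_in_affine_weyl[OF assms aff(2)]] by (simp add: bij_is_inj)
  then have "\<theta> = \<theta>'"
    using eq \<open>\<eta> = \<eta>'\<close> by (metis inj_eq comp_apply ext)
  ultimately show "\<eta> = \<eta>' \<and> \<theta> = \<theta>'" by simp
qed

text \<open>The outer factor is the level-q alcove containing the center scaled by 1/r. For the
  inner factor the computation only shows that the q-th power of z fixes its displacement, and
  coprimality upgrades this to z.\<close>

lemma stable_mult_surj:
  assumes "q > 0" "r > 0" "\<kappa> \<in> stable (q * r)"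
  shows "\<exists>\<eta>\<in>stable q. \<exists>\<theta>\<in>stable r. \<kappa> = dilate r \<eta> \<circ> \<theta>"
proof -
  let ?y = "\<kappa> center"
  let ?y' = "(1 / of_nat r) *s \<kappa> center"
  have \<kappa>: "\<kappa> \<in> affine_weyl" "?y \<in> dilated (of_nat (q * r))"
    "z (?y - of_nat (q * r) *s center) = ?y - of_nat (q * r) *s center"
    using assms(3) by (auto simp: stable_def)
  have "?y' \<in> dilated (of_nat q)" using \<kappa> dilated_scale assms by metis
  moreover have "generic ?y'"
    by (rule generic_scale[OF assms(2)
          affine_weyl_generic[OF \<kappa>(1) interior_alcove_generic[OF center_interior]]])
  moreover have y': "?y' - of_nat q *s center = (1 / of_nat r) *s (?y - of_nat (q * r) *s center)"
    using assms(2) by (simp add: vec_eq_iff field_simps)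
  have "z (?y' - of_nat q *s center) = ?y' - of_nat q *s center"
    unfolding y' by (simp only: z_scale \<kappa>(3))
  ultimately obtain \<eta> x where \<eta>: "\<eta> \<in> stable q" "x \<in> interior_alcove" "\<eta> x = ?y'"
    using stable_cover by blast
  have aff: "\<eta> \<in> affine_weyl" using \<eta> by (simp add: stable_def)
  obtain w t where w: "w \<in> W" "t \<in> Q" "\<eta> = (\<lambda>v. w v + t)" using aff by (rule affine_weylE)
  have d: "bij (dilate r \<eta>)" "inv (dilate r \<eta>) \<in> affine_weyl"
    using affine_weyl_bij_inv[OF dilate_in_affine_weyl[OF assms(2) aff]] by auto
  define \<theta> where "\<theta> = inv (dilate r \<eta>) \<circ> \<kappa>"
  have \<theta>\<kappa>: "dilate r \<eta> (\<theta> v) = \<kappa> v" for v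
    using d(1) by (simp add: \<theta>_def bij_is_surj surj_f_inv_f)
  have \<theta>_aff: "\<theta> \<in> affine_weyl" unfolding \<theta>_def by (rule affine_weyl_comp[OF d(2) \<kappa>(1)])
  have y: "?y = w (\<theta> center) + of_nat r *s t"
    using \<theta>\<kappa>[of center] by (simp add: w(3) dilate_affine[OF assms(2) w(1)])
  have "dilate r \<eta> (of_nat r *s x) = ?y"
    using assms(2) \<eta>(3) by (simp add: dilate_def vec_eq_iff)
  then have "\<theta> center = of_nat r *s x"
    using \<theta>\<kappa>[of center] d(1) by (metis bij_is_inj inj_eq)
  then have "\<theta> center \<in> dilated (of_nat r)"
    using \<eta>(2) assms(2) dilated_scale[of r 1 "of_nat r *s x"]
    by (simp add: interior_alcove_iff alcove_eq_dilated)
  moreover have "z (\<theta> center - of_nat r *s center) = \<theta> center - of_nat r *s center"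
  proof -
    define u where "u = \<theta> center - of_nat r *s center"
    define u' where "u' = \<eta> center - of_nat q *s center"
    have "z u' = u'" using \<eta> by (auto simp: stable_def u'_def)
    have wu: "w u = (?y - of_nat (q * r) *s center) - of_nat r *s u'"
      unfolding y by (simp add: u_def u'_def w(3) W_diff[OF w(1)] W_scale[OF w(1)] vec_eq_iff algebra_simps)
    have "z (w u) = w u"
      unfolding wu by (simp only: z_diff[of _ "of_nat r *s u'"] \<kappa>(3) z_scale \<open>z u' = u'\<close>)
    then have "w ((z ^^ q) u) = w u"
      using conjugate_eq_power[OF \<eta>(1) w(1,2), of u] w(3) by simp
    then have "(z ^^ q) u = u" using W_inv_left[OF w(1)] by metis
    then show ?thesis using fixed_by_power[of q u] \<eta>(1) assms(1) by (auto simp: u_def)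
  qed
  ultimately have "\<theta> \<in> stable r" using \<theta>_aff by (simp add: stable_def)
  moreover have "\<kappa> = dilate r \<eta> \<circ> \<theta>" using \<theta>\<kappa> by (simp add: fun_eq_iff)
  ultimately show ?thesis using \<eta> by blast
qed

lemma card_stable_mult:
  assumes "q > 0" "r > 0"
  shows "card (stable (q * r)) = card (stable q) * card (stable r)"
proof -
  have "bij_betw (\<lambda>(\<eta>, \<theta>). dilate r \<eta> \<circ> \<theta>) (stable q \<times> stable r) (stable (q * r))"
    unfolding bij_betw_def
  proof
    show "(\<lambda>(\<eta>, \<theta>). dilate r \<eta> \<circ> \<theta>) ` (stable q \<times> stable r) = stable (q * r)"
      using stable_mult_in[OF assms] stable_mult_surj[OF assms] by (fastforce simp: image_iff)
  qed (rule stable_mult_inj[OF assms(2)])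
  then show ?thesis by (metis bij_betw_same_card card_cartesian_product)
qed

lemma card_stable_power:
  assumes "q > 0"
  shows "card (stable (q ^ Suc n)) = card (stable q) ^ Suc n"
proof (induction n)
  case (Suc n)
  have "card (stable (q * q ^ Suc n)) = card (stable q) * card (stable (q ^ Suc n))"
    using assms by (intro card_stable_mult) auto
  then show ?case using Suc by simp
qed simp

end

text \<open>Bounds on powers up to a constant factor compare the bases exactly; this removes the
  constants from the lattice point estimates.\<close>

lemma power_growth_le:
  fixes a b C l :: nat
  assumes "\<And>n. n \<ge> l \<Longrightarrow> a ^ n \<le> C * b ^ n"
  shows "a \<le> b"
proof (rule ccontr)
  assume "\<not> a \<le> b"
  then have ab: "b < a" by simp
  show False
  proof (cases "b = 0")
    case True
    then show False using assms[of "Suc l"] ab by simp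
  next
    case False
    then have "1 < real a / real b" using ab by simp
    then obtain k where k: "real C < (real a / real b) ^ k" using real_arch_pow by blast
    also have "\<dots> \<le> (real a / real b) ^ (k + l)"
      using \<open>1 < real a / real b\<close> by (intro power_increasing) auto
    finally have "real C * real b ^ (k + l) < real a ^ (k + l)"
      using False by (simp add: power_divide field_simps)
    moreover have "real (a ^ (k + l)) \<le> real (C * b ^ (k + l))"
      using assms[of "k + l"] by (simp only: of_nat_le_iff)
    ultimately show False by simp
  qed
qed

section \<open>Upper and lower bounds for the number of stable alcoves\<close>

context based_root_datum
begin

text \<open>Each step picks a root that does not vanish on the subspace and passes to its kernel, so
  as many roots as the dimension serve as coordinates.\<close>

lemma separating_roots:
  assumes "vec.subspace S"
  shows "\<exists>B\<subseteq>\<Phi>. card B \<le> vec.dim S \<and> (\<forall>u\<in>S. (\<forall>\<beta>\<in>B. pairing \<beta> u = 0) \<longrightarrow> u = 0)"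
  using assms
proof (induction "vec.dim S" arbitrary: S rule: less_induct)
  case less
  show ?case
  proof (cases "\<exists>u\<in>S. u \<noteq> 0")
    case False
    then show ?thesis by (intro exI[of _ "{}"]) auto
  next
    case True
    then obtain u where u: "u \<in> S" "u \<noteq> 0" by blast
    then obtain \<beta> where \<beta>: "\<beta> \<in> \<Phi>" "pairing \<beta> u \<noteq> 0"
      using pairing_eq_zero_on_roots by blast
    define S' where "S' = {v \<in> S. pairing \<beta> v = 0}"
    have sub: "vec.subspace S'"
      using less.prems unfolding vec.subspace_def S'_def by auto
    have "S' \<subset> S" using u \<beta> unfolding S'_def by auto
    then have "vec.span S' \<subset> vec.span S"
      using sub less.prems by (metis vec.span_eq_iff)
    then have dim: "vec.dim S' < vec.dim S" by (rule vec.dim_psubset)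
    then obtain B where B: "B \<subseteq> \<Phi>" "card B \<le> vec.dim S'"
      "\<forall>u\<in>S'. (\<forall>\<beta>\<in>B. pairing \<beta> u = 0) \<longrightarrow> u = 0"
      using less.hyps[OF dim sub] by blast
    have "finite B" using B(1) finite_roots finite_subset by blast
    then have "card (insert \<beta> B) \<le> vec.dim S"
      using B(2) dim by (simp add: card_insert_if)
    then show ?thesis
      using B \<beta> by (intro exI[of _ "insert \<beta> B"]) (auto simp: S'_def)
  qed
qed

text \<open>The coroots span: for the map \<open>T\<close>, the form of \<open>T v\<close> with
  \<open>v\<close> is a sum of squares with positive weights, so \<open>T\<close> is injective and
  hence onto. Clearing the denominators of the coefficients then reaches \<open>Q\<close>.\<close>

lemma multiple_in_lattice: "\<exists>N::nat. N > 0 \<and> of_nat N *s v \<in> Q"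
proof -
  define T where "T v = (\<Sum>\<gamma>\<in>\<Phi>. pairing \<gamma> v *s coroot \<gamma>)" for v
  have lin: "Vector_Spaces.linear (*s) (*s) T"
    by (rule linear_vecI)
      (simp_all add: T_def vector_sadd_rdistrib sum.distrib vec.scale_sum_right vector_smult_assoc)
  have form_sum: "form (sum f A) v = (\<Sum>i\<in>A. form (f i) v)" for f and A :: "(rat ^ 'n) set" and v
    by (induction A rule: infinite_finite_induct) (auto simp: form_add_left, auto simp: form_def)
  have "v = 0" if "T v = 0" for v
  proof (rule pairing_eq_zero_on_roots)
    fix \<gamma> assume \<gamma>: "\<gamma> \<in> \<Phi>"
    have "0 = form (T v) v" using that by (simp add: form_def)
    also have "\<dots> = (\<Sum>\<gamma>\<in>\<Phi>. form (coroot \<gamma>) (coroot \<gamma>) / 2 * (pairing \<gamma> v)\<^sup>2)"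
      unfolding T_def form_sum
    proof (rule sum.cong[OF refl])
      fix \<gamma> assume "\<gamma> \<in> \<Phi>"
      then show "form (pairing \<gamma> v *s coroot \<gamma>) v = form (coroot \<gamma>) (coroot \<gamma>) / 2 * (pairing \<gamma> v)\<^sup>2"
        unfolding form_scale_left by (subst form_coroot) (auto simp: power2_eq_square)
    qed
    finally have "form (coroot \<gamma>) (coroot \<gamma>) / 2 * (pairing \<gamma> v)\<^sup>2 = 0"
      using \<gamma> finite_roots form_self_nonneg
      by (subst (asm) eq_commute, subst (asm) sum_nonneg_eq_0_iff) auto
    then show "pairing \<gamma> v = 0" using form_coroot_pos[OF \<gamma>] by simp
  qed
  then have "x = y" if "T x = T y" for x y
    using that vec.linear_diff[OF lin, of x y] by (metis eq_iff_diff_eq_0)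
  then have "inj T" by (rule injI)
  then have "surj T" by (rule vec.linear_injective_imp_surjective[OF lin]) simp
  then obtain u where u: "v = T u" by blast
  obtain N :: nat where N: "N > 0" "\<forall>a\<in>(\<lambda>\<gamma>. pairing \<gamma> u) ` \<Phi>. of_nat N * a \<in> \<int>"
    using common_denominator[of "(\<lambda>\<gamma>. pairing \<gamma> u) ` \<Phi>"] finite_roots by auto
  have "of_nat N *s v = (\<Sum>\<gamma>\<in>\<Phi>. (of_nat N * pairing \<gamma> u) *s coroot \<gamma>)"
    unfolding u T_def by (simp add: vec.scale_sum_right vector_smult_assoc)
  also have "\<dots> \<in> Q" using N by (intro lattice_sum lattice_scale coroot_in_lattice) auto
  finally show ?thesis using N by blast
qed

lemma common_multiple_in_lattice:
  assumes "finite B"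
  shows "\<exists>N::nat. N > 0 \<and> (\<forall>b\<in>B. of_nat N *s b \<in> Q)"
  using assms
proof induction
  case (insert b B)
  then obtain N :: nat where N: "N > 0" "\<forall>b\<in>B. of_nat N *s b \<in> Q" by auto
  obtain M :: nat where M: "M > 0" "of_nat M *s b \<in> Q" using multiple_in_lattice by blast
  have "of_nat (N * M) *s b \<in> Q"
    using lattice_scale[of "of_nat N", OF _ M(2)] by (simp add: vector_smult_assoc)
  moreover have "of_nat (N * M) *s c \<in> Q" if "c \<in> B" for c
    using lattice_scale[of "of_nat M" "of_nat N *s c"] N that
    by (simp add: vector_smult_assoc mult.commute)
  ultimately show ?case using N M by (intro exI[of _ "N * M"]) auto
qed (auto intro: exI[of _ 1])

lemma pairing_center: "\<alpha> \<in> \<Delta> \<Longrightarrow> pairing \<alpha> center = 1 / coxeter_number"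
  and pairing_highest_center: "pairing \<alpha>\<^sub>0 center = 1 - 1 / coxeter_number"
  using aff_fun_center[of "(\<alpha>, 0)"] aff_fun_center[of "(- \<alpha>\<^sub>0, 1)"]
  by (auto simp: aff_fun_def simple_affine_def finite_simple_affine_def)

end

context alcove_automorphism
begin

definition fixed_dirs :: "(rat ^ 'n) set"
  where "fixed_dirs = {u. z u = u}"

lemma subspace_fixed_dirs: "vec.subspace fixed_dirs"
  unfolding vec.subspace_def fixed_dirs_def by (auto simp: z_add z_scale W_zero[OF z_in_W])

lemma stable_fixed_dir: "\<eta> \<in> stable m \<Longrightarrow> \<eta> center - of_nat m *s center \<in> fixed_dirs"
  by (simp add: stable_def fixed_dirs_def)

text \<open>Differences of stable centers are fixed directions, so d separating roots determine the
  alcove. Each root value times h is an integer between -mh and mh.\<close>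

lemma card_stable_le:
  assumes "m > 0"
  shows "finite (stable m) \<and>
    card (stable m) \<le> (2 * m * nat \<lfloor>coxeter_number\<rfloor> + 1) ^ vec.dim fixed_dirs"
proof -
  define h where "h = nat \<lfloor>coxeter_number\<rfloor>"
  have h: "coxeter_number = of_nat h"
    using coxeter_number_Ints coxeter_number_pos by (auto simp: h_def elim!: Ints_cases)
  obtain B where B: "B \<subseteq> \<Phi>" "card B \<le> vec.dim fixed_dirs"
    "\<forall>u\<in>fixed_dirs. (\<forall>\<beta>\<in>B. pairing \<beta> u = 0) \<longrightarrow> u = 0"
    using separating_roots[OF subspace_fixed_dirs] by blast
  have finB: "finite B" using B finite_roots finite_subset by blast
  let ?I = "{- int (m * h)..int (m * h)}"
  let ?c = "\<lambda>\<eta> \<beta>. coxeter_number * pairing \<beta> (\<eta> center)"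
  let ?g = "\<lambda>\<eta>. \<lambda>\<beta>\<in>B. \<lfloor>?c \<eta> \<beta>\<rfloor>"
  have int: "?c \<eta> \<beta> \<in> \<int>" if "\<eta> \<in> stable m" "\<beta> \<in> \<Phi>" for \<eta> \<beta>
  proof -
    from that(1) have "\<eta> \<in> affine_weyl" by (simp add: stable_def)
    then obtain w t where w: "w \<in> W" "t \<in> Q" "\<eta> = (\<lambda>v. w v + t)" by (rule affine_weylE)
    from W_root[OF w(1) that(2)] obtain \<gamma> where \<gamma>: "\<gamma> \<in> \<Phi>" "\<And>v. pairing \<beta> (w v) = pairing \<gamma> v"
      by blast
    have "pairing \<beta> t \<in> \<int>"
      using w(2) lattice_subset_coweight_lattice that(2) by (auto simp: coweight_lattice_def)
    moreover have "?c \<eta> \<beta> = coxeter_number * aff_fun (\<gamma>, pairing \<beta> t) center"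
      by (simp add: w(3) \<gamma> aff_fun_def)
    ultimately show ?thesis using aff_fun_center_Ints[OF \<gamma>(1)] by metis
  qed
  have range: "\<lfloor>?c \<eta> \<beta>\<rfloor> \<in> ?I" if \<eta>: "\<eta> \<in> stable m" and \<beta>: "\<beta> \<in> \<Phi>" for \<eta> \<beta>
  proof -
    let ?v = "(1 / of_nat m) *s \<eta> center"
    have "?v \<in> alcove \<Delta> \<alpha>\<^sub>0"
      using stable_scaled_interior[OF assms \<eta>] interior_alcove_iff by blast
    then have "- 1 \<le> pairing \<beta> ?v \<and> pairing \<beta> ?v \<le> 1"
      using root_alcove_bounds[OF \<beta>] by fastforce
    then have "- of_nat m \<le> pairing \<beta> (\<eta> center)" "pairing \<beta> (\<eta> center) \<le> of_nat m"
      using assms by (auto simp: field_simps)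
    then have "of_nat h * - of_nat m \<le> of_nat h * pairing \<beta> (\<eta> center)"
      "of_nat h * pairing \<beta> (\<eta> center) \<le> of_nat h * of_nat m"
      by (intro mult_left_mono; simp)+
    then have "of_int (- int (m * h)) \<le> ?c \<eta> \<beta>" "?c \<eta> \<beta> \<le> of_int (int (m * h))"
      by (simp_all add: h mult.commute)
    then show ?thesis by (simp add: le_floor_iff floor_le_iff)
  qed
  have "?g ` stable m \<subseteq> B \<rightarrow>\<^sub>E ?I" using range B(1) by auto
  moreover have fin: "finite (B \<rightarrow>\<^sub>E ?I)" by (intro finite_PiE finB) auto
  moreover have inj: "inj_on ?g (stable m)"
  proof (rule inj_onI)
    fix \<eta> \<theta> assume st: "\<eta> \<in> stable m" "\<theta> \<in> stable m" and eq: "?g \<eta> = ?g \<theta>"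
    have "pairing \<beta> (\<eta> center - \<theta> center) = 0" if "\<beta> \<in> B" for \<beta>
    proof -
      have "\<lfloor>?c \<eta> \<beta>\<rfloor> = \<lfloor>?c \<theta> \<beta>\<rfloor>" using fun_cong[OF eq, of \<beta>] that by simp
      moreover have "?c \<eta> \<beta> \<in> \<int>" "?c \<theta> \<beta> \<in> \<int>" using int st that B(1) by auto
      ultimately have "?c \<eta> \<beta> = ?c \<theta> \<beta>" by (metis Ints_cases floor_of_int)
      then show ?thesis using coxeter_number_pos by simp
    qed
    moreover have "\<eta> center - \<theta> center \<in> fixed_dirs"
      using vec.subspace_diff[OF subspace_fixed_dirs stable_fixed_dir[OF st(1)] stable_fixed_dir[OF st(2)]]
      by simp
    ultimately have "\<eta> center = \<theta> center" using B(3) by fastforce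
    then show "\<eta> = \<theta>"
      using st center_interior by (intro affine_weyl_eq) (auto simp: stable_def)
  qed
  ultimately have "finite (stable m)" "card (stable m) \<le> card (B \<rightarrow>\<^sub>E ?I)"
    using inj_on_finite card_inj_on_le by blast+
  moreover have "card (B \<rightarrow>\<^sub>E ?I) = (2 * m * h + 1) ^ card B"
  proof -
    have "int m * int h - - (int m * int h) + 1 = int (2 * m * h + 1)" by simp
    then have "card ?I = 2 * m * h + 1"
      unfolding card_atLeastAtMost_int of_nat_mult by (metis nat_int)
    then show ?thesis using finB by (simp add: card_PiE)
  qed
  moreover have "(2 * m * h + 1) ^ card B \<le> (2 * m * h + 1) ^ vec.dim fixed_dirs"
    using B(2) by (intro power_increasing) auto
  ultimately show ?thesis by (simp add: h_def)
qed

lemma translate_stable: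
  assumes "\<eta> \<in> stable m" "t \<in> Q" "t \<in> fixed_dirs" "\<eta> center + t \<in> dilated (of_nat m)"
  shows "(\<lambda>v. \<eta> v + t) \<in> stable m"
proof -
  have "\<eta> \<in> affine_weyl" using assms by (simp add: stable_def)
  then obtain w s where w: "w \<in> W" "s \<in> Q" "\<eta> = (\<lambda>v. w v + s)" by (rule affine_weylE)
  have "(\<lambda>v. \<eta> v + t) \<in> affine_weyl"
    by (rule affine_weylI[OF w(1) lattice_add[OF w(2) assms(2)]]) (simp add: w(3) add.assoc)
  moreover have "z ((\<eta> center - of_nat m *s center) + t) = (\<eta> center - of_nat m *s center) + t"
    using assms(1,3) by (simp only: z_add stable_def fixed_dirs_def mem_Collect_eq)
  then have "z (\<eta> center + t - of_nat m *s center) = \<eta> center + t - of_nat m *s center"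
    by (simp add: algebra_simps)
  ultimately show ?thesis using assms(4) by (simp add: stable_def)
qed

text \<open>One stable alcove is translated by coroot lattice vectors in the fixed directions. The
  translates are placed around \<open>of_nat m *s center\<close>, where every wall of the dilated
  alcove has level m/h, so a box of side proportional to m fits inside.\<close>

lemma card_stable_ge:
  "\<exists>L>0. \<forall>m\<ge>L. stable m \<noteq> {} \<longrightarrow> (m div L) ^ vec.dim fixed_dirs \<le> card (stable m)"
proof -
  obtain B where B: "B \<subseteq> fixed_dirs" "vec.independent B" "fixed_dirs \<subseteq> vec.span B"
    "card B = vec.dim fixed_dirs"
    by (rule vec.basis_exists)
  have finB: "finite B" using B(2) by (rule vec.finiteI_independent)
  obtain N :: nat where N: "N > 0" "\<forall>b\<in>B. of_nat N *s b \<in> Q"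
    using common_multiple_in_lattice[OF finB] by blast
  define d where "d b = of_nat N *s b" for b :: "rat ^ 'n"
  \<comment> \<open>A bound, uniform over all roots, for the effect of a translation whose
    coefficients on the vectors \<open>d b\<close> have absolute value at most 1.\<close>
  define \<kappa> where "\<kappa> = (\<Sum>\<beta>\<in>\<Phi>. \<Sum>b\<in>B. \<bar>pairing \<beta> (d b)\<bar>)"
  obtain L0 :: nat where "\<kappa> * coxeter_number \<le> of_nat L0" using real_arch_simple by blast
  then have L: "\<kappa> * coxeter_number \<le> of_nat (Suc L0)" by simp
  define L where "L = Suc L0"
  have "(m div L) ^ card B \<le> card (stable m)" if m: "m \<ge> L" and ne: "stable m \<noteq> {}" for m
  proof -
    obtain \<eta> where \<eta>: "\<eta> \<in> stable m" using ne by blast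
    define K where "K = m div L"
    define u where "u = of_nat m *s center - \<eta> center"
    have "- u \<in> fixed_dirs" using stable_fixed_dir[OF \<eta>] by (simp add: u_def)
    then have uU: "u \<in> fixed_dirs" using vec.subspace_neg[OF subspace_fixed_dirs] by fastforce
    define a where "a b = vec.representation B u b / of_nat N" for b
    have "(\<Sum>b\<in>B. vec.representation B u b *s b) = u"
      using B uU finB by (intro vec.sum_representation_eq) auto
    then have u: "u = (\<Sum>b\<in>B. a b *s d b)"
      using N(1) by (simp add: a_def d_def vector_smult_assoc)
    \<comment> \<open>Rounding down the coefficients of \<open>u\<close> gives a lattice vector that
      brings the center of \<eta> near the target; \<open>k\<close> then ranges over a cube of side
      \<open>K\<close>. The total coefficient error stays between -1 and K - 1.\<close>
    define t where "t k = (\<Sum>b\<in>B. of_int (\<lfloor>a b\<rfloor> + int (k b)) *s d b)" for k :: "rat ^ 'n \<Rightarrow> nat"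
    have tQ: "t k \<in> Q" for k
      unfolding t_def using N(2) by (intro lattice_sum lattice_scale) (auto simp: d_def)
    have tU: "t k \<in> fixed_dirs" for k
      unfolding t_def d_def using B(1) vec.subspace_scale[OF subspace_fixed_dirs]
      by (intro vec.subspace_sum[OF subspace_fixed_dirs]) blast
    let ?P = "B \<rightarrow>\<^sub>E {..<K}"
    have close: "\<bar>pairing \<beta> (t k - u)\<bar> \<le> of_nat m / coxeter_number" if k: "k \<in> ?P" and \<beta>: "\<beta> \<in> \<Phi>" for k \<beta>
    proof -
      have "t k - u = (\<Sum>b\<in>B. (of_int (\<lfloor>a b\<rfloor> + int (k b)) - a b) *s d b)"
        unfolding t_def u by (simp add: sum_subtractf vec.scale_left_diff_distrib)
      then have "\<bar>pairing \<beta> (t k - u)\<bar> = \<bar>\<Sum>b\<in>B. (of_int (\<lfloor>a b\<rfloor> + int (k b)) - a b) * pairing \<beta> (d b)\<bar>"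
        by (simp only: pairing_sum_right pairing_scale_right)
      also have "\<dots> \<le> (\<Sum>b\<in>B. \<bar>(of_int (\<lfloor>a b\<rfloor> + int (k b)) - a b) * pairing \<beta> (d b)\<bar>)"
        by (rule sum_abs)
      also have "\<dots> \<le> (\<Sum>b\<in>B. of_nat K * \<bar>pairing \<beta> (d b)\<bar>)"
      proof (rule sum_mono)
        fix b assume "b \<in> B"
        then have "k b < K" using k by auto
        then have "(of_nat (k b) :: rat) + 1 \<le> of_nat K"
          by (metis Suc_leI of_nat_Suc of_nat_le_iff add.commute)
        moreover have "of_int \<lfloor>a b\<rfloor> \<le> a b" "a b < of_int \<lfloor>a b\<rfloor> + 1" by linarith+
        moreover have "(0 :: rat) \<le> of_nat (k b)" by simp
        ultimately have "\<bar>of_int (\<lfloor>a b\<rfloor> + int (k b)) - a b\<bar> \<le> of_nat K"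
          unfolding of_int_add of_int_of_nat_eq by linarith
        then show "\<bar>(of_int (\<lfloor>a b\<rfloor> + int (k b)) - a b) * pairing \<beta> (d b)\<bar> \<le> of_nat K * \<bar>pairing \<beta> (d b)\<bar>"
          unfolding abs_mult by (rule mult_right_mono) simp
      qed
      also have "\<dots> = of_nat K * (\<Sum>b\<in>B. \<bar>pairing \<beta> (d b)\<bar>)" by (simp add: sum_distrib_left)
      also have "\<dots> \<le> of_nat K * \<kappa>"
        unfolding \<kappa>_def using \<beta> finite_roots
        by (intro mult_left_mono member_le_sum[of \<beta> \<Phi> "\<lambda>\<beta>. \<Sum>b\<in>B. \<bar>pairing \<beta> (d b)\<bar>"] sum_nonneg) auto
      also have "\<dots> \<le> of_nat m / coxeter_number"
      proof -
        have "of_nat K * (\<kappa> * coxeter_number) \<le> (of_nat K * of_nat L :: rat)"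
          using L by (intro mult_left_mono) (auto simp: L_def)
        also have "\<dots> \<le> of_nat m"
          unfolding K_def of_nat_mult[symmetric] of_nat_le_iff by (rule div_times_less_eq_dividend)
        finally show ?thesis using coxeter_number_pos by (simp add: field_simps)
      qed
      finally show ?thesis .
    qed
    have in_stable: "(\<lambda>v. \<eta> v + t k) \<in> stable m" if k: "k \<in> ?P" for k
    proof (rule translate_stable[OF \<eta> tQ tU])
      have y: "\<eta> center + t k = of_nat m *s center + (t k - u)" by (simp add: u_def)
      have "0 \<le> pairing \<alpha> (\<eta> center + t k)" if "\<alpha> \<in> \<Delta>" for \<alpha>
        using close[OF k simple_is_root[OF that]] pairing_center[OF that]
        unfolding y pairing_add_right pairing_scale_right by (auto simp: abs_le_iff)
      moreover have "pairing \<alpha>\<^sub>0 (\<eta> center + t k) \<le> of_nat m"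
      proof -
        have "pairing \<alpha>\<^sub>0 (t k - u) \<le> of_nat m / coxeter_number"
          using close[OF k highest_in_roots] by linarith
        then show ?thesis
          unfolding y pairing_add_right[of _ "of_nat m *s center"] pairing_scale_right pairing_highest_center
          by (simp only: right_diff_distrib) simp
      qed
      ultimately show "\<eta> center + t k \<in> dilated (of_nat m)" by (simp add: dilated_def)
    qed
    have inj: "inj_on (\<lambda>k. (\<lambda>v. \<eta> v + t k)) ?P"
    proof (rule inj_onI)
      fix k l assume kl: "k \<in> ?P" "l \<in> ?P" and eq: "(\<lambda>v. \<eta> v + t k) = (\<lambda>v. \<eta> v + t l)"
      have "t k - t l = 0" using fun_cong[OF eq, of 0] by simp
      then have "(\<Sum>b\<in>B. (of_nat N * (of_nat (k b) - of_nat (l b))) *s b) = 0"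
        unfolding t_def d_def
        by (simp add: sum_subtractf[symmetric] vector_smult_assoc vec_eq_iff algebra_simps)
      then have zero: "of_nat N * (of_nat (k b) - of_nat (l b)) = (0 :: rat)" if "b \<in> B" for b
        using vec.independentD[OF B(2) finB subset_refl _ that,
            of "\<lambda>b. of_nat N * (of_nat (k b) - of_nat (l b))"] by simp
      have "k b = l b" if "b \<in> B" for b
        using zero[OF that] N(1) by simp
      then show "k = l" using kl by (intro PiE_ext) auto
    qed
    have "card ?P \<le> card (stable m)"
      using in_stable inj card_stable_le[of m] m
      by (intro card_inj_on_le[of "\<lambda>k. (\<lambda>v. \<eta> v + t k)"]) (auto simp: L_def)
    then show ?thesis using finB by (simp add: card_PiE K_def)
  qed
  then show ?thesis using B(4) by (intro exI[of _ L]) (auto simp: L_def)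
qed

text \<open>Both bounds are applied to the powers of \<open>q\<close>, where the count is itself a
  power.\<close>

lemma card_stable:
  assumes "q \<ge> 2" "stable q \<noteq> {}"
  shows "card (stable q) = q ^ vec.dim fixed_dirs"
proof (rule antisym)
  let ?d = "vec.dim fixed_dirs" and ?h = "nat \<lfloor>coxeter_number\<rfloor>"
  have pow: "card (stable (q ^ n)) = card (stable q) ^ n" if "n \<ge> 1" for n
    using card_stable_power[of q "n - 1"] that assms(1) by simp
  show "card (stable q) \<le> q ^ ?d"
  proof (rule power_growth_le[where l = 1 and C = "(2 * ?h + 1) ^ ?d"])
    fix n :: nat assume "n \<ge> 1"
    have "card (stable q) ^ n \<le> (2 * q ^ n * ?h + 1) ^ ?d"
      using card_stable_le[of "q ^ n"] assms(1) pow[OF \<open>n \<ge> 1\<close>] by simp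
    also have "2 * q ^ n * ?h + 1 \<le> (2 * ?h + 1) * q ^ n"
      using assms(1) by (simp add: algebra_simps)
    then have "(2 * q ^ n * ?h + 1) ^ ?d \<le> ((2 * ?h + 1) * q ^ n) ^ ?d"
      by (rule power_mono) simp
    also have "\<dots> = (2 * ?h + 1) ^ ?d * (q ^ ?d) ^ n"
      unfolding power_mult_distrib power_mult[symmetric] by (simp only: mult.commute)
    finally show "card (stable q) ^ n \<le> (2 * ?h + 1) ^ ?d * (q ^ ?d) ^ n" .
  qed
  obtain L where L: "L > 0" "\<And>m. m \<ge> L \<Longrightarrow> stable m \<noteq> {} \<Longrightarrow> (m div L) ^ ?d \<le> card (stable m)"
    using card_stable_ge by blast
  have "card (stable q) > 0"
    using assms card_stable_le[of q] by (simp add: card_gt_0_iff)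
  show "q ^ ?d \<le> card (stable q)"
  \<comment> \<open>From this exponent on \<open>q ^ n\<close> is at least \<open>L\<close>, so the
    quotient by \<open>L\<close> is not zero and rounding down loses at most a factor 2.\<close>
  proof (rule power_growth_le[where l = "Suc L" and C = "(2 * L) ^ ?d"])
    fix n assume n: "Suc L \<le> n"
    define m where "m = q ^ n"
    have "n < 2 ^ n" by (rule less_exp)
    also have "(2::nat) ^ n \<le> m" unfolding m_def using assms(1) by (intro power_mono) auto
    finally have mL: "L \<le> m" using n by simp
    have "card (stable m) = card (stable q) ^ n" unfolding m_def using pow n by simp
    moreover from this have "stable m \<noteq> {}" using \<open>card (stable q) > 0\<close> by force
    ultimately have le: "(m div L) ^ ?d \<le> card (stable q) ^ n" using L(2)[OF mL] by simp
    have "1 \<le> m div L" using mL L(1) by (simp add: div_greater_zero_iff Suc_le_eq)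
    then have "L \<le> L * (m div L)" using L(1) by simp
    moreover have "m = L * (m div L) + m mod L" by simp
    moreover have "m mod L < L" using L(1) by simp
    ultimately have "m \<le> 2 * L * (m div L)" by linarith
    then have "m ^ ?d \<le> (2 * L * (m div L)) ^ ?d" by (intro power_mono) auto
    also have "\<dots> = (2 * L) ^ ?d * (m div L) ^ ?d" by (rule power_mult_distrib)
    also have "\<dots> \<le> (2 * L) ^ ?d * card (stable q) ^ n" using le by (intro mult_left_mono) auto
    finally show "(q ^ ?d) ^ n \<le> (2 * L) ^ ?d * card (stable q) ^ n"
      by (simp add: m_def power_mult[symmetric] mult.commute)
  qed
qed

end

text \<open>Validity for all small positive rationals. Its closure under finite conjunctions allows
  one step size to meet finitely many conditions.\<close>

definition near_zero :: "(rat \<Rightarrow> bool) \<Rightarrow> bool"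
  where "near_zero P \<longleftrightarrow> (\<exists>d>0. \<forall>e. 0 < e \<and> e < d \<longrightarrow> P e)"

lemma near_zero_conj: "near_zero P \<Longrightarrow> near_zero R \<Longrightarrow> near_zero (\<lambda>e. P e \<and> R e)"
  unfolding near_zero_def by (elim exE, rule_tac x = "min d da" in exI) auto

lemma near_zero_ball: "finite A \<Longrightarrow> (\<And>a. a \<in> A \<Longrightarrow> near_zero (P a)) \<Longrightarrow> near_zero (\<lambda>e. \<forall>a\<in>A. P a e)"
proof (induction rule: finite_induct)
  case empty
  then show ?case by (auto simp: near_zero_def intro: exI[of _ 1])
next
  case (insert a A)
  then show ?case using near_zero_conj[of "P a" "\<lambda>e. \<forall>a\<in>A. P a e"] by simp
qed

lemma near_zero_imp_ex: "near_zero P \<Longrightarrow> \<exists>e>0. P e"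
  unfolding near_zero_def by (metis field_lbound_gt_zero)

lemma near_zero_pos:
  assumes "0 < a"
  shows "near_zero (\<lambda>e. 0 < a + e * b)"
proof (cases "0 \<le> b")
  case True
  then show ?thesis
    using assms unfolding near_zero_def by (intro exI[of _ 1]) (auto intro!: add_pos_nonneg)
next
  case False
  then show ?thesis
    using assms unfolding near_zero_def
    by (intro exI[of _ "a / - b"]) (auto simp: field_simps)
qed

text \<open>For positive slope the value moves strictly above \<open>a\<close> and stays below the
  next integer; for negative slope both numbers are negated.\<close>

lemma near_zero_not_Ints:
  assumes "a \<notin> \<int> \<or> b \<noteq> 0"
  shows "near_zero (\<lambda>e. a + e * b \<notin> \<int>)"
proof -
  have pos: "near_zero (\<lambda>e. a + e * b \<notin> \<int>)" if "0 < b" for a b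
    unfolding near_zero_def
  proof (intro exI conjI allI impI notI)
    show "0 < (of_int (\<lfloor>a\<rfloor> + 1) - a) / b" using that by (auto simp: field_simps) linarith
    fix e assume e: "0 < e \<and> e < (of_int (\<lfloor>a\<rfloor> + 1) - a) / b" and "a + e * b \<in> \<int>"
    then obtain k where k: "a + e * b = of_int k" by (auto elim: Ints_cases)
    have "a < of_int k" using e that k by (metis less_add_same_cancel1 mult_pos_pos)
    moreover have "of_int k < (of_int (\<lfloor>a\<rfloor> + 1) :: rat)" using e that k[symmetric] by (simp add: field_simps)
    ultimately have "\<lfloor>a\<rfloor> < k" "k < \<lfloor>a\<rfloor> + 1" by (simp only: floor_less_iff, simp only: of_int_less_iff)
    then show False by simp
  qed
  consider "b = 0" | "0 < b" | "0 < - b" by linarith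
  then show ?thesis
  proof cases
    case 1
    then show ?thesis using assms by (auto simp: near_zero_def intro: exI[of _ 1])
  next
    case 2
    then show ?thesis by (rule pos)
  next
    case 3
    have "(- a) + e * (- b) \<in> \<int> \<longleftrightarrow> a + e * b \<in> \<int>" for e
      using minus_in_Ints_iff[of "a + e * b"] by simp
    then show ?thesis using pos[OF 3, of "- a"] by simp
  qed
qed

section \<open>Points of the fixed space off the hyperplanes, and stability of small alcoves\<close>

context alcove_automorphism
begin

definition fixed_points :: "(rat ^ 'n) set"
  where "fixed_points = {v. z (v - center) = v - center}"

lemma center_in_fixed_points: "center \<in> fixed_points"
  using W_zero[OF z_in_W] by (simp add: fixed_points_def)

lemma affine_dim_fixed_points: "affine_dim fixed_points = vec.dim fixed_dirs"
proof -
  have "{u - v | u v. u \<in> fixed_points \<and> v \<in> fixed_points} = fixed_dirs"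
  proof (intro equalityI subsetI)
    fix x assume "x \<in> {u - v | u v. u \<in> fixed_points \<and> v \<in> fixed_points}"
    then obtain u v where x: "x = u - v" and uv: "u \<in> fixed_points" "v \<in> fixed_points" by blast
    have "x = (u - center) - (v - center)" using x by simp
    then show "x \<in> fixed_dirs"
      using uv z_diff[of "u - center" "v - center"] by (simp add: fixed_points_def fixed_dirs_def)
  next
    fix x assume "x \<in> fixed_dirs"
    then have "center + x \<in> fixed_points" by (simp add: fixed_points_def fixed_dirs_def)
    then show "x \<in> {u - v | u v. u \<in> fixed_points \<and> v \<in> fixed_points}"
      using center_in_fixed_points by (intro CollectI exI[of _ "center + x"] exI[of _ center]) simp
  qed
  then show ?thesis by (simp add: affine_dim_def)
qed

lemma fixed_points_scale:
  assumes "q > 0"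
  shows "z (of_nat q *s v - of_nat q *s center) = of_nat q *s v - of_nat q *s center \<longleftrightarrow>
    v \<in> fixed_points"
proof -
  have "of_nat q *s v - of_nat q *s center = of_nat q *s (v - center)"
    by (simp only: vector_ssub_ldistrib)
  then show ?thesis
    using assms by (simp only: z_scale vector_mul_lcancel fixed_points_def mem_Collect_eq of_nat_eq_0_iff) blast
qed

text \<open>The center of a stable alcove, divided by \<open>q\<close>, is a point of the fixed
  space on no hyperplane of level \<open>q\<close>.\<close>

lemma stable_empty:
  assumes "q > 0" "H \<in> hyperplanes_q \<Phi> q" "fixed_points \<subseteq> H"
  shows "stable q = {}"
proof (rule ccontr)
  assume "stable q \<noteq> {}"
  then obtain \<eta> where \<eta>: "\<eta> \<in> stable q" by blast
  obtain \<beta> k where H: "\<beta> \<in> \<Phi>" "H = {v. pairing \<beta> v = of_int k / of_nat q}"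
    using assms(2) unfolding hyperplanes_q_def by blast
  define y where "y = (1 / of_nat q) *s \<eta> center"
  have y: "of_nat q *s y = \<eta> center" using assms(1) by (simp add: y_def vec_eq_iff)
  then have "y \<in> fixed_points"
    using \<eta> fixed_points_scale[OF assms(1), of y] by (simp add: stable_def)
  then have "pairing \<beta> y = of_int k / of_nat q" using assms(3) H by auto
  then have "pairing \<beta> (\<eta> center) = of_int k"
    using assms(1) by (simp add: y[symmetric])
  moreover have "generic (\<eta> center)"
    using \<eta> affine_weyl_generic interior_alcove_generic[OF center_interior] by (auto simp: stable_def)
  ultimately show False using H(1) unfolding generic_def by (metis Ints_of_int)
qed

text \<open>The roots are treated one at a time. If the current point lies on a hyperplane of the
  new root, some fixed direction leaves that hyperplane, and a small step along it preserves all the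
  conditions already achieved.\<close>

lemma generic_fixed_point:
  assumes "q > 0" "\<And>H. H \<in> hyperplanes_q \<Phi> q \<Longrightarrow> \<not> fixed_points \<subseteq> H" "finite B" "B \<subseteq> \<Phi>"
  shows "\<exists>v\<in>fixed_points. v \<in> interior_alcove \<and> (\<forall>\<beta>\<in>B. of_nat q * pairing \<beta> v \<notin> \<int>)"
  using assms(3,4)
proof (induction B rule: finite_induct)
  case empty
  then show ?case using center_in_fixed_points center_interior by blast
next
  case (insert \<beta> B)
  then obtain v where v: "v \<in> fixed_points" "v \<in> interior_alcove"
    "\<forall>\<beta>\<in>B. of_nat q * pairing \<beta> v \<notin> \<int>" by auto
  show ?case
  proof (cases "of_nat q * pairing \<beta> v \<in> \<int>")
    case False
    with v show ?thesis by blast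
  next
    case True
    then obtain k where k: "of_nat q * pairing \<beta> v = of_int k" by (elim Ints_cases)
    have "\<exists>u\<in>fixed_dirs. pairing \<beta> u \<noteq> 0"
    proof (rule ccontr)
      assume neg: "\<not> ?thesis"
      have "pairing \<beta> x = of_int k / of_nat q" if "x \<in> fixed_points" for x
      proof -
        have "(x - center) - (v - center) \<in> fixed_dirs"
          using that v(1) z_diff[of "x - center" "v - center"] unfolding fixed_points_def fixed_dirs_def
          by simp
        then have "pairing \<beta> x = pairing \<beta> v" using neg by fastforce
        then show ?thesis using k assms(1) by (simp add: field_simps)
      qed
      then have "fixed_points \<subseteq> {x. pairing \<beta> x = of_int k / of_nat q}" by auto
      moreover have "{x. pairing \<beta> x = of_int k / of_nat q} \<in> hyperplanes_q \<Phi> q"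
        using insert.prems unfolding hyperplanes_q_def by auto
      ultimately show False using assms(2) by blast
    qed
    then obtain u where u: "u \<in> fixed_dirs" "pairing \<beta> u \<noteq> 0" by blast
    have "near_zero (\<lambda>e. \<forall>i\<in>simple_affine. 0 < aff_fun i v + e * pairing (fst i) u)"
      using v(2) interior_alcove_simple_affine finite_simple
      by (intro near_zero_ball near_zero_pos) (auto simp: simple_affine_def finite_simple_affine_def)
    moreover have "near_zero (\<lambda>e. \<forall>\<gamma>\<in>insert \<beta> B.
        of_nat q * pairing \<gamma> v + e * (of_nat q * pairing \<gamma> u) \<notin> \<int>)"
      using v(3) u(2) insert.hyps assms(1) by (intro near_zero_ball near_zero_not_Ints) auto
    ultimately obtain e where e: "\<forall>i\<in>simple_affine. 0 < aff_fun i v + e * pairing (fst i) u"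
      "\<forall>\<gamma>\<in>insert \<beta> B. of_nat q * pairing \<gamma> v + e * (of_nat q * pairing \<gamma> u) \<notin> \<int>"
      using near_zero_imp_ex[OF near_zero_conj] by blast
    have "v + e *s u - center = (v - center) + e *s u" by simp
    then have "v + e *s u \<in> fixed_points"
      using v(1) u(1) unfolding fixed_points_def fixed_dirs_def mem_Collect_eq
      by (simp only: z_add z_scale)
    moreover have "v + e *s u \<in> interior_alcove"
      using e(1) by (simp add: interior_alcove_simple_affine aff_fun_def algebra_simps)
    moreover have "\<forall>\<gamma>\<in>insert \<beta> B. of_nat q * pairing \<gamma> (v + e *s u) \<notin> \<int>"
      using e(2) by (simp add: algebra_simps)
    ultimately show ?thesis by blast
  qed
qed

lemma stable_nonempty:
  assumes "q > 0" "\<And>H. H \<in> hyperplanes_q \<Phi> q \<Longrightarrow> \<not> fixed_points \<subseteq> H"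
  shows "stable q \<noteq> {}"
proof -
  obtain v where v: "v \<in> fixed_points" "v \<in> interior_alcove"
    "\<forall>\<beta>\<in>\<Phi>. of_nat q * pairing \<beta> v \<notin> \<int>"
    using generic_fixed_point[OF assms finite_roots subset_refl] by blast
  have "of_nat q *s v \<in> dilated (of_nat q)"
    using dilated_scale[OF assms(1), of 1 "of_nat q *s v"] v(2) assms(1)
    by (simp add: interior_alcove_iff alcove_eq_dilated)
  moreover have "generic (of_nat q *s v)" using v(3) by (simp add: generic_def)
  ultimately show ?thesis
    using stable_cover[of "of_nat q *s v" q] v(1) fixed_points_scale[OF assms(1), of v] by blast
qed

text \<open>The left-hand side says that the automorphism stabilizes the small alcove \<open>\<omega> (alcove / q)\<close>,
  where \<open>\<omega> v = w v + t\<close>.\<close>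

lemma image_stable_iff:
  assumes q: "q > 0" and w: "w \<in> W" and t: "of_nat q *s t \<in> Q"
    and f: "\<And>v. f v = z (v - center) + center"
  defines "A \<equiv> {v. of_nat q *s v \<in> alcove \<Delta> \<alpha>\<^sub>0}"
  shows "f ` (\<lambda>v. w v + t) ` A = (\<lambda>v. w v + t) ` A \<longleftrightarrow> w ((1 / of_nat q) *s center) + t \<in> fixed_points"
proof -
  let ?\<omega> = "\<lambda>v. w v + t"
  let ?c = "(1 / of_nat q) *s center"
  define c where "c = center - z center"
  have iw: "inv w \<in> W" by (rule W_inv[OF w])
  \<comment> \<open>Pulled back along the small alcove map and rescaled by \<open>q\<close>,
    \<open>f\<close> becomes the extended affine map with linear part \<open>B\<close> and
    translation \<tau>. Stability of the small alcove then reads as stability of the alcove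
    itself.\<close>
  define B where "B = inv w \<circ> z \<circ> w"
  have BW: "B \<in> W" unfolding B_def by (intro refl_group_comp iw z_in_W w)
  define \<tau> where "\<tau> = inv w (z (of_nat q *s t) + of_nat q *s c - of_nat q *s t)"
  have tP: "of_nat q *s t \<in> coweight_lattice" using t lattice_subset_coweight_lattice by auto
  have \<tau>: "\<tau> \<in> coweight_lattice" unfolding \<tau>_def c_def
    by (intro W_coweight_lattice[OF iw] coweight_lattice_add coweight_lattice_diff
        coweight_lattice_scale z_center tP W_coweight_lattice[OF z_in_W]) auto
  have conj: "f (?\<omega> v) = ?\<omega> ((1 / of_nat q) *s (B (of_nat q *s v) + \<tau>))" for v
  proof -
    have "w ((1 / of_nat q) *s (B (of_nat q *s v) + \<tau>)) = z (w v) + z t + c - t"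
      using q by (simp add: B_def \<tau>_def W_add[OF w] W_scale[OF w] W_inv_right[OF w] z_scale
          W_diff[OF w] vec_eq_iff algebra_simps)
    then show ?thesis by (simp add: f z_add z_diff c_def)
  qed
  have inj: "w u = w v \<longleftrightarrow> u = v" for u v
    using W_inv_left[OF w] by metis
  have cA: "?c \<in> A"
    using center_interior q by (simp add: A_def interior_alcove_iff)
  have fixed: "?\<omega> ?c \<in> fixed_points \<longleftrightarrow> B center + \<tau> = center"
  proof -
    have "?\<omega> ?c \<in> fixed_points \<longleftrightarrow> f (?\<omega> ?c) = ?\<omega> ?c"
      unfolding fixed_points_def f by (auto simp: algebra_simps)
    also have "\<dots> \<longleftrightarrow> (1 / of_nat q) *s (B center + \<tau>) = ?c"
      using q conj[of ?c] by (simp add: inj)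
    also have "\<dots> \<longleftrightarrow> B center + \<tau> = center"
      unfolding vector_mul_lcancel using q by simp
    finally show ?thesis .
  qed
  have scale: "(1 / of_nat q) *s v \<in> A \<longleftrightarrow> v \<in> alcove \<Delta> \<alpha>\<^sub>0" for v
    using q by (simp add: A_def)
  show ?thesis
  proof
    assume "f ` ?\<omega> ` A = ?\<omega> ` A"
    then obtain x where x: "x \<in> A" "f (?\<omega> ?c) = ?\<omega> x" using cA by blast
    then have "x = (1 / of_nat q) *s (B center + \<tau>)"
      using conj[of ?c] q by (simp add: inj)
    then have "B center + \<tau> \<in> alcove \<Delta> \<alpha>\<^sub>0" using x(1) scale by metis
    then have "B center + \<tau> = center" by (rule center_fixed[OF BW \<tau>])
    then show "?\<omega> ?c \<in> fixed_points" by (simp only: fixed)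
  next
    assume "?\<omega> ?c \<in> fixed_points"
    then have Bc: "B center + \<tau> = center" by (simp only: fixed)
    \<comment> \<open>The inverse map is extended affine as well and fixes \<open>center\<close>, so
      it also keeps the alcove inside itself; this gives equality of the two sets instead of one
      inclusion.\<close>
    have iB: "inv B \<in> W" by (rule W_inv[OF BW])
    have "inv B (B center + \<tau>) = inv B center" using Bc by simp
    then have iBc: "inv B center + (- inv B \<tau>) = center"
      by (simp add: W_add[OF iB] W_inv_left[OF BW] algebra_simps)
    have "- inv B \<tau> \<in> coweight_lattice"
      using coweight_lattice_scale[of "- 1" "inv B \<tau>"] W_coweight_lattice[OF iB \<tau>] by simp
    note stay = image_stays_inside[OF BW \<tau> center_interior, of 1]
      image_stays_inside[OF iB this center_interior, of 1]
    have c1: "center \<in> dilated 1"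
      using center_interior by (simp add: interior_alcove_iff alcove_eq_dilated)
    have 1: "B v + \<tau> \<in> alcove \<Delta> \<alpha>\<^sub>0" if "v \<in> alcove \<Delta> \<alpha>\<^sub>0" for v
      using stay(1)[of v] that Bc c1 by (simp add: alcove_eq_dilated)
    have 2: "inv B v - inv B \<tau> \<in> alcove \<Delta> \<alpha>\<^sub>0" if "v \<in> alcove \<Delta> \<alpha>\<^sub>0" for v
      using stay(2)[of v] that iBc c1 by (simp add: alcove_eq_dilated)
    show "f ` ?\<omega> ` A = ?\<omega> ` A"
    proof (intro equalityI subsetI)
      fix y assume "y \<in> f ` ?\<omega> ` A"
      then obtain v where "v \<in> A" "y = f (?\<omega> v)" by blast
      then have "(1 / of_nat q) *s (B (of_nat q *s v) + \<tau>) \<in> A"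
        using 1[of "of_nat q *s v"] scale unfolding A_def by blast
      then show "y \<in> ?\<omega> ` A" using \<open>y = f (?\<omega> v)\<close> conj[of v] by blast
    next
      fix y assume "y \<in> ?\<omega> ` A"
      then obtain v where v: "v \<in> A" "y = ?\<omega> v" by blast
      define u where "u = (1 / of_nat q) *s (inv B (of_nat q *s v) - inv B \<tau>)"
      have "u \<in> A" using 2[of "of_nat q *s v"] v(1) scale unfolding u_def A_def by blast
      moreover have "of_nat q *s u = inv B (of_nat q *s v) - inv B \<tau>"
        using q by (simp add: u_def vec_eq_iff)
      then have "B (of_nat q *s u) + \<tau> = of_nat q *s v"
        by (simp add: W_diff[OF BW] W_inv_right[OF BW])
      then have "f (?\<omega> u) = ?\<omega> ((1 / of_nat q) *s (of_nat q *s v))"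
        using conj[of u] by simp
      then have "f (?\<omega> u) = y" using q v(2) by (simp add: vector_smult_assoc)
      ultimately show "y \<in> f ` ?\<omega> ` A" by blast
    qed
  qed
qed

end

section \<open>The Frobenius map\<close>

locale frobenius_datum = based_root_datum \<Phi> coroot \<Delta> \<alpha>\<^sub>0
  for \<Phi> :: "(rat ^ 'n) set" and coroot \<Delta> \<alpha>\<^sub>0 +
  fixes \<rho> F\<^sub>0 F :: "rat ^ 'n \<Rightarrow> rat ^ 'n" and q :: nat
  assumes symmetry: "dynkin_symmetry coroot \<Delta> \<rho>"
    and F0_linear: "Vector_Spaces.linear (*s) (*s) F\<^sub>0"
    and F0_coweight: "\<forall>\<beta>\<in>\<Delta>. F\<^sub>0 (fund_coweight \<Delta> \<beta>) = fund_coweight \<Delta> (inv_into \<Delta> \<rho> \<beta>)"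
    and F_eq: "F = (\<lambda>v. of_nat q *s F\<^sub>0 v)"
    and q_pos: "q > 0"
begin

lemmas F0_add = vec.linear_add[OF F0_linear] and F0_diff = vec.linear_diff[OF F0_linear]
  and F0_scale = vec.linear_scale[OF F0_linear] and F0_sum = vec.linear_sum[OF F0_linear]

lemma \<rho>_bij: "bij_betw \<rho> \<Delta> \<Delta>"
  and \<rho>_cartan: "\<alpha> \<in> \<Delta> \<Longrightarrow> \<beta> \<in> \<Delta> \<Longrightarrow> pairing (\<rho> \<alpha>) (coroot (\<rho> \<beta>)) = pairing \<alpha> (coroot \<beta>)"
  using symmetry unfolding dynkin_symmetry_def by auto

lemma \<rho>_in: "\<alpha> \<in> \<Delta> \<Longrightarrow> \<rho> \<alpha> \<in> \<Delta>" and inv_\<rho>_in: "\<alpha> \<in> \<Delta> \<Longrightarrow> inv_into \<Delta> \<rho> \<alpha> \<in> \<Delta>"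
  and \<rho>_inv: "\<alpha> \<in> \<Delta> \<Longrightarrow> \<rho> (inv_into \<Delta> \<rho> \<alpha>) = \<alpha>"
  and inv_\<rho>: "\<alpha> \<in> \<Delta> \<Longrightarrow> inv_into \<Delta> \<rho> (\<rho> \<alpha>) = \<alpha>"
  using \<rho>_bij bij_betw_inv_into_left bij_betw_inv_into_right bij_betwE bij_betw_inv_into by metis+

lemma coweight_expansion: "v = (\<Sum>\<alpha>\<in>\<Delta>. pairing \<alpha> v *s coweight \<alpha>)"
proof (rule eq_on_simple)
  fix \<beta> assume "\<beta> \<in> \<Delta>"
  then show "pairing \<beta> v = pairing \<beta> (\<Sum>\<alpha>\<in>\<Delta>. pairing \<alpha> v *s coweight \<alpha>)"
    using finite_simple by (simp add: pairing_sum_right pairing_coweight if_distrib sum.delta' cong: if_cong)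
qed

lemma pairing_F0: "\<alpha> \<in> \<Delta> \<Longrightarrow> pairing \<alpha> (F\<^sub>0 v) = pairing (\<rho> \<alpha>) v"
proof -
  assume \<alpha>: "\<alpha> \<in> \<Delta>"
  have "F\<^sub>0 v = (\<Sum>\<beta>\<in>\<Delta>. pairing \<beta> v *s F\<^sub>0 (coweight \<beta>))"
    by (subst coweight_expansion) (simp add: F0_sum F0_scale)
  then have "pairing \<alpha> (F\<^sub>0 v) = (\<Sum>\<beta>\<in>\<Delta>. pairing \<beta> v * pairing \<alpha> (coweight (inv_into \<Delta> \<rho> \<beta>)))"
    using F0_coweight by (simp add: pairing_sum_right)
  also have "\<dots> = (\<Sum>\<beta>\<in>\<Delta>. if \<beta> = \<rho> \<alpha> then pairing \<beta> v else 0)"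
    by (intro sum.cong refl) (use \<alpha> in \<open>auto simp: pairing_coweight inv_\<rho>_in \<rho>_inv inv_\<rho>\<close>)
  also have "\<dots> = pairing (\<rho> \<alpha>) v" using finite_simple \<rho>_in[OF \<alpha>] by (simp add: sum.delta)
  finally show ?thesis .
qed

lemma F0_inj: "F\<^sub>0 u = F\<^sub>0 v \<Longrightarrow> u = v"
  by (rule eq_on_simple) (metis pairing_F0 inv_\<rho>_in \<rho>_inv)

lemma F0_coroot: "\<alpha> \<in> \<Delta> \<Longrightarrow> F\<^sub>0 (coroot (\<rho> \<alpha>)) = coroot \<alpha>"
  by (rule eq_on_simple) (simp add: pairing_F0 \<rho>_cartan)

lemma F0_root_refl: "\<alpha> \<in> \<Delta> \<Longrightarrow> F\<^sub>0 (root_refl coroot (\<rho> \<alpha>) v) = root_refl coroot \<alpha> (F\<^sub>0 v)"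
  by (simp add: root_refl_def F0_diff F0_scale F0_coroot pairing_F0)

text \<open>\<open>F\<^sub>0\<close> intertwines the reflection in the image of a simple root under
  \<rho> with the reflection in that root, so elements of W can be moved past it.\<close>

lemma F0_W: "u \<in> refl_group coroot \<Delta> \<Longrightarrow> \<exists>u'\<in>refl_group coroot \<Delta>. \<forall>v. u (F\<^sub>0 v) = F\<^sub>0 (u' v)"
proof (induction rule: refl_group_induct)
  case id
  show ?case by (rule bexI[OF _ id_in_refl_group]) simp
next
  case (comp \<alpha> u)
  then obtain u' where u': "u' \<in> refl_group coroot \<Delta>" "\<forall>v. u (F\<^sub>0 v) = F\<^sub>0 (u' v)" by blast
  have "root_refl coroot (\<rho> \<alpha>) \<circ> u' \<in> refl_group coroot \<Delta>"
    by (intro refl_group_comp root_refl_in_refl_group \<rho>_in comp u')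
  then show ?case
    by (rule bexI[rotated]) (simp add: u'(2) F0_root_refl[OF comp(1)])
qed

text \<open>\<rho> is given on simple roots only. Writing \<gamma> as a conjugate of a simple root
  and moving \<open>F\<^sub>0\<close> past the conjugating element extends the action to
  roots.\<close>

lemma F0_root:
  assumes "\<gamma> \<in> \<Phi>" "0 < pairing \<gamma> center"
  shows "\<exists>\<delta>\<in>\<Phi>. \<forall>v. pairing \<gamma> (F\<^sub>0 v) = pairing \<delta> v"
proof -
  obtain u \<alpha> where u: "u \<in> refl_group coroot \<Delta>" "\<alpha> \<in> \<Delta>" "\<And>v. pairing \<gamma> (u v) = pairing \<alpha> v"
    using positive_root_conjugate[OF assms] by blast
  have iu: "inv u \<in> refl_group coroot \<Delta>" and uW: "u \<in> W"
    using refl_group_bij_inv[OF simple_subset u(1)] u(1) simple_group_subset by auto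
  obtain u' where u': "u' \<in> refl_group coroot \<Delta>" "\<And>v. inv u (F\<^sub>0 v) = F\<^sub>0 (u' v)"
    using F0_W[OF iu] by blast
  have "pairing \<gamma> (F\<^sub>0 v) = pairing (\<rho> \<alpha>) (u' v)" for v
    by (metis u(3) W_inv_right[OF uW] u'(2) pairing_F0[OF u(2)])
  moreover have "u' \<in> W" using u'(1) simple_group_subset by auto
  ultimately show ?thesis using W_root[of u' "\<rho> \<alpha>"] \<rho>_in[OF u(2)] by auto
qed

text \<open>Composing the highest root with \<open>F\<^sub>0\<close> gives a root of the same
  height, since the fundamental coweights are permuted. No coefficient can exceed that of the
  highest root, so equal height forces equality.\<close>

lemma pairing_highest_F0: "pairing \<alpha>\<^sub>0 (F\<^sub>0 v) = pairing \<alpha>\<^sub>0 v"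
proof -
  have "0 < pairing \<alpha>\<^sub>0 center"
    using root_sign[OF highest_in_roots center_interior] mark_ge_1
    by (meson order_trans zero_le_one)
  then obtain \<delta> where \<delta>: "\<delta> \<in> \<Phi>" "\<And>v. pairing \<alpha>\<^sub>0 (F\<^sub>0 v) = pairing \<delta> v"
    using F0_root[OF highest_in_roots] by blast
  let ?n = "\<lambda>\<gamma> \<alpha>. pairing \<gamma> (coweight \<alpha>)"
  have "(\<Sum>\<beta>\<in>\<Delta>. ?n \<delta> \<beta>) = (\<Sum>\<beta>\<in>\<Delta>. ?n \<alpha>\<^sub>0 (inv_into \<Delta> \<rho> \<beta>))"
    using \<delta>(2)[symmetric] F0_coweight by simp
  also have "\<dots> = (\<Sum>\<beta>\<in>\<Delta>. ?n \<alpha>\<^sub>0 \<beta>)"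
    by (rule sum.reindex_bij_betw[OF bij_betw_inv_into[OF \<rho>_bij]])
  finally have "(\<Sum>\<beta>\<in>\<Delta>. ?n \<alpha>\<^sub>0 \<beta> - ?n \<delta> \<beta>) = 0" by (simp add: sum_subtractf)
  then have "?n \<alpha>\<^sub>0 \<beta> - ?n \<delta> \<beta> = 0" if "\<beta> \<in> \<Delta>" for \<beta>
    using that finite_simple root_le_highest[OF \<delta>(1)]
      sum_nonneg_eq_0_iff[of \<Delta> "\<lambda>\<beta>. ?n \<alpha>\<^sub>0 \<beta> - ?n \<delta> \<beta>"] by auto
  then have "\<alpha>\<^sub>0 = \<delta>"
    by (subst (1 2) simple_expansion) simp
  then show ?thesis using \<delta>(2) by simp
qed

lemma alcove_q_eq: "alcove_q \<Delta> \<alpha>\<^sub>0 F = {v. of_nat q *s v \<in> alcove \<Delta> \<alpha>\<^sub>0}"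
proof -
  have "(\<forall>\<alpha>\<in>\<Delta>. 0 \<le> pairing (\<rho> \<alpha>) v) \<longleftrightarrow> (\<forall>\<alpha>\<in>\<Delta>. 0 \<le> pairing \<alpha> v)" for v
    using \<rho>_in inv_\<rho>_in \<rho>_inv by metis
  then show ?thesis
    using q_pos by (auto simp: alcove_q_def alcove_def F_eq pairing_F0 pairing_highest_F0 zero_le_mult_iff)
qed

lemma F0_lattice: "F\<^sub>0 u \<in> Q \<longleftrightarrow> u \<in> Q"
proof
  assume "u \<in> Q"
  then show "F\<^sub>0 u \<in> Q"
  proof (induction rule: lattice_induct)
    case zero
    then show ?case using vec.linear_0[OF F0_linear] lattice_zero by simp
  next
    case (add u \<alpha>)
    then show ?case
      using F0_coroot[OF inv_\<rho>_in[OF add(2)]] lattice_simple[OF inv_\<rho>_in[OF add(2)]]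
      by (simp add: F0_add \<rho>_inv lattice_add)
  next
    case (diff u \<alpha>)
    then show ?case
      using F0_coroot[OF inv_\<rho>_in[OF diff(2)]] lattice_simple[OF inv_\<rho>_in[OF diff(2)]]
      by (simp add: F0_diff \<rho>_inv lattice_diff)
  qed
next
  have surj: "\<exists>u\<in>Q. F\<^sub>0 u = x" if "x \<in> Q" for x
    using that
  proof (induction rule: lattice_induct)
    case zero
    then show ?case using vec.linear_0[OF F0_linear] lattice_zero by blast
  next
    case (add x \<alpha>)
    then obtain u where "u \<in> Q" "F\<^sub>0 u = x" by blast
    then show ?case
      using add lattice_simple[OF \<rho>_in[OF add(2)]]
      by (intro bexI[of _ "u + coroot (\<rho> \<alpha>)"]) (auto simp: F0_add F0_coroot lattice_add)
  next
    case (diff x \<alpha>)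
    then obtain u where "u \<in> Q" "F\<^sub>0 u = x" by blast
    then show ?case
      using diff lattice_simple[OF \<rho>_in[OF diff(2)]]
      by (intro bexI[of _ "u - coroot (\<rho> \<alpha>)"]) (auto simp: F0_diff F0_coroot lattice_diff)
  qed
  assume "F\<^sub>0 u \<in> Q"
  then show "u \<in> Q" using surj F0_inj by metis
qed

lemma F_lattice: "F t \<in> Q \<longleftrightarrow> of_nat q *s t \<in> Q"
  using F0_lattice[of "of_nat q *s t"] by (simp add: F_eq F0_scale)

end

section \<open>Passing from small alcoves to stable alcoves of level q\<close>

locale minuscule_frobenius_datum = frobenius_datum +
  fixes \<alpha>
  assumes minuscule: "\<alpha> \<in> minuscule_roots \<Delta> \<alpha>\<^sub>0"
begin

sublocale alcove_automorphism \<Phi> coroot \<Delta> \<alpha>\<^sub>0 "z_elt \<Phi> coroot \<Delta> \<alpha>"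
proof
  note f = f_map_fixes_center[OF minuscule]
  show "z_elt \<Phi> coroot \<Delta> \<alpha> \<in> W" by (rule f(1))
  have "center - z_elt \<Phi> coroot \<Delta> \<alpha> center = ext_coweight \<Delta> \<alpha>\<^sub>0 \<alpha>"
    using f(3) unfolding f_map_def by (metis add_diff_cancel_left')
  then show "center - z_elt \<Phi> coroot \<Delta> \<alpha> center \<in> coweight_lattice" using f(2) by simp
qed

lemma f_map_eq: "f_map \<Phi> coroot \<Delta> \<alpha>\<^sub>0 \<alpha> v = z_elt \<Phi> coroot \<Delta> \<alpha> (v - center) + center"
  using f_map_fixes_center(3)[OF minuscule] by (simp add: f_map_def z_diff algebra_simps)

lemma fixed_space_eq: "fixed_space \<Phi> coroot \<Delta> \<alpha>\<^sub>0 \<alpha> = fixed_points"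
  unfolding fixed_space_def fixed_points_def f_map_eq by (auto simp: algebra_simps)

text \<open>Inclusion in the alcove and stability are both decided at the center of the small
  alcove, and multiplication by \<open>q\<close> turns these two conditions into those of
  \<open>stable\<close>.\<close>

lemma M_q_iff_stable:
  assumes w: "w \<in> W" and t: "of_nat q *s t \<in> Q"
  shows "(\<lambda>v. w v + t) \<in> M_q \<Phi> coroot \<Delta> \<alpha>\<^sub>0 F \<alpha> \<longleftrightarrow> dilate q (\<lambda>v. w v + t) \<in> stable q"
proof -
  let ?\<omega> = "\<lambda>v. w v + t" and ?y = "w ((1 / of_nat q) *s center) + t"
  let ?A = "{v. of_nat q *s v \<in> alcove \<Delta> \<alpha>\<^sub>0}"
  have dil: "dilate q ?\<omega> v = w v + of_nat q *s t" for v
    by (rule dilate_affine[OF q_pos w])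
  have y: "of_nat q *s ?y = w center + of_nat q *s t"
    using q_pos by (simp add: W_scale[OF w] vec_eq_iff algebra_simps)
  have y': "?y = (1 / of_nat q) *s (w center + of_nat q *s t)"
    using q_pos by (simp add: y[symmetric] vec_eq_iff)
  have tP: "of_nat q *s t \<in> coweight_lattice" using t lattice_subset_coweight_lattice by auto
  have inside: "?\<omega> ` ?A \<subseteq> alcove \<Delta> \<alpha>\<^sub>0 \<longleftrightarrow> w center + of_nat q *s t \<in> dilated (of_nat q)"
  proof
    assume "?\<omega> ` ?A \<subseteq> alcove \<Delta> \<alpha>\<^sub>0"
    moreover have "(1 / of_nat q) *s center \<in> ?A"
      using center_interior q_pos by (simp add: interior_alcove_iff)
    ultimately have "?y \<in> dilated 1" by (auto simp: alcove_eq_dilated)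
    then show "w center + of_nat q *s t \<in> dilated (of_nat q)"
      using dilated_scale[OF q_pos, of 1] unfolding y' by (metis of_nat_1 zero_less_one mult_1)
  next
    assume c: "w center + of_nat q *s t \<in> dilated (of_nat q)"
    show "?\<omega> ` ?A \<subseteq> alcove \<Delta> \<alpha>\<^sub>0"
    proof clarify
      fix v assume "of_nat q *s v \<in> alcove \<Delta> \<alpha>\<^sub>0"
      then have "w (of_nat q *s v) + of_nat q *s t \<in> dilated (of_nat (1 * q))"
        using image_stays_inside[OF w tP center_interior _ c] by simp
      then have "(1 / of_nat q) *s (w (of_nat q *s v) + of_nat q *s t) \<in> dilated (of_nat 1)"
        using dilated_scale[OF q_pos, of 1] by (metis zero_less_one)
      moreover have "(1 / of_nat q) *s (w (of_nat q *s v) + of_nat q *s t) = w v + t"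
        using q_pos by (simp add: W_scale[OF w] vec_eq_iff)
      ultimately show "w v + t \<in> alcove \<Delta> \<alpha>\<^sub>0" by (simp add: alcove_eq_dilated)
    qed
  qed
  have "?\<omega> \<in> affine_weyl_q \<Phi> coroot \<Delta> F"
    using w t unfolding affine_weyl_q_def by (auto simp: F_lattice)
  moreover have "dilate q ?\<omega> \<in> affine_weyl" by (rule affine_weylI[OF w t]) (rule dil)
  ultimately show ?thesis
    using image_stable_iff[OF q_pos w t f_map_eq] inside fixed_points_scale[OF q_pos, of ?y] y
    by (simp add: M_q_def E_q_def stable_def alcove_q_eq dil)
qed

lemma bij_betw_M_q_stable: "bij_betw (dilate q) (M_q \<Phi> coroot \<Delta> \<alpha>\<^sub>0 F \<alpha>) (stable q)"
  unfolding bij_betw_def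
proof
  have "\<eta> = \<theta>" if "dilate q \<eta> = dilate q \<theta>" for \<eta> \<theta>
  proof
    fix v show "\<eta> v = \<theta> v"
      using fun_cong[OF that, of "of_nat q *s v"] q_pos by (simp add: dilate_def vec_eq_iff)
  qed
  then show "inj_on (dilate q) (M_q \<Phi> coroot \<Delta> \<alpha>\<^sub>0 F \<alpha>)" by (rule inj_onI)
  show "dilate q ` M_q \<Phi> coroot \<Delta> \<alpha>\<^sub>0 F \<alpha> = stable q"
  proof (intro equalityI subsetI)
    fix \<eta> assume "\<eta> \<in> dilate q ` M_q \<Phi> coroot \<Delta> \<alpha>\<^sub>0 F \<alpha>"
    then obtain \<omega> where \<omega>: "\<omega> \<in> M_q \<Phi> coroot \<Delta> \<alpha>\<^sub>0 F \<alpha>" "\<eta> = dilate q \<omega>" by blast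
    then obtain w t where "w \<in> W" "F t \<in> Q" "\<omega> = (\<lambda>v. w v + t)"
      unfolding M_q_def E_q_def affine_weyl_q_def by blast
    then show "\<eta> \<in> stable q" using M_q_iff_stable[of w t] \<omega> by (simp add: F_lattice)
  next
    fix \<eta> assume \<eta>: "\<eta> \<in> stable q"
    then have "\<eta> \<in> affine_weyl" by (simp add: stable_def)
    then obtain w s where w: "w \<in> W" "s \<in> Q" "\<eta> = (\<lambda>v. w v + s)" by (rule affine_weylE)
    define t where "t = (1 / of_nat q) *s s"
    have qt: "of_nat q *s t = s" using q_pos by (simp add: t_def vec_eq_iff)
    then have "dilate q (\<lambda>v. w v + t) = \<eta>"
      using dilate_affine[OF q_pos w(1), of t] by (simp add: fun_eq_iff w(3))
    moreover from this have "(\<lambda>v. w v + t) \<in> M_q \<Phi> coroot \<Delta> \<alpha>\<^sub>0 F \<alpha>"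
      using M_q_iff_stable[OF w(1), of t] qt w(2) \<eta> by simp
    ultimately show "\<eta> \<in> dilate q ` M_q \<Phi> coroot \<Delta> \<alpha>\<^sub>0 F \<alpha>" by blast
  qed
qed

lemma card_M_q:
  assumes "q \<ge> 2"
  shows "finite (M_q \<Phi> coroot \<Delta> \<alpha>\<^sub>0 F \<alpha>)"
    and "H \<in> hyperplanes_q \<Phi> q \<Longrightarrow> fixed_space \<Phi> coroot \<Delta> \<alpha>\<^sub>0 \<alpha> \<subseteq> H \<Longrightarrow>
      card (M_q \<Phi> coroot \<Delta> \<alpha>\<^sub>0 F \<alpha>) = 0"
    and "\<nexists>H. H \<in> hyperplanes_q \<Phi> q \<and> fixed_space \<Phi> coroot \<Delta> \<alpha>\<^sub>0 \<alpha> \<subseteq> H \<Longrightarrow>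
      card (M_q \<Phi> coroot \<Delta> \<alpha>\<^sub>0 F \<alpha>) = q ^ affine_dim (fixed_space \<Phi> coroot \<Delta> \<alpha>\<^sub>0 \<alpha>)"
proof -
  have card: "card (M_q \<Phi> coroot \<Delta> \<alpha>\<^sub>0 F \<alpha>) = card (stable q)"
    by (rule bij_betw_same_card[OF bij_betw_M_q_stable])
  show "finite (M_q \<Phi> coroot \<Delta> \<alpha>\<^sub>0 F \<alpha>)"
    using bij_betw_finite[OF bij_betw_M_q_stable] card_stable_le[OF q_pos] by blast
  show "card (M_q \<Phi> coroot \<Delta> \<alpha>\<^sub>0 F \<alpha>) = 0"
    if "H \<in> hyperplanes_q \<Phi> q" "fixed_space \<Phi> coroot \<Delta> \<alpha>\<^sub>0 \<alpha> \<subseteq> H"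
    using stable_empty[OF q_pos that(1)] that(2) by (simp add: card fixed_space_eq)
  show "card (M_q \<Phi> coroot \<Delta> \<alpha>\<^sub>0 F \<alpha>) = q ^ affine_dim (fixed_space \<Phi> coroot \<Delta> \<alpha>\<^sub>0 \<alpha>)"
    if "\<nexists>H. H \<in> hyperplanes_q \<Phi> q \<and> fixed_space \<Phi> coroot \<Delta> \<alpha>\<^sub>0 \<alpha> \<subseteq> H"
  proof -
    have "stable q \<noteq> {}"
      by (rule stable_nonempty[OF q_pos]) (use that in \<open>auto simp: fixed_space_eq\<close>)
    then show ?thesis
      using card_stable[OF assms] by (simp add: card fixed_space_eq affine_dim_fixed_points)
  qed
qed

end

theorem theorem2p5:
  fixes \<Phi> \<Delta> :: "(rat ^ 'n) set"
    and coroot \<rho> F\<^sub>0 F :: "rat ^ 'n \<Rightarrow> rat ^ 'n"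
    and \<alpha>\<^sub>0 \<alpha> :: "rat ^ 'n"
    and p e q :: nat
  assumes "prime p" and "e > 0" and "q = p ^ e"
    and "semisimple_root_datum \<Phi> coroot"
    and "irreducible_roots \<Phi> coroot"
    and "simple_roots \<Phi> \<Delta>"
    and "highest_root \<Phi> \<Delta> \<alpha>\<^sub>0"
    and "dynkin_symmetry coroot \<Delta> \<rho>"
    and "Vector_Spaces.linear (*s) (*s) F\<^sub>0"
    and "\<forall>\<beta>\<in>\<Delta>. F\<^sub>0 (fund_coweight \<Delta> \<beta>) = fund_coweight \<Delta> (inv_into \<Delta> \<rho> \<beta>)"
    and "F = (\<lambda>v. of_nat q *s F\<^sub>0 v)"
    and "F ` integral_vectors \<subseteq> integral_vectors"
    and "\<alpha> \<in> minuscule_roots \<Delta> \<alpha>\<^sub>0"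
  shows "finite (M_q \<Phi> coroot \<Delta> \<alpha>\<^sub>0 F \<alpha>) \<and>
    ((\<exists>H\<in>hyperplanes_q \<Phi> q. fixed_space \<Phi> coroot \<Delta> \<alpha>\<^sub>0 \<alpha> \<subseteq> H) \<longrightarrow>
       card (M_q \<Phi> coroot \<Delta> \<alpha>\<^sub>0 F \<alpha>) = 0) \<and>
    ((\<nexists>H. H \<in> hyperplanes_q \<Phi> q \<and> fixed_space \<Phi> coroot \<Delta> \<alpha>\<^sub>0 \<alpha> \<subseteq> H) \<longrightarrow>
       card (M_q \<Phi> coroot \<Delta> \<alpha>\<^sub>0 F \<alpha>) = q ^ affine_dim (fixed_space \<Phi> coroot \<Delta> \<alpha>\<^sub>0 \<alpha>))"
proof -
  \<comment> \<open>The comparison of growth rates needs \<open>q\<close> at least 2, so that its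
    powers are unbounded.\<close>
  have "p \<ge> 2" using assms(1) by (rule prime_ge_2_nat)
  moreover have "p ^ 1 \<le> p ^ e"
    using assms(2) \<open>p \<ge> 2\<close> by (intro power_increasing) auto
  ultimately have q: "q \<ge> 2" using assms(3) by simp
  then have "q > 0" by simp
  then interpret minuscule_frobenius_datum \<Phi> coroot \<Delta> \<alpha>\<^sub>0 \<rho> F\<^sub>0 F q \<alpha>
    using assms(4,6-11,13)
    by (intro minuscule_frobenius_datum.intro minuscule_frobenius_datum_axioms.intro
        frobenius_datum.intro frobenius_datum_axioms.intro
        based_root_datum.intro based_root_datum_axioms.intro) auto
  show ?thesis using card_M_q[OF q] by blast
qed

end
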